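(* The problem 3-Colouring Reconfiguration can be solved in time $O(n+m)$, where $n$ and $m$ are the numbers of vertices and edges of the input graph $G$.
   Context: For a graph $G=(V,E)$ and positive integer $k$, a $k$-colouring is a map $c:V\to\{1,\dots,k\}$; it is proper if $c(u)\neq c(v)$ for every edge $uv\in E$. The $k$-colouring reconfiguration graph $R_k(G)$ has as vertices the proper $k$-colourings of $G$, two being adjacent if and only if they differ on exactly one vertex of $G$. The problem $k$-Colouring Reconfiguration: given an $n$-vertex, $m$-edge graph $G$, two proper $k$-colourings $\alpha,\beta$ of $G$ and a positive integer $\ell$, decide whether there is a path in $R_k(G)$ between $\alpha$ and $\beta$ of length at most $\ell$. Here $k=3$. *)

theory Defs
  imports Main "HOL-Library.FuncSet"
begin

section \<open>Graphs, paths and colouring reconfiguration\<close>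

type_synonym 'v graph = "'v set \<times> 'v set set"

abbreviation verts :: "'v graph \<Rightarrow> 'v set" where "verts G \<equiv> fst G"

abbreviation edges :: "'v graph \<Rightarrow> 'v set set" where "edges G \<equiv> snd G"

definition simple_graph :: "'v graph \<Rightarrow> bool" where
  "simple_graph G \<longleftrightarrow> finite (verts G) \<and> (\<forall>e\<in>edges G. e \<subseteq> verts G \<and> card e = 2)"

text \<open>A path is given by its list of vertices, so its length (number of edges) is
  one less than the length of the list.\<close>

definition is_path :: "'v graph \<Rightarrow> 'v \<Rightarrow> 'v list \<Rightarrow> 'v \<Rightarrow> bool" where
  "is_path G x p y \<longleftrightarrow>
     p \<noteq> [] \<and> hd p = x \<and> last p = y \<and> set p \<subseteq> verts G \<and> distinct p \<and>
     (\<forall>i. Suc i < length p \<longrightarrow> {p ! i, p ! Suc i} \<in> edges G)"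

definition path_length :: "'v list \<Rightarrow> nat" where
  "path_length p = length p - 1"

text \<open>Colourings are extensional functions on the vertex set, so that two of them
  are equal iff they agree on all vertices of the graph.\<close>

definition colourings :: "nat \<Rightarrow> 'v graph \<Rightarrow> ('v \<Rightarrow> nat) set" where
  "colourings k G = verts G \<rightarrow>\<^sub>E {1..k}"

definition proper_colourings :: "nat \<Rightarrow> 'v graph \<Rightarrow> ('v \<Rightarrow> nat) set" where
  "proper_colourings k G =
     {c \<in> colourings k G. \<forall>u v. {u, v} \<in> edges G \<longrightarrow> c u \<noteq> c v}"

definition reconf_graph :: "nat \<Rightarrow> 'v graph \<Rightarrow> ('v \<Rightarrow> nat) graph" where
  "reconf_graph k G =
     (proper_colourings k G,
      {{c, d} | c d. c \<in> proper_colourings k G \<and> d \<in> proper_colourings k G \<and>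
                     (\<exists>!v. v \<in> verts G \<and> c v \<noteq> d v)})"

definition colouring_reconfiguration ::
    "nat \<Rightarrow> 'v graph \<Rightarrow> ('v \<Rightarrow> nat) \<Rightarrow> ('v \<Rightarrow> nat) \<Rightarrow> nat \<Rightarrow> bool" where
  "colouring_reconfiguration k G \<alpha> \<beta> l \<longleftrightarrow>
     (\<exists>p. is_path (reconf_graph k G) \<alpha> p \<beta> \<and> path_length p \<le> l)"


section \<open>A random access machine\<close>

text \<open>The machine model is a word RAM with structured control flow. The memory consists
  of arrays of natural numbers; array names are constants of the program, so a program
  uses only finitely many arrays, while indices are computed, which gives indirect addressing.
  The arithmetic operations are addition and truncated subtraction.\<close>

type_synonym memory = "nat \<Rightarrow> nat \<Rightarrow> nat"

datatype expr = Const nat | Cell nat expr | Plus expr expr | Minus expr expr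

datatype com =
    Skip
  | Assign nat expr expr
  | Seq com com
  | If expr com com
  | While expr com

primrec eval_expr :: "memory \<Rightarrow> expr \<Rightarrow> nat" where
  "eval_expr s (Const n) = n"
| "eval_expr s (Cell a i) = s a (eval_expr s i)"
| "eval_expr s (Plus d e) = eval_expr s d + eval_expr s e"
| "eval_expr s (Minus d e) = eval_expr s d - eval_expr s e"

text \<open>Every value and every address occurring during an evaluation must fit into a machine
  word, that is, be at most \<open>W\<close>. This rules out the well-known abuse of unit cost
  arithmetic on very large numbers.\<close>

primrec fits :: "nat \<Rightarrow> memory \<Rightarrow> expr \<Rightarrow> bool" where
  "fits W s (Const n) \<longleftrightarrow> n \<le> W"
| "fits W s (Cell a i) \<longleftrightarrow> fits W s i \<and> s a (eval_expr s i) \<le> W"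
| "fits W s (Plus d e) \<longleftrightarrow> fits W s d \<and> fits W s e \<and> eval_expr s d + eval_expr s e \<le> W"
| "fits W s (Minus d e) \<longleftrightarrow> fits W s d \<and> fits W s e"

primrec expr_cost :: "expr \<Rightarrow> nat" where
  "expr_cost (Const n) = 1"
| "expr_cost (Cell a i) = 1 + expr_cost i"
| "expr_cost (Plus d e) = 1 + expr_cost d + expr_cost e"
| "expr_cost (Minus d e) = 1 + expr_cost d + expr_cost e"

text \<open>\<open>exec W P s t s'\<close>: with word bound \<open>W\<close>, program \<open>P\<close> started in memory \<open>s\<close>
  halts after exactly \<open>t\<close> elementary steps in memory \<open>s'\<close>. There is no derivation if \<open>P\<close>
  diverges or exceeds the word bound. \<open>Assign a i e\<close> stores the value of \<open>e\<close> in cell \<open>i\<close> of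
  array \<open>a\<close>; a test succeeds iff its value is nonzero.\<close>

inductive exec :: "nat \<Rightarrow> com \<Rightarrow> memory \<Rightarrow> nat \<Rightarrow> memory \<Rightarrow> bool" for W :: nat where
  Skip: "exec W Skip s 1 s"
| Assign: "fits W s i \<Longrightarrow> fits W s e \<Longrightarrow>
    exec W (Assign a i e) s (1 + expr_cost i + expr_cost e)
      (s(a := (s a)(eval_expr s i := eval_expr s e)))"
| Seq: "exec W c s t s' \<Longrightarrow> exec W d s' u s'' \<Longrightarrow> exec W (Seq c d) s (1 + t + u) s''"
| IfTrue: "fits W s e \<Longrightarrow> eval_expr s e \<noteq> 0 \<Longrightarrow> exec W c s t s' \<Longrightarrow>
    exec W (If e c d) s (1 + expr_cost e + t) s'"
| IfFalse: "fits W s e \<Longrightarrow> eval_expr s e = 0 \<Longrightarrow> exec W d s t s' \<Longrightarrow>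
    exec W (If e c d) s (1 + expr_cost e + t) s'"
| WhileTrue: "fits W s e \<Longrightarrow> eval_expr s e \<noteq> 0 \<Longrightarrow> exec W c s t s' \<Longrightarrow>
    exec W (While e c) s' u s'' \<Longrightarrow>
    exec W (While e c) s (1 + expr_cost e + t + u) s''"
| WhileFalse: "fits W s e \<Longrightarrow> eval_expr s e = 0 \<Longrightarrow>
    exec W (While e c) s (1 + expr_cost e) s"


section \<open>Input encoding\<close>

text \<open>The graph, with vertex set \<open>{..<n}\<close>, is stored by adjacency lists: array 2 is the
  concatenation of the adjacency lists of \<open>0, \<dots>, n - 1\<close>, each in arbitrary order, and the
  list of vertex \<open>v\<close> occupies the index range given by cells \<open>v\<close> and \<open>v + 1\<close> of array 1.
  Arrays 3 and 4 hold the colourings and array 0 holds \<open>n\<close>, the number of edges, and the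
  bound \<open>l\<close>. All other cells are initially zero.\<close>

definition adjacency_lists :: "nat graph \<Rightarrow> (nat \<Rightarrow> nat list) \<Rightarrow> bool" where
  "adjacency_lists G adj \<longleftrightarrow>
     (\<forall>v\<in>verts G. distinct (adj v) \<and> set (adj v) = {u. {v, u} \<in> edges G})"

definition cells_of_list :: "nat list \<Rightarrow> nat \<Rightarrow> nat" where
  "cells_of_list xs i = (if i < length xs then xs ! i else 0)"

definition input_memory ::
    "nat graph \<Rightarrow> (nat \<Rightarrow> nat list) \<Rightarrow> (nat \<Rightarrow> nat) \<Rightarrow> (nat \<Rightarrow> nat) \<Rightarrow> nat \<Rightarrow> memory" where
  "input_memory G adj \<alpha> \<beta> l =
     (let n = card (verts G) in
      (\<lambda>_ _. 0)
        (0 := cells_of_list [n, card (edges G), l],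
         1 := cells_of_list (map (\<lambda>v. \<Sum>u<v. length (adj u)) [0..<Suc n]),
         2 := cells_of_list (concat (map adj [0..<n])),
         3 := cells_of_list (map \<alpha> [0..<n]),
         4 := cells_of_list (map \<beta> [0..<n])))"

definition answer :: "memory \<Rightarrow> nat" where
  "answer s = s 0 0"

end

theory Submission
  imports Defs
begin

text \<open>Recolouring a vertex \<open>v\<close> is possible only if all its neighbours have the same colour, and then it
  changes the colour of \<open>v\<close> by \<open>1\<close> or \<open>-1\<close> modulo 3. Let \<open>F v\<close> be the signed number of recolourings
  of \<open>v\<close> on a walk from \<open>a\<close> to \<open>b\<close>. Then \<open>F v\<close> is congruent to \<open>a v - b v\<close> modulo 3, \<open>F\<close> changes by
  at most \<open>1\<close> along every edge, and \<open>F\<close> vanishes on every set of vertices in which each vertex sees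
  both other colours, since no vertex of such a set ever moves. Conversely, if \<open>F\<close> has these
  properties and is not zero, then some vertex can be recoloured so that the sum of all \<open>\<bar>F v\<bar>\<close>
  drops by one. So the distance is the minimum of this sum.

  The congruence and the edge condition determine \<open>F\<close> on a connected component up to a multiple
  of 3. Breadth-first search finds one candidate, the vertices on which \<open>F\<close> must vanish are those
  that survive when vertices lacking a neighbour of one of the other colours are removed repeatedly,
  and the best multiple of 3 for a component is found by sweeping over a histogram of the candidate,
  whose range is at most proportional to the size of the component.\<close>

section \<open>Reconfiguration distance\<close>

text \<open>Locally a proper 3-colouring lifts to integer heights that differ by exactly 1 along
  edges, and a recolouring moves one height by 2, which is 1 or -1 modulo 3. Up to sign,
  \<open>F\<close> is half the difference of two lifts; hence the bound 1 along edges. Around a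
  cycle the heights of a colouring need not close up, so everything is stated for \<open>F\<close>
  and no lift is ever formed. Since -1, 0 and 1 represent all residues, the congruences leave one
  possible value of \<open>F u - F v\<close> on an edge. The search can therefore fix values along
  tree edges alone; whether the other edges agree is tested at the end, and a failure means that no
  shift exists. The machine has only addition and truncated subtraction, so shifts are stored with
  an offset divisible by 3 and residues are looked up. Sums of distances can be quadratic, so every
  phase also proves that its values fit into a word. The optimum of a component is cut off at
  \<open>l + 1\<close>, which also stands for infeasibility and does not affect the comparison of
  the total with \<open>l\<close>.\<close>

definition tight :: "'v graph \<Rightarrow> ('v \<Rightarrow> nat) \<Rightarrow> 'v set \<Rightarrow> bool" where
  "tight G c X \<longleftrightarrow> X \<subseteq> verts G \<and>
     (\<forall>v\<in>X. \<forall>d\<in>{1, 2}. \<exists>u\<in>X. {v, u} \<in> edges G \<and> (int (c u) - int (c v)) mod 3 = d)"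

text \<open>Sign convention: \<open>F v\<close> is what remains to be subtracted from the colour of
  \<open>v\<close> modulo 3, so a positive value asks for lowering the colour.\<close>

definition shift :: "'v graph \<Rightarrow> ('v \<Rightarrow> nat) \<Rightarrow> ('v \<Rightarrow> nat) \<Rightarrow> ('v \<Rightarrow> int) \<Rightarrow> bool" where
  "shift G a b F \<longleftrightarrow>
     (\<forall>v\<in>verts G. 3 dvd int (a v) - F v - int (b v)) \<and>
     (\<forall>u v. {u, v} \<in> edges G \<longrightarrow> \<bar>F u - F v\<bar> \<le> 1)"

definition differ_at :: "'v graph \<Rightarrow> ('v \<Rightarrow> nat) \<Rightarrow> ('v \<Rightarrow> nat) \<Rightarrow> 'v \<Rightarrow> bool" where
  "differ_at G c d v \<longleftrightarrow> v \<in> verts G \<and> c v \<noteq> d v \<and> (\<forall>u. u \<noteq> v \<longrightarrow> c u = d u)"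

lemma differ_at_sym: "differ_at G c d v \<Longrightarrow> differ_at G d c v"
  by (auto simp: differ_at_def)

lemma simple_graph_edgeD:
  assumes "simple_graph G" "{u, v} \<in> edges G"
  shows "u \<in> verts G" "v \<in> verts G" "u \<noteq> v"
  using assms by (fastforce simp: simple_graph_def card_insert_if)+

lemma colour_range: "c \<in> proper_colourings 3 G \<Longrightarrow> v \<in> verts G \<Longrightarrow> c v = 1 \<or> c v = 2 \<or> c v = 3"
  by (fastforce simp: proper_colourings_def colourings_def PiE_iff)

lemma proper_neq: "c \<in> proper_colourings 3 G \<Longrightarrow> {u, v} \<in> edges G \<Longrightarrow> c u \<noteq> c v"
  by (auto simp: proper_colourings_def)

lemma reconf_edge_iff:
  assumes "c \<in> proper_colourings 3 G" "d \<in> proper_colourings 3 G"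
  shows "{c, d} \<in> edges (reconf_graph 3 G) \<longleftrightarrow> (\<exists>v. differ_at G c d v)"
proof -
  have ext: "c u = d u" if "u \<notin> verts G" for u
    using assms that by (simp add: proper_colourings_def colourings_def PiE_iff extensional_def)
  have sym: "(\<exists>!v. v \<in> verts G \<and> c v \<noteq> d v) \<longleftrightarrow> (\<exists>!v. v \<in> verts G \<and> d v \<noteq> c v)"
    by metis
  have "{c, d} \<in> edges (reconf_graph 3 G) \<longleftrightarrow> (\<exists>!v. v \<in> verts G \<and> c v \<noteq> d v)"
    using assms sym by (auto simp: reconf_graph_def doubleton_eq_iff)
  also have "\<dots> \<longleftrightarrow> (\<exists>v. differ_at G c d v)"
  proof
    assume "\<exists>!v. v \<in> verts G \<and> c v \<noteq> d v"
    then obtain v where v: "v \<in> verts G" "c v \<noteq> d v" "\<And>u. u \<in> verts G \<Longrightarrow> c u \<noteq> d u \<Longrightarrow> u = v"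
      by blast
    then have "differ_at G c d v"
      using ext unfolding differ_at_def by blast
    then show "\<exists>v. differ_at G c d v" ..
  next
    assume "\<exists>v. differ_at G c d v"
    then obtain v where "v \<in> verts G" "c v \<noteq> d v" "\<And>u. u \<noteq> v \<Longrightarrow> c u = d u"
      unfolding differ_at_def by blast
    then show "\<exists>!v. v \<in> verts G \<and> c v \<noteq> d v"
      by (intro ex1I[of _ v]) auto
  qed
  finally show ?thesis .
qed

section \<open>Arithmetic of a single recolouring and the lower bound on the distance\<close>

lemma dvd_diff_iff_colour_eq:
  assumes "c \<in> proper_colourings 3 G" "d \<in> proper_colourings 3 G" "u \<in> verts G" "v \<in> verts G"
  shows "3 dvd int (c u) - int (d v) \<longleftrightarrow> c u = d v"
  using colour_range[OF assms(1,3)] colour_range[OF assms(2,4)] by auto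

text \<open>Along an edge, \<open>A\<close>, \<open>B\<close> and \<open>f\<close> are the
  differences of \<open>a\<close>, \<open>b\<close> and \<open>F\<close>. As \<open>A\<close> is
  neither 0 nor \<open>\<sigma>\<close> modulo 3, it is \<open>-\<sigma>\<close>; then
  \<open>f = -\<sigma>\<close> would make \<open>B\<close> divisible by 3, against properness of
  \<open>b\<close>.\<close>

lemma shift_neq:
  fixes A B f \<sigma> :: int
  assumes "\<sigma> = 1 \<or> \<sigma> = -1" "\<not> 3 dvd A" "\<not> 3 dvd A - \<sigma>" "\<not> 3 dvd B" "3 dvd A - f - B"
  shows "f \<noteq> - \<sigma>"
proof
  assume f: "f = - \<sigma>"
  show False
    using assms(1)
  proof
    assume "\<sigma> = 1"
    then show False using assms(2-5) f by presburger
  next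
    assume "\<sigma> = -1"
    then show False using assms(2-5) f by presburger
  qed
qed

text \<open>The edge condition at \<open>v\<close> could fail only for a neighbour \<open>u\<close>
  with \<open>F u - F v = -\<delta>\<close>, and \<open>shift_neq\<close> excludes this because
  \<open>u\<close> has neither the old nor the new colour of \<open>v\<close>. Both bounds use it,
  with the roles of \<open>a\<close> and \<open>a'\<close> exchanged in the upper bound.\<close>

lemma shift_recolour:
  assumes G: "simple_graph G"
    and a: "a \<in> proper_colourings 3 G" and a': "a' \<in> proper_colourings 3 G"
    and b: "b \<in> proper_colourings 3 G"
    and v: "differ_at G a a' v"
    and \<delta>: "\<bar>\<delta>\<bar> = 1" "3 dvd int (a v) - \<delta> - int (a' v)"
    and F: "shift G a' b F"
  shows "shift G a b (F(v := F v + \<delta>))"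
proof -
  have vG: "v \<in> verts G" and other: "\<And>u. u \<noteq> v \<Longrightarrow> a u = a' u" and neq: "a v \<noteq> a' v"
    using v by (auto simp: differ_at_def)
  have nb: "\<bar>F u - F v - \<delta>\<bar> \<le> 1" if e: "{u, v} \<in> edges G" for u
  proof -
    note uv = simple_graph_edgeD[OF G e]
    have 1: "\<bar>F u - F v\<bar> \<le> 1" "3 dvd int (a' v) - F v - int (b v)" "3 dvd int (a u) - F u - int (b u)"
      using F e uv other by (auto simp: shift_def)
    have "\<not> 3 dvd int (a u) - int (a v)" "\<not> 3 dvd int (a u) - int (a' v)" "\<not> 3 dvd int (b u) - int (b v)"
      using dvd_diff_iff_colour_eq[OF a a uv(1,2)] dvd_diff_iff_colour_eq[OF b b uv(1,2)]
        dvd_diff_iff_colour_eq[OF a a' uv(1,2)] proper_neq[OF a e] proper_neq[OF a' e] proper_neq[OF b e] other[OF uv(3)] by auto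
    moreover have "3 dvd (int (a u) - int (a' v)) - (F u - F v) - (int (b u) - int (b v))"
      using dvd_diff[OF 1(3) 1(2)] by (simp add: algebra_simps)
    moreover have "\<not> 3 dvd (int (a u) - int (a' v)) - \<delta>"
    proof
      assume "3 dvd (int (a u) - int (a' v)) - \<delta>"
      from dvd_diff[OF this \<delta>(2)] show False
        using \<open>\<not> 3 dvd int (a u) - int (a v)\<close> by simp
    qed
    ultimately have "F u - F v \<noteq> - \<delta>"
      using shift_neq \<delta>(1) by (smt (verit))
    then show ?thesis
      using 1(1) \<delta>(1) by linarith
  qed
  have "\<bar>(F(v := F v + \<delta>)) x - (F(v := F v + \<delta>)) y\<bar> \<le> 1" if e: "{x, y} \<in> edges G" for x y
  proof -
    have "x \<noteq> y" using simple_graph_edgeD[OF G e] by simp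
    then show ?thesis
      using e F nb[of x] nb[of y] by (auto simp: shift_def insert_commute)
  qed
  moreover have "3 dvd int (a x) - (F(v := F v + \<delta>)) x - int (b x)" if "x \<in> verts G" for x
  proof (cases "x = v")
    case True
    have "3 dvd int (a' v) - F v - int (b v)"
      using F vG by (simp add: shift_def)
    from dvd_add[OF this \<delta>(2)] show ?thesis
      using True by (simp add: algebra_simps)
  next
    case False
    then show ?thesis
      using F that other by (simp add: shift_def)
  qed
  ultimately show ?thesis
    by (simp add: shift_def)
qed

text \<open>The new colour of \<open>v\<close> is one of the two other colours, and inside a tight
  set some neighbour of \<open>v\<close> already has it. So tight sets keep their colours and stay
  tight.\<close>

lemma tight_recolour:
  assumes G: "simple_graph G"
    and a: "a \<in> proper_colourings 3 G" and a': "a' \<in> proper_colourings 3 G"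
    and v: "differ_at G a a' v" and X: "tight G a X"
  shows "v \<notin> X" "tight G a' X"
proof -
  have other: "\<And>u. u \<noteq> v \<Longrightarrow> a u = a' u" and neq: "a v \<noteq> a' v"
    using v by (auto simp: differ_at_def)
  show vX: "v \<notin> X"
  proof
    assume vX: "v \<in> X"
    have "\<exists>d\<in>{1, 2}. (int (a' v) - int (a v)) mod 3 = d"
      using neq colour_range[OF a, of v] colour_range[OF a', of v] v
      by (auto simp: differ_at_def)
    then obtain u where u: "{v, u} \<in> edges G" "(int (a u) - int (a v)) mod 3 = (int (a' v) - int (a v)) mod 3"
      using X vX unfolding tight_def by metis
    note uv = simple_graph_edgeD[OF G u(1)]
    have "a u = a' v"
      using u(2) colour_range[OF a uv(1)] colour_range[OF a uv(2)] colour_range[OF a' uv(1)] by auto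
    then show False
      using proper_neq[OF a' u(1)] other[of u] uv(3) by auto
  qed
  have "a u = a' u" if "u \<in> X" for u
    using that vX other by metis
  then show "tight G a' X"
    using X unfolding tight_def by metis
qed

text \<open>Induction on the path, peeling off its first edge: this edge adds 1 or -1 to the shift
  of one vertex, which lies in no tight set, so the sum grows by at most 1.\<close>

lemma reconf_lower:
  assumes G: "simple_graph G" and b: "b \<in> proper_colourings 3 G"
    and "is_path (reconf_graph 3 G) a p b"
  shows "\<exists>F. shift G a b F \<and> (\<forall>X. tight G a X \<longrightarrow> (\<forall>v\<in>X. F v = 0)) \<and>
             (\<Sum>v\<in>verts G. nat \<bar>F v\<bar>) \<le> path_length p"
  using assms(3)
proof (induction p arbitrary: a)
  case Nil
  then show ?case by (simp add: is_path_def)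
next
  case (Cons c p)
  have fin: "finite (verts G)" using G by (simp add: simple_graph_def)
  show ?case
  proof (cases p)
    case Nil
    then have "a = c" "b = c" using Cons.prems by (auto simp: is_path_def)
    then have "a = b" by simp
    then show ?thesis
      by (intro exI[of _ "\<lambda>_. 0"]) (auto simp: shift_def)
  next
    case (Cons a' q)
    have P: "is_path (reconf_graph 3 G) a (a # a' # q) b" "c = a"
      using Cons.prems Cons by (auto simp: is_path_def)
    have P': "is_path (reconf_graph 3 G) a' p b"
      unfolding is_path_def
    proof (intro conjI allI impI)
      fix i assume "Suc i < length p"
      then show "{p ! i, p ! Suc i} \<in> edges (reconf_graph 3 G)"
        using P(1) Cons unfolding is_path_def by (metis Suc_less_eq length_Cons nth_Cons_Suc)
    qed (use P Cons in \<open>auto simp: is_path_def\<close>)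
    obtain F where F: "shift G a' b F" "\<And>X v. tight G a' X \<Longrightarrow> v \<in> X \<Longrightarrow> F v = 0"
      "(\<Sum>v\<in>verts G. nat \<bar>F v\<bar>) \<le> path_length p"
      using Cons.IH[OF P'] by auto
    have col: "a \<in> proper_colourings 3 G" "a' \<in> proper_colourings 3 G"
      using P by (auto simp: is_path_def reconf_graph_def)
    have "{a, a'} \<in> edges (reconf_graph 3 G)"
      using P unfolding is_path_def by (auto dest: spec[of _ 0])
    then obtain v where v: "differ_at G a a' v"
      using reconf_edge_iff[OF col] by auto
    then have vG: "v \<in> verts G" by (simp add: differ_at_def)
    have "\<exists>\<delta>. \<bar>\<delta>\<bar> = 1 \<and> 3 dvd int (a v) - \<delta> - int (a' v)"
      using colour_range[OF col(1) vG] colour_range[OF col(2) vG] v unfolding differ_at_def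
      by (elim disjE; simp; presburger)
    then obtain \<delta> where \<delta>: "\<bar>\<delta>\<bar> = 1" "3 dvd int (a v) - \<delta> - int (a' v)" by auto
    let ?F = "F(v := F v + \<delta>)"
    have "shift G a b ?F"
      by (rule shift_recolour[OF G col b v \<delta> F(1)])
    moreover have "?F x = 0" if "tight G a X" "x \<in> X" for X x
      using tight_recolour[OF G col v that(1)] F(2)[of X x] that by auto
    moreover have "(\<Sum>v\<in>verts G. nat \<bar>?F v\<bar>) \<le> path_length (c # p)"
    proof -
      have "(\<Sum>x\<in>verts G. nat \<bar>?F x\<bar>) \<le> (\<Sum>x\<in>verts G. nat \<bar>F x\<bar> + (if x = v then 1 else 0))"
        using \<delta>(1) by (intro sum_mono) auto
      also have "\<dots> = (\<Sum>x\<in>verts G. nat \<bar>F x\<bar>) + 1"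
        using fin vG by (simp add: sum.distrib)
      also have "\<dots> \<le> path_length (c # p)"
        using F(3) Cons by (simp add: path_length_def)
      finally show ?thesis .
    qed
    ultimately show ?thesis by blast
  qed
qed

section \<open>Upper bound on the distance: spending a shift one recolouring at a time\<close>

text \<open>On the set \<open>S\<close> where \<open>\<sigma> * F\<close> is maximal, a vertex that cannot be recoloured in direction \<open>\<sigma>\<close>
  has a neighbour of the blocking colour, and this neighbour again lies in \<open>S\<close>. If all of \<open>S\<close> were
  blocked, following these neighbours would end in cycles, which form a tight set.\<close>

lemma ex_recolouring:
  assumes G: "simple_graph G" and a: "a \<in> proper_colourings 3 G" and b: "b \<in> proper_colourings 3 G"
    and F: "shift G a b F" and F0: "\<And>X v. tight G a X \<Longrightarrow> v \<in> X \<Longrightarrow> F v = 0"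
    and w: "w \<in> verts G" "F w \<noteq> 0"
  shows "\<exists>a' v. a' \<in> proper_colourings 3 G \<and> differ_at G a a' v \<and> F v \<noteq> 0 \<and>
           3 dvd int (a v) - sgn (F v) - int (a' v)"
proof -
  \<comment> \<open>The direction is that of a nonzero value, so the maximum \<open>m\<close> is
    positive and \<open>F\<close> is nonzero on all of \<open>S\<close>.\<close>
  define \<sigma> where "\<sigma> = sgn (F w)"
  have \<sigma>: "\<sigma> = 1 \<or> \<sigma> = -1" using w by (auto simp: \<sigma>_def sgn_if)
  have fin: "finite (verts G)" using G by (simp add: simple_graph_def)
  define m where "m = Max ((\<lambda>v. \<sigma> * F v) ` verts G)"
  have mle: "\<sigma> * F v \<le> m" if "v \<in> verts G" for v
    unfolding m_def using fin that by (intro Max_ge) auto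
  have mpos: "m > 0"
    using mle[OF w(1)] w(2) by (auto simp: \<sigma>_def sgn_if split: if_splits)
  define S where "S = {v \<in> verts G. \<sigma> * F v = m}"
  have S_ne: "S \<noteq> {}"
  proof -
    have "m \<in> (\<lambda>v. \<sigma> * F v) ` verts G"
      unfolding m_def using fin w(1) by (intro Max_in) auto
    then show ?thesis by (auto simp: S_def)
  qed
  have finS: "finite S" using fin by (simp add: S_def)
  \<comment> \<open>Properness excludes 0 and \<open>d\<close> excludes \<open>\<sigma>\<close> as
    residue of \<open>a u - a v\<close>: \<open>u\<close> has the colour that \<open>v\<close> would
    take. By \<open>shift_neq\<close>, \<open>\<sigma> * F\<close> cannot drop from \<open>v\<close>
    to such a neighbour.\<close>
  have up: "u \<in> S" if v: "v \<in> S" and e: "{v, u} \<in> edges G"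
    and d: "\<not> 3 dvd int (a u) - int (a v) - \<sigma>" for u v
  proof -
    note uv = simple_graph_edgeD[OF G e]
    have 1: "\<bar>F v - F u\<bar> \<le> 1" "3 dvd int (a v) - F v - int (b v)" "3 dvd int (a u) - F u - int (b u)"
      using F e uv by (auto simp: shift_def)
    have "\<not> 3 dvd int (a u) - int (a v)" "\<not> 3 dvd int (b u) - int (b v)"
      using dvd_diff_iff_colour_eq[OF a a uv(2,1)] dvd_diff_iff_colour_eq[OF b b uv(2,1)]
        proper_neq[OF b e] proper_neq[OF a e] by auto
    moreover have "3 dvd (int (a u) - int (a v)) - (F u - F v) - (int (b u) - int (b v))"
      using dvd_diff[OF 1(3) 1(2)] by (simp add: algebra_simps)
    ultimately have "F u - F v \<noteq> - \<sigma> \<and> \<bar>F u - F v\<bar> \<le> 1"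
      using shift_neq[OF \<sigma> _ d] 1(1) by (metis abs_minus_commute)
    then have "\<sigma> * F u \<ge> \<sigma> * F v"
      using \<sigma> by auto
    then show ?thesis using v mle[OF uv(2)] uv(2) by (auto simp: S_def)
  qed
  have "\<exists>v\<in>S. \<forall>u. {v, u} \<in> edges G \<longrightarrow> 3 dvd int (a u) - int (a v) - \<sigma>"
  proof (rule ccontr)
    assume "\<not> ?thesis"
    then have "\<forall>v\<in>S. \<exists>u. {v, u} \<in> edges G \<and> \<not> 3 dvd int (a u) - int (a v) - \<sigma>"
      by blast
    then obtain f where f: "\<And>v. v \<in> S \<Longrightarrow> {v, f v} \<in> edges G"
      "\<And>v. v \<in> S \<Longrightarrow> \<not> 3 dvd int (a (f v)) - int (a v) - \<sigma>"
      by metis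
    have fS: "f v \<in> S" if "v \<in> S" for v using up f that by blast
    let ?closed = "\<lambda>T. T \<subseteq> S \<and> T \<noteq> {} \<and> f ` T \<subseteq> T"
    \<comment> \<open>The image of a minimal closed set is closed again, so \<open>f\<close> maps
      \<open>T\<close> onto \<open>T\<close>. Every \<open>v\<close> in \<open>T\<close> thus sees
      \<open>f v\<close> with residue \<open>-\<sigma>\<close> and a preimage under \<open>f\<close>
      with residue \<open>\<sigma>\<close>.\<close>
    obtain T where T: "?closed T" "\<And>T'. ?closed T' \<Longrightarrow> card T \<le> card T'"
      using ex_has_least_nat[of ?closed S card] S_ne fS by auto
    have finT: "finite T" using T finS finite_subset by auto
    have "?closed (f ` T)" using T(1) fS by blast
    then have fT: "f ` T = T"
      using T finT by (metis card_subset_eq card_image_le le_antisym)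
    have "tight G a T"
      unfolding tight_def
    proof (intro conjI ballI)
      show "T \<subseteq> verts G" using T(1) by (auto simp: S_def)
      fix v :: 'a and d :: int assume v: "v \<in> T" and d: "d \<in> {1, 2}"
      obtain u where u: "u \<in> T" "v = f u" using fT v by blast
      have uS: "u \<in> S" and vS: "v \<in> S" using T(1) u v by auto
      have e1: "{v, f v} \<in> edges G" "{v, u} \<in> edges G"
        using f(1)[OF vS] f(1)[OF uS] u by (auto simp: insert_commute)
      note r1 = simple_graph_edgeD[OF G e1(1)]
      note r2 = simple_graph_edgeD[OF G e1(2)]
      have "(int (a (f v)) - int (a v)) mod 3 = (- \<sigma>) mod 3"
        using f(2)[OF vS] colour_range[OF a r1(1)] colour_range[OF a r1(2)] proper_neq[OF a e1(1)] \<sigma>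
        by (elim disjE; simp)
      moreover have "(int (a u) - int (a v)) mod 3 = \<sigma> mod 3"
        using f(2)[OF uS] colour_range[OF a r2(1)] colour_range[OF a r2(2)] proper_neq[OF a e1(2)] \<sigma> u(2)
        by (elim disjE; simp)
      ultimately show "\<exists>u\<in>T. {v, u} \<in> edges G \<and> (int (a u) - int (a v)) mod 3 = d"
        using \<sigma> d e1 u(1) fT v by (elim disjE) auto
    qed
    moreover obtain v where "v \<in> T" using T by blast
    ultimately have "F v = 0" "v \<in> S" using F0 T by auto
    then show False using mpos by (simp add: S_def)
  qed
  then obtain v where v: "v \<in> S" "\<And>u. {v, u} \<in> edges G \<Longrightarrow> 3 dvd int (a u) - int (a v) - \<sigma>"
    by blast
  have vG: "v \<in> verts G" using v by (simp add: S_def)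
  have sg: "sgn (F v) = \<sigma>" "F v \<noteq> 0" using v(1) mpos \<sigma> by (auto simp: S_def sgn_if)
  \<comment> \<open>The representative of \<open>a v - \<sigma>\<close> in \<open>{1..3}\<close>;
    the shifts by 1 around \<open>mod\<close> account for colours starting at 1.\<close>
  define x where "x = nat ((int (a v) - \<sigma> - 1) mod 3 + 1)"
  have "(int (a v) - \<sigma> - 1) mod 3 \<ge> 0" "(int (a v) - \<sigma> - 1) mod 3 < 3"
    by simp_all
  then have int_x: "int x = (int (a v) - \<sigma> - 1) mod 3 + 1" and x3: "x \<in> {1..3}"
    by (auto simp: x_def)
  have "3 dvd (int (a v) - \<sigma> - 1) - (int (a v) - \<sigma> - 1) mod 3"
    by (rule dvd_minus_mod)
  then have x: "x \<in> {1..3}" "3 dvd int (a v) - \<sigma> - int x"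
    using x3 by (simp_all add: int_x algebra_simps)
  have x_neq: "x \<noteq> a v" using x \<sigma> by auto
  have x_nb: "x \<noteq> a u" if "{v, u} \<in> edges G" for u
  proof
    assume "x = a u"
    then have "3 dvd int x - int (a v) - \<sigma>" using v(2)[OF that] by simp
    from dvd_add[OF this x(2)] show False using \<sigma> by auto
  qed
  have "a(v := x) \<in> proper_colourings 3 G"
    using a vG x(1) x_nb simple_graph_edgeD(3)[OF G]
    by (auto simp: proper_colourings_def colourings_def insert_commute PiE_iff extensional_def)
  moreover have "differ_at G a (a(v := x)) v"
    using vG x_neq by (simp add: differ_at_def)
  ultimately show ?thesis
    using x(2) sg by (intro exI[of _ "a(v := x)"] exI[of _ v]) simp
qed

text \<open>Paths must not repeat vertices. If \<open>x\<close> already lies on \<open>p\<close>,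
  the part of \<open>p\<close> from \<open>x\<close> on is taken, which is why the length is only
  bounded.\<close>

lemma is_path_Cons:
  assumes "is_path H y p z" "x \<in> verts H" "{x, y} \<in> edges H"
  shows "\<exists>q. is_path H x q z \<and> path_length q \<le> Suc (path_length p)"
proof (cases "x \<in> set p")
  case True
  then obtain p1 p2 where p: "p = p1 @ x # p2" by (meson split_list)
  have "is_path H x (x # p2) z"
    unfolding is_path_def
  proof (intro conjI allI impI)
    fix i assume i: "Suc i < length (x # p2)"
    then have "Suc (length p1 + i) < length p" using p by simp
    then have "{p ! (length p1 + i), p ! Suc (length p1 + i)} \<in> edges H"
      using assms(1) unfolding is_path_def by blast
    then show "{(x # p2) ! i, (x # p2) ! Suc i} \<in> edges H"
      using p by (simp add: nth_append)
  qed (use assms(1) p in \<open>auto simp: is_path_def\<close>)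
  then show ?thesis using p by (intro exI[of _ "x # p2"]) (simp add: path_length_def)
next
  case False
  have "is_path H x (x # p) z"
    unfolding is_path_def
  proof (intro conjI allI impI)
    fix i assume "Suc i < length (x # p)"
    then show "{(x # p) ! i, (x # p) ! Suc i} \<in> edges H"
      using assms by (cases i) (auto simp: is_path_def hd_conv_nth)
  qed (use assms False in \<open>auto simp: is_path_def\<close>)
  then show ?thesis using assms(1)
    by (intro exI[of _ "x # p"]) (auto simp: path_length_def is_path_def)
qed

text \<open>Induction on the sum: \<open>ex_recolouring\<close> supplies a move that takes one
  \<open>F v\<close> a unit towards 0. When \<open>F\<close> vanishes everywhere, congruent colours
  in \<open>{1..3}\<close> coincide.\<close>

lemma reconf_upper:
  assumes G: "simple_graph G" and b: "b \<in> proper_colourings 3 G"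
    and "a \<in> proper_colourings 3 G" "shift G a b F" "\<And>X v. tight G a X \<Longrightarrow> v \<in> X \<Longrightarrow> F v = 0"
  shows "\<exists>p. is_path (reconf_graph 3 G) a p b \<and> path_length p \<le> (\<Sum>v\<in>verts G. nat \<bar>F v\<bar>)"
  using assms(3-5)
proof (induction "\<Sum>v\<in>verts G. nat \<bar>F v\<bar>" arbitrary: a F rule: less_induct)
  case less
  have fin: "finite (verts G)" using G by (simp add: simple_graph_def)
  note a = less.prems(1)
  show ?case
  proof (cases "\<exists>w\<in>verts G. F w \<noteq> 0")
    case False
    have "a x = b x" for x
    proof (cases "x \<in> verts G")
      case True
      then have "3 dvd int (a x) - int (b x)"
        using False less.prems(2) by (auto simp: shift_def)
      then show ?thesis
        using colour_range[OF a True] colour_range[OF b True] by (elim disjE) simp_all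
    next
      case False
      then show ?thesis
        using a b by (simp add: proper_colourings_def colourings_def PiE_iff extensional_def)
    qed
    then have "a = b" by blast
    then have "is_path (reconf_graph 3 G) a [a] b \<and> path_length [a] \<le> (\<Sum>v\<in>verts G. nat \<bar>F v\<bar>)"
      using a by (simp add: is_path_def reconf_graph_def path_length_def)
    then show ?thesis ..
  next
    case True
    then obtain a' v where v: "a' \<in> proper_colourings 3 G" "differ_at G a a' v" "F v \<noteq> 0"
      "3 dvd int (a v) - sgn (F v) - int (a' v)"
      using ex_recolouring[OF G a b less.prems(2)] less.prems(3) by blast
    let ?F = "F(v := F v + - sgn (F v))"
    have vG: "v \<in> verts G" using v(2) by (simp add: differ_at_def)
    have d3: "3 dvd int (a' v) - - sgn (F v) - int (a v)"
      using v(4) by (metis (no_types, opaque_lifting) dvd_minus_iff minus_diff_eq diff_diff_eq2 diff_minus_eq_add add.commute diff_add_eq)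
    have "shift G a' b ?F"
      by (rule shift_recolour[OF G v(1) a b differ_at_sym[OF v(2)] _ d3 less.prems(2)])
        (use v(3) in \<open>simp add: sgn_if\<close>)
    moreover have "?F x = 0" if "tight G a' X" "x \<in> X" for X x
      using tight_recolour[OF G v(1) a differ_at_sym[OF v(2)] that(1)] less.prems(3)[of X x] that by auto
    moreover have lt: "(\<Sum>x\<in>verts G. nat \<bar>?F x\<bar>) < (\<Sum>x\<in>verts G. nat \<bar>F x\<bar>)"
      using fin vG v(3) by (intro sum_strict_mono_ex1) (auto simp: sgn_if)
    ultimately obtain p where p: "is_path (reconf_graph 3 G) a' p b"
      "path_length p \<le> (\<Sum>x\<in>verts G. nat \<bar>?F x\<bar>)"
      using less.hyps[of ?F a'] v(1) by blast
    have "{a, a'} \<in> edges (reconf_graph 3 G)"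
      using reconf_edge_iff[OF a v(1)] v(2) by blast
    moreover have "a \<in> verts (reconf_graph 3 G)" using a by (simp add: reconf_graph_def)
    ultimately obtain q where "is_path (reconf_graph 3 G) a q b" "path_length q \<le> Suc (path_length p)"
      using is_path_Cons[OF p(1)] by blast
    then show ?thesis using p(2) lt by (intro exI[of _ q]) simp
  qed
qed

theorem colouring_reconfiguration_iff_shift:
  assumes "simple_graph G" "a \<in> proper_colourings 3 G" "b \<in> proper_colourings 3 G"
  shows "colouring_reconfiguration 3 G a b l \<longleftrightarrow>
    (\<exists>F. shift G a b F \<and> (\<forall>X. tight G a X \<longrightarrow> (\<forall>v\<in>X. F v = 0)) \<and>
         (\<Sum>v\<in>verts G. nat \<bar>F v\<bar>) \<le> l)"
proof
  assume "colouring_reconfiguration 3 G a b l"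
  then obtain p where p: "is_path (reconf_graph 3 G) a p b" "path_length p \<le> l"
    by (auto simp: colouring_reconfiguration_def)
  obtain F where "shift G a b F" "\<forall>X. tight G a X \<longrightarrow> (\<forall>v\<in>X. F v = 0)"
    "(\<Sum>v\<in>verts G. nat \<bar>F v\<bar>) \<le> path_length p"
    using reconf_lower[OF assms(1,3) p(1)] by blast
  then show "\<exists>F. shift G a b F \<and> (\<forall>X. tight G a X \<longrightarrow> (\<forall>v\<in>X. F v = 0)) \<and>
      (\<Sum>v\<in>verts G. nat \<bar>F v\<bar>) \<le> l"
    using p(2) by (intro exI[of _ F]) simp
next
  assume "\<exists>F. shift G a b F \<and> (\<forall>X. tight G a X \<longrightarrow> (\<forall>v\<in>X. F v = 0)) \<and>
      (\<Sum>v\<in>verts G. nat \<bar>F v\<bar>) \<le> l"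
  then obtain F where F: "shift G a b F" "\<And>X v. tight G a X \<Longrightarrow> v \<in> X \<Longrightarrow> F v = 0"
    "(\<Sum>v\<in>verts G. nat \<bar>F v\<bar>) \<le> l"
    by blast
  obtain p where "is_path (reconf_graph 3 G) a p b" "path_length p \<le> (\<Sum>v\<in>verts G. nat \<bar>F v\<bar>)"
    using reconf_upper[OF assms(1,3,2) F(1)] F(2) by metis
  then show "colouring_reconfiguration 3 G a b l"
    unfolding colouring_reconfiguration_def using F(3) by (intro exI[of _ p]) simp
qed

section \<open>Running times from loop iterations\<close>

primrec code_size :: "com \<Rightarrow> nat" where
  "code_size Skip = 1"
| "code_size (Assign a i e) = 1 + expr_cost i + expr_cost e"
| "code_size (Seq c d) = 1 + code_size c + code_size d"
| "code_size (If e c d) = 1 + expr_cost e + code_size c + code_size d"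
| "code_size (While e c) = 2 + 2 * expr_cost e + code_size c"

text \<open>The number \<open>k\<close> bounds the total number of loop iterations, including those of
  nested loops; everything else is accounted for by the size of the program.\<close>

definition wp :: "nat \<Rightarrow> com \<Rightarrow> memory \<Rightarrow> nat \<Rightarrow> (memory \<Rightarrow> bool) \<Rightarrow> bool" where
  "wp W c s k Q \<longleftrightarrow> (\<exists>t s'. exec W c s t s' \<and> t \<le> code_size c * (k + 1) \<and> Q s')"

lemma wp_mono:
  assumes "wp W c s k Q" "k \<le> k'" "\<And>s'. Q s' \<Longrightarrow> Q' s'"
  shows "wp W c s k' Q'"
proof -
  obtain t s' where "exec W c s t s'" "t \<le> code_size c * (k + 1)" "Q s'"
    using assms(1) by (auto simp: wp_def)
  moreover have "code_size c * (k + 1) \<le> code_size c * (k' + 1)"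
    using assms(2) by (intro mult_left_mono) auto
  ultimately show ?thesis
    using assms(3) unfolding wp_def by (meson le_trans)
qed

lemma wp_Seq:
  assumes "wp W c s k1 R" "\<And>s'. R s' \<Longrightarrow> wp W d s' k2 Q"
  shows "wp W (Seq c d) s (k1 + k2) Q"
proof -
  obtain t1 s1 where 1: "exec W c s t1 s1" "t1 \<le> code_size c * (k1 + 1)" "R s1"
    using assms(1) by (auto simp: wp_def)
  obtain t2 s2 where 2: "exec W d s1 t2 s2" "t2 \<le> code_size d * (k2 + 1)" "Q s2"
    using assms(2)[OF 1(3)] by (auto simp: wp_def)
  have "1 + t1 + t2 \<le> code_size (Seq c d) * (k1 + k2 + 1)"
    using 1(2) 2(2) by (simp add: algebra_simps)
  then show ?thesis
    using exec.Seq[OF 1(1) 2(1)] 2(3) unfolding wp_def by blast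
qed

text \<open>\<open>f\<close> is a potential for all remaining iterations: an outer iteration pays
  for itself and for the \<open>k\<close> iterations nested in it, so the bound for nested loops is
  additive rather than a product.\<close>

lemma wp_While:
  assumes "I s"
    and cond: "\<And>s. I s \<Longrightarrow> fits W s e"
    and body: "\<And>s. I s \<Longrightarrow> eval_expr s e \<noteq> 0 \<Longrightarrow>
      \<exists>k. wp W c s k (\<lambda>s'. I s' \<and> f s' + k + 1 \<le> f s)"
    and "\<And>s'. I s' \<Longrightarrow> eval_expr s' e = 0 \<Longrightarrow> Q s'"
    and "f s \<le> m"
  shows "wp W (While e c) s m Q"
proof -
  have "\<exists>t s'. exec W (While e c) s t s' \<and> t \<le> code_size (While e c) * (f s + 1) \<and>
          I s' \<and> eval_expr s' e = 0"
    using \<open>I s\<close>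
  proof (induction "f s" arbitrary: s rule: less_induct)
    case less
    show ?case
    proof (cases "eval_expr s e = 0")
      case True
      have "1 + expr_cost e \<le> code_size (While e c) * (f s + 1)"
        by simp
      then show ?thesis
        using exec.WhileFalse[OF cond[OF less.prems] True, of c] True less.prems by blast
    next
      case False
      obtain k t1 s1 where 1: "exec W c s t1 s1" "t1 \<le> code_size c * (k + 1)" "I s1"
        "f s1 + k + 1 \<le> f s"
        using body[OF less.prems False] by (auto simp: wp_def)
      obtain t2 s2 where 2: "exec W (While e c) s1 t2 s2"
        "t2 \<le> code_size (While e c) * (f s1 + 1)" "I s2" "eval_expr s2 e = 0"
        using less.hyps[OF _ 1(3)] 1(4) by auto
      have "1 + expr_cost e + t1 + t2 \<le>
          1 + expr_cost e + code_size c * (k + 1) + code_size (While e c) * (f s1 + 1)"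
        using 1(2) 2(2) by linarith
      also have "\<dots> \<le> code_size (While e c) * (k + 1) + code_size (While e c) * (f s1 + 1)"
        by (simp add: algebra_simps)
      also have "\<dots> = code_size (While e c) * (f s1 + k + 1 + 1)"
        by (simp add: algebra_simps)
      also have "\<dots> \<le> code_size (While e c) * (f s + 1)"
        using 1(4) by (intro mult_left_mono) auto
      finally show ?thesis
        using exec.WhileTrue[OF cond[OF less.prems] False 1(1) 2(1)] 2(3,4) by blast
    qed
  qed
  then have "wp W (While e c) s (f s) Q"
    unfolding wp_def using assms(4) by blast
  then show ?thesis
    using assms(5) by (rule wp_mono)
qed

text \<open>Weakest preconditions of loop-free code, which the simplifier can unfold. A loop would
  need an invariant and is rejected; it is treated by \<open>wp_While\<close>.\<close>

primrec vc :: "nat \<Rightarrow> com \<Rightarrow> (memory \<Rightarrow> bool) \<Rightarrow> memory \<Rightarrow> bool" where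
  "vc W Skip Q s \<longleftrightarrow> Q s"
| "vc W (Assign a i e) Q s \<longleftrightarrow>
     fits W s i \<and> fits W s e \<and> Q (s(a := (s a)(eval_expr s i := eval_expr s e)))"
| "vc W (Seq c d) Q s \<longleftrightarrow> vc W c (vc W d Q) s"
| "vc W (If e c d) Q s \<longleftrightarrow>
     fits W s e \<and> (eval_expr s e \<noteq> 0 \<longrightarrow> vc W c Q s) \<and> (eval_expr s e = 0 \<longrightarrow> vc W d Q s)"
| "vc W (While e c) Q s \<longleftrightarrow> False"

lemma vc_mono: "vc W c Q s \<Longrightarrow> (\<And>s'. Q s' \<Longrightarrow> Q' s') \<Longrightarrow> vc W c Q' s"
proof (induction c arbitrary: s Q Q')
  case (Seq c d)
  show ?case
    using Seq.prems(1) Seq.IH(2)[OF _ Seq.prems(2)]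
    by (auto intro: Seq.IH(1)[where Q = "vc W d Q"])
qed auto

lemma wp_vc:
  assumes "vc W c Q s"
  shows "wp W c s 0 Q"
  using assms
proof (induction c arbitrary: s Q)
  case Skip
  then show ?case
    using exec.Skip[of W s] by (auto simp: wp_def)
next
  case (Assign a i e)
  then show ?case
    using exec.Assign[of W s i e a] unfolding wp_def vc.simps code_size.simps
    by (intro exI conjI) (assumption | simp)+
next
  case (Seq c d)
  have "wp W c s 0 (vc W d Q)"
    using Seq.IH(1) Seq.prems by simp
  from wp_Seq[OF this Seq.IH(2)] show ?case by simp
next
  case (If e c d)
  show ?case
  proof (cases "eval_expr s e = 0")
    case True
    then obtain t s' where "exec W d s t s'" "t \<le> code_size d" "Q s'"
      using If.IH(2)[of Q s] If.prems by (auto simp: wp_def)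
    then show ?thesis
      using exec.IfFalse[of W s e d t s' c] True If.prems
      unfolding wp_def by (intro exI[of _ "1 + expr_cost e + t"] exI[of _ s']) auto
  next
    case False
    then obtain t s' where "exec W c s t s'" "t \<le> code_size c" "Q s'"
      using If.IH(1)[of Q s] If.prems by (auto simp: wp_def)
    then show ?thesis
      using exec.IfTrue[of W s e c t s' d] False If.prems
      unfolding wp_def by (intro exI[of _ "1 + expr_cost e + t"] exI[of _ s']) auto
  qed
qed simp

lemma wp_While_vc:
  assumes "I s"
    and "\<And>s. I s \<Longrightarrow> fits W s e"
    and "\<And>s. I s \<Longrightarrow> eval_expr s e \<noteq> 0 \<Longrightarrow> vc W c (\<lambda>s'. I s' \<and> f s' < f s) s"
    and "\<And>s'. I s' \<Longrightarrow> eval_expr s' e = 0 \<Longrightarrow> Q s'"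
    and "f s \<le> m"
  shows "wp W (While e c) s m Q"
proof (rule wp_While[where I = I and f = f, OF assms(1,2) _ assms(4,5)])
  fix s assume "I s" "eval_expr s e \<noteq> 0"
  from wp_vc[OF assms(3)[OF this]] have "wp W c s 0 (\<lambda>s'. I s' \<and> f s' + 0 + 1 \<le> f s)"
    by (rule wp_mono) auto
  then show "\<exists>k. wp W c s k (\<lambda>s'. I s' \<and> f s' + k + 1 \<le> f s)" ..
qed

primrec writes :: "com \<Rightarrow> nat set" where
  "writes Skip = {}"
| "writes (Assign a i e) = {a}"
| "writes (Seq c d) = writes c \<union> writes d"
| "writes (If e c d) = writes c \<union> writes d"
| "writes (While e c) = writes c"

lemma exec_writes: "exec W c s t s' \<Longrightarrow> x \<notin> writes c \<Longrightarrow> s' x = s x"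
  by (induction rule: exec.induct) auto

text \<open>Keeps loop invariants local: facts about arrays of other phases, mostly that they are
  still zero, are put back afterwards from the syntactic set of written arrays.\<close>

lemma wp_frame:
  assumes "wp W c s k Q"
  shows "wp W c s k (\<lambda>s'. Q s' \<and> (\<forall>x. x \<notin> writes c \<longrightarrow> s' x = s x))"
  using assms exec_writes unfolding wp_def by blast

section \<open>Frozen vertices\<close>

text \<open>Register \<open>a\<close> is cell 0 of array \<open>a\<close>; registers have numbers at least 20. The other arrays are:
  5 a table of residues modulo 3, since the machine cannot divide;
  6 the source of each arc, an arc being an index into the adjacency array 2;
  7 numbers of unhandled arcs by target and colour difference; 8 marks of the peeled vertices;
  9 the queue of the peeling; 10 marks of the visited vertices; 11 the queue of the search;
  12 the candidate shift, offset so as to be a natural number; 13 the number of the component;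
  14 the position in array 11 where each component starts;
  15 and 16 the histograms of all and of the frozen vertices of the current component.\<close>

abbreviation reg :: "nat \<Rightarrow> expr" where "reg a \<equiv> Cell a (Const 0)"
abbreviation set_reg :: "nat \<Rightarrow> expr \<Rightarrow> com" where "set_reg a \<equiv> Assign a (Const 0)"
abbreviation incr :: "nat \<Rightarrow> com" where "incr a \<equiv> set_reg a (Plus (reg a) (Const 1))"

text \<open>Three times the target plus the colour difference modulo 3, with repeated addition in
  place of multiplication. Adding 3 first prevents truncation.\<close>

definition arc_key :: "nat \<Rightarrow> expr" where
  "arc_key j = Plus (Plus (Plus (Cell 2 (reg j)) (Cell 2 (reg j))) (Cell 2 (reg j)))
     (Cell 5 (Minus (Plus (Cell 3 (Cell 6 (reg j))) (Const 3)) (Cell 3 (Cell 2 (reg j)))))"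

text \<open>Entries at multiples of 3 are zero from the start. Twelve entries suffice: the largest
  index looked up is 3 + 3 + 7 - 2 = 11, in \<open>arc_step\<close>.\<close>

definition fill_mod3 :: com where
  "fill_mod3 =
     Seq (Assign 5 (Const 1) (Const 1)) (Seq (Assign 5 (Const 2) (Const 2))
     (Seq (Assign 5 (Const 4) (Const 1)) (Seq (Assign 5 (Const 5) (Const 2))
     (Seq (Assign 5 (Const 7) (Const 1)) (Seq (Assign 5 (Const 8) (Const 2))
     (Seq (Assign 5 (Const 10) (Const 1)) (Assign 5 (Const 11) (Const 2))))))))"

text \<open>Each iteration advances either the vertex or the arc, so empty adjacency lists cost one
  iteration each and the total is \<open>n + M\<close>.\<close>

definition fill_src :: com where
  "fill_src = While (Minus (reg 0) (reg 20))
     (If (Minus (Cell 1 (Plus (reg 20) (Const 1))) (reg 21))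
        (Seq (Assign 6 (reg 21) (reg 20)) (incr 21))
        (incr 20))"

text \<open>\<open>Cell 1 (reg 0)\<close> is the end of the last adjacency list, that is, the number
  of arcs.\<close>

definition count_keys :: com where
  "count_keys = While (Minus (Cell 1 (reg 0)) (reg 22))
     (Seq (Assign 7 (arc_key 22) (Plus (Cell 7 (arc_key 22)) (Const 1))) (incr 22))"

definition push :: "nat \<Rightarrow> nat \<Rightarrow> nat \<Rightarrow> expr \<Rightarrow> com" where
  "push vis Q t u = Seq (Assign vis u (Const 1)) (Seq (Assign Q (reg t) u) (incr t))"

definition triple :: "expr \<Rightarrow> expr" where
  "triple e = Plus (Plus e e) e"

text \<open>The loop over the arcs of a vertex is merged with the loop over the queue and the loop over
  the possible start vertices, so that the body is free of loops.\<close>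

definition peel :: com where
  "peel = While (Plus (Plus (Minus (reg 0) (reg 25)) (Minus (reg 24) (reg 23))) (Minus (reg 27) (reg 26)))
     (If (Minus (reg 27) (reg 26))
        (Seq (Assign 7 (arc_key 26) (Minus (Cell 7 (arc_key 26)) (Const 1)))
        (Seq (If (Plus (Cell 8 (Cell 2 (reg 26))) (Cell 7 (arc_key 26))) Skip
                (push 8 9 24 (Cell 2 (reg 26))))
             (incr 26)))
        (If (Minus (reg 24) (reg 23))
           (Seq (set_reg 26 (Cell 1 (Cell 9 (reg 23))))
           (Seq (set_reg 27 (Cell 1 (Plus (Cell 9 (reg 23)) (Const 1))))
                (incr 23)))
           (Seq (If (Cell 8 (reg 25)) Skip
                  (If (Plus (Minus (Const 1) (Cell 7 (Plus (triple (reg 25)) (Const 1))))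
                            (Minus (Const 1) (Cell 7 (Plus (triple (reg 25)) (Const 2)))))
                     (push 8 9 24 (reg 25)) Skip))
                (incr 25))))"

text \<open>The graph enters only through its arcs, so the phases can be verified without sets of
  edges. The linear word bound covers indices and counters, the quadratic one the accumulated
  distances.\<close>

locale ram_instance =
  fixes n M l W :: nat and A1 dst src a b :: "nat \<Rightarrow> nat"
  assumes A1_0: "A1 0 = 0" and A1_n: "A1 n = M" and A1_mono: "v < n \<Longrightarrow> A1 v \<le> A1 (Suc v)"
    and dst_less: "j < M \<Longrightarrow> dst j < n"
    and src_eq: "v < n \<Longrightarrow> A1 v \<le> j \<Longrightarrow> j < A1 (Suc v) \<Longrightarrow> src j = v"
    and src_range: "j < M \<Longrightarrow> src j < n \<and> A1 (src j) \<le> j \<and> j < A1 (Suc (src j))"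
    and a_range: "v < n \<Longrightarrow> 1 \<le> a v \<and> a v \<le> 3"
    and a_proper: "j < M \<Longrightarrow> a (src j) \<noteq> a (dst j)"
    and arc_sym: "j < M \<Longrightarrow> \<exists>j'<M. src j' = dst j \<and> dst j' = src j"
    and b_range: "v < n \<Longrightarrow> 1 \<le> b v \<and> b v \<le> 3"
    and W_lin: "10 * n + 10 * M + 10 * l + 100 \<le> W"
    and W_quad: "4 * ((10 * n + 10 * M + 10 * l + 100) * (10 * n + 10 * M + 10 * l + 100)) \<le> W"
begin

lemma A1_le: "v \<le> w \<Longrightarrow> w \<le> n \<Longrightarrow> A1 v \<le> A1 w"
proof (induction rule: dec_induct)
  case (step w)
  then show ?case using A1_mono[of w] by simp
qed simp

lemma A1_le_M: "v \<le> n \<Longrightarrow> A1 v \<le> M"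
  using A1_le[of v n] A1_n by simp

definition input_ok :: "memory \<Rightarrow> bool" where
  "input_ok s \<longleftrightarrow> s 0 0 = n \<and> s 0 2 = l \<and> s 1 = A1 \<and> s 2 = dst \<and> s 3 = a \<and> s 4 = b"

definition static :: "memory \<Rightarrow> bool" where
  "static s \<longleftrightarrow> input_ok s \<and> (\<forall>k<12. s 5 k = k mod 3) \<and> (\<forall>j<M. s 6 j = src j)"

lemma input_ok_upd [simp]: "x \<ge> 5 \<Longrightarrow> input_ok (s(x := f)) = input_ok s"
  by (simp add: input_ok_def)

lemma static_upd [simp]: "x \<ge> 7 \<Longrightarrow> static (s(x := f)) = static s"
  by (simp add: static_def)

section \<open>Tables of residues, arc sources and arc counts\<close>

lemma wp_fill_mod3:
  assumes "input_ok s" "s 5 = (\<lambda>_. 0)"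
  shows "wp W fill_mod3 s 0 (\<lambda>s. input_ok s \<and> (\<forall>k<12. s 5 k = k mod 3))"
proof (rule wp_vc)
  have "(\<forall>k<12. P k) \<longleftrightarrow> P 0 \<and> P 1 \<and> P 2 \<and> P 3 \<and> P 4 \<and> P 5 \<and> P 6 \<and> P 7 \<and> P 8 \<and> P 9 \<and> P 10 \<and> P 11"
    for P :: "nat \<Rightarrow> bool"
    by (simp add: numeral_eq_Suc All_less_Suc conj_ac)
  then show "vc W fill_mod3 (\<lambda>s. input_ok s \<and> (\<forall>k<12. s 5 k = k mod 3)) s"
    using assms W_lin by (simp add: fill_mod3_def)
qed

lemma wp_fill_src:
  assumes "input_ok s" "\<forall>k<12. s 5 k = k mod 3" "s 20 0 = 0" "s 21 0 = 0"
  shows "wp W fill_src s (n + M) static"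
  unfolding fill_src_def
proof (rule wp_While_vc[where f = "\<lambda>s. (n - s 20 0) + (M - s 21 0)" and
      I = "\<lambda>s. input_ok s \<and> (\<forall>k<12. s 5 k = k mod 3) \<and> s 20 0 \<le> n \<and> A1 (s 20 0) \<le> s 21 0 \<and>
        s 21 0 \<le> M \<and> (s 20 0 < n \<longrightarrow> s 21 0 \<le> A1 (Suc (s 20 0))) \<and> (\<forall>j<s 21 0. s 6 j = src j)"])
  fix s :: memory
  assume I: "input_ok s \<and> (\<forall>k<12. s 5 k = k mod 3) \<and> s 20 0 \<le> n \<and> A1 (s 20 0) \<le> s 21 0 \<and>
        s 21 0 \<le> M \<and> (s 20 0 < n \<longrightarrow> s 21 0 \<le> A1 (Suc (s 20 0))) \<and> (\<forall>j<s 21 0. s 6 j = src j)"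
  then show "fits W s (Minus (reg 0) (reg 20))"
    using W_lin by (simp add: input_ok_def)
  assume "eval_expr s (Minus (reg 0) (reg 20)) \<noteq> 0"
  then have v: "s 20 0 < n" using I by (simp add: input_ok_def)
  have "A1 (Suc (s 20 0)) \<le> M" "Suc (s 20 0) < n \<Longrightarrow> A1 (Suc (s 20 0)) \<le> A1 (Suc (Suc (s 20 0)))"
    using A1_le_M[of "Suc (s 20 0)"] A1_mono[of "Suc (s 20 0)"] v by auto
  moreover have "src (s 21 0) = s 20 0" if "s 21 0 < A1 (Suc (s 20 0))"
    using src_eq[OF v _ that] I by simp
  moreover have "s 1 = A1" "s 0 0 = n" using I by (auto simp: input_ok_def)
  ultimately show "vc W (If (Minus (Cell 1 (Plus (reg 20) (Const 1))) (reg 21))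
        (Seq (Assign 6 (reg 21) (reg 20)) (incr 21)) (incr 20))
      (\<lambda>s'. (input_ok s' \<and> (\<forall>k<12. s' 5 k = k mod 3) \<and> s' 20 0 \<le> n \<and> A1 (s' 20 0) \<le> s' 21 0 \<and>
        s' 21 0 \<le> M \<and> (s' 20 0 < n \<longrightarrow> s' 21 0 \<le> A1 (Suc (s' 20 0))) \<and> (\<forall>j<s' 21 0. s' 6 j = src j)) \<and>
        (n - s' 20 0) + (M - s' 21 0) < (n - s 20 0) + (M - s 21 0)) s"
    using I v W_lin by (auto simp: less_Suc_eq)
qed (use assms A1_0 A1_n A1_le_M in \<open>auto simp: static_def input_ok_def\<close>)

text \<open>A pair of target and colour difference in mixed radix. By properness the digit 0 does
  not occur (\<open>key_cases\<close>), so only the cells \<open>3 * u + 1\<close> and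
  \<open>3 * u + 2\<close> count arcs.\<close>

definition key :: "nat \<Rightarrow> nat" where
  "key j = 3 * dst j + (a (src j) + 3 - a (dst j)) mod 3"

lemma arc_key:
  assumes "static s" "s x 0 < M"
  shows "eval_expr s (arc_key x) = key (s x 0)" "fits W s (arc_key x)" "s 2 (s x 0) = dst (s x 0)"
proof -
  let ?j = "s x 0"
  have "a (src ?j) + 3 - a (dst ?j) < 12" "dst ?j < n" "src ?j < n" "a (src ?j) \<le> 3" "a (dst ?j) \<le> 3"
    using a_range[of "src ?j"] a_range[of "dst ?j"] src_range[OF assms(2)] dst_less[OF assms(2)]
    by auto
  moreover have "(a (src ?j) + 3 - a (dst ?j)) mod 3 \<le> 2" by simp
  ultimately show "eval_expr s (arc_key x) = key ?j" "fits W s (arc_key x)" "s 2 ?j = dst ?j"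
    using assms W_lin by (auto simp: arc_key_def static_def input_ok_def key_def)
qed

lemma card_arcs_le: "card {j. j < M \<and> P j} \<le> M"
proof -
  have "card {j. j < M \<and> P j} \<le> card {..<M}"
    by (rule card_mono) auto
  then show ?thesis by simp
qed

lemma wp_count_keys:
  assumes "static s" "s 7 = (\<lambda>_. 0)" "s 22 0 = 0"
  shows "wp W count_keys s M (\<lambda>s. static s \<and> (\<forall>x. s 7 x = card {j. j < M \<and> key j = x}))"
  unfolding count_keys_def
proof (rule wp_While_vc[where f = "\<lambda>s. M - s 22 0" and
      I = "\<lambda>s. static s \<and> s 22 0 \<le> M \<and> (\<forall>x. s 7 x = card {j. j < s 22 0 \<and> key j = x})"])
  fix s :: memory
  assume I: "static s \<and> s 22 0 \<le> M \<and> (\<forall>x. s 7 x = card {j. j < s 22 0 \<and> key j = x})"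
  have n: "s 0 0 = n" "s 1 = A1" using I by (auto simp: static_def input_ok_def)
  then show "fits W s (Minus (Cell 1 (reg 0)) (reg 22))"
    using W_lin I A1_n by simp
  assume "eval_expr s (Minus (Cell 1 (reg 0)) (reg 22)) \<noteq> 0"
  then have j: "s 22 0 < M" using I n A1_n by simp
  have card_Suc: "card {j. j < Suc i \<and> key j = x} =
      card {j. j < i \<and> key j = x} + (if key i = x then 1 else 0)" for i x
  proof -
    have "{j. j < Suc i \<and> key j = x} = (if key i = x then insert i else id) {j. j < i \<and> key j = x}"
      by (auto simp: less_Suc_eq)
    then show ?thesis by auto
  qed
  have le: "card {j. j < s 22 0 \<and> key j = x} \<le> M" for x
  proof -
    have "{j. j < s 22 0 \<and> key j = x} = {j. j < M \<and> j < s 22 0 \<and> key j = x}"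
      using j by auto
    then show ?thesis by (simp add: card_arcs_le)
  qed
  note k = arc_key[of s 22] arc_key[of "s(7 := f)" 22 for f]
  show "vc W (Seq (Assign 7 (arc_key 22) (Plus (Cell 7 (arc_key 22)) (Const 1))) (incr 22))
      (\<lambda>s'. (static s' \<and> s' 22 0 \<le> M \<and> (\<forall>x. s' 7 x = card {j. j < s' 22 0 \<and> key j = x})) \<and>
        M - s' 22 0 < M - s 22 0) s"
    using I j W_lin le[of "key (s 22 0)"] by (auto simp: k card_Suc)
qed (use assms A1_n in \<open>auto simp: static_def input_ok_def\<close>)

section \<open>Worklists, the common skeleton of peeling and search\<close>

text \<open>The queue \<open>Q\<close> has been read up to \<open>h\<close> and written up to \<open>t\<close>, the roots below \<open>r\<close> have been
  tried, and the arcs in \<open>{i..<e}\<close> are those of the vertex read last that are still to be handled.\<close>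

definition worklist ::
    "(nat \<Rightarrow> nat) \<Rightarrow> (nat \<Rightarrow> nat) \<Rightarrow> nat \<Rightarrow> nat \<Rightarrow> nat \<Rightarrow> nat \<Rightarrow> nat \<Rightarrow> bool" where
  "worklist vis Q h t r i e \<longleftrightarrow>
     h \<le> t \<and> r \<le> n \<and> inj_on Q {..<t} \<and> Q ` {..<t} \<subseteq> {..<n} \<and>
     (\<forall>u<n. vis u \<noteq> 0 \<longleftrightarrow> u \<in> Q ` {..<t}) \<and> (\<forall>u<n. vis u \<le> 1) \<and> i \<le> M \<and> e \<le> M \<and>
     (i < e \<longrightarrow> 0 < h \<and> e = A1 (Suc (Q (h - 1))) \<and> A1 (Q (h - 1)) \<le> i)"

definition handled :: "(nat \<Rightarrow> nat) \<Rightarrow> nat \<Rightarrow> nat \<Rightarrow> nat \<Rightarrow> nat set" where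
  "handled Q h i e = {j. j < M \<and> src j \<in> Q ` {..<h} \<and> \<not> (i \<le> j \<and> j < e)}"

text \<open>One summand for each branch of the merged loop: vertices to be read, roots to be tried,
  arcs to be handled.\<close>

definition worklist_measure :: "(nat \<Rightarrow> nat) \<Rightarrow> nat \<Rightarrow> nat \<Rightarrow> nat \<Rightarrow> nat \<Rightarrow> nat" where
  "worklist_measure Q h r i e = (n - h) + (n - r) + card ({..<M} - handled Q h i e)"

lemma worklist_le_n:
  assumes "worklist vis Q h t r i e"
  shows "t \<le> n"
proof -
  have "card (Q ` {..<t}) \<le> card {..<n}"
    using assms by (intro card_mono) (auto simp: worklist_def)
  then show ?thesis
    using assms by (simp add: worklist_def card_image)
qed

lemma worklist_init: "worklist (\<lambda>_. 0) Q 0 0 0 0 0"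
  by (simp add: worklist_def)

text \<open>Position \<open>t\<close> lies beyond the part of the queue that has been read, so
  neither the handled arcs nor the measure change.\<close>

lemma worklist_push:
  assumes "worklist vis Q h t r i e" "u < n" "vis u = 0"
  shows "worklist (vis(u := Suc 0)) (Q(t := u)) h (Suc t) r i e"
    "handled (Q(t := u)) h i' e' = handled Q h i' e'"
    "worklist_measure (Q(t := u)) h r' i' e' = worklist_measure Q h r' i' e'"
proof -
  have w: "h \<le> t" "r \<le> n" "inj_on Q {..<t}" "Q ` {..<t} \<subseteq> {..<n}"
    "\<And>u. u < n \<Longrightarrow> vis u \<noteq> 0 \<longleftrightarrow> u \<in> Q ` {..<t}" "\<forall>u<n. vis u \<le> 1" "i \<le> M \<and> e \<le> M"
    "i < e \<Longrightarrow> 0 < h \<and> e = A1 (Suc (Q (h - 1))) \<and> A1 (Q (h - 1)) \<le> i"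
    using assms(1) unfolding worklist_def by blast+
  have u: "u \<notin> Q ` {..<t}" using w(5)[OF assms(2)] assms(3) by simp
  have img: "(Q(t := u)) ` {..<Suc t} = insert u (Q ` {..<t})"
    by (auto simp: lessThan_Suc fun_upd_def)
  have imgh: "(Q(t := u)) ` {..<h} = Q ` {..<h}"
    using w(1) by (auto simp: fun_upd_def)
  show "worklist (vis(u := Suc 0)) (Q(t := u)) h (Suc t) r i e"
    unfolding worklist_def img
  proof (intro conjI allI impI)
    show "inj_on (Q(t := u)) {..<Suc t}"
      using w(3) u by (auto simp: inj_on_def less_Suc_eq)
    show "insert u (Q ` {..<t}) \<subseteq> {..<n}" using w(4) assms(2) by auto
    show "((vis(u := Suc 0)) x \<noteq> 0) = (x \<in> insert u (Q ` {..<t}))" if "x < n" for x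
      using w(5)[OF that] by simp
    show "e = A1 (Suc ((Q(t := u)) (h - 1)))" "A1 ((Q(t := u)) (h - 1)) \<le> i" if "i < e"
      using w(8)[OF that] w(1) by auto
  qed (use w in auto)
  show "handled (Q(t := u)) h i' e' = handled Q h i' e'" for i' e'
    unfolding handled_def imgh ..
  then show "worklist_measure (Q(t := u)) h r' i' e' = worklist_measure Q h r' i' e'"
    unfolding worklist_measure_def by simp
qed

lemma worklist_next:
  assumes "worklist vis Q h t r i e" "i < e"
  shows "worklist vis Q h t r (Suc i) e" "i < M" "src i = Q (h - 1)" "0 < h"
    "dst i < n" "i \<notin> handled Q h i e" "handled Q h (Suc i) e = insert i (handled Q h i e)"
    "worklist_measure Q h r (Suc i) e < worklist_measure Q h r i e"
proof -
  have w: "h \<le> t" "Q ` {..<t} \<subseteq> {..<n}" "e \<le> M" "0 < h" "e = A1 (Suc (Q (h - 1)))" "A1 (Q (h - 1)) \<le> i"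
    using assms unfolding worklist_def by blast+
  show i: "i < M" "0 < h" using w assms(2) by auto
  have "h - 1 < t" using w by simp
  then have "Q (h - 1) < n" using w(2) by auto
  then show src: "src i = Q (h - 1)" using src_eq w assms(2) by simp
  show "dst i < n" using dst_less[OF i(1)] .
  show "worklist vis Q h t r (Suc i) e" using assms unfolding worklist_def by auto
  show i_not: "i \<notin> handled Q h i e" using assms(2) by (simp add: handled_def)
  have "src i \<in> Q ` {..<h}" using src i by auto
  then show h: "handled Q h (Suc i) e = insert i (handled Q h i e)"
    using i assms(2) by (auto simp: handled_def)
  have "{..<M} - handled Q h (Suc i) e \<subset> {..<M} - handled Q h i e"
    using h i_not i by auto
  then have "card ({..<M} - handled Q h (Suc i) e) < card ({..<M} - handled Q h i e)"
    by (intro psubset_card_mono) auto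
  then show "worklist_measure Q h r (Suc i) e < worklist_measure Q h r i e"
    by (simp add: worklist_measure_def)
qed

text \<open>Reading \<open>Q h\<close> would add its arcs to the handled ones, but the new window
  withholds exactly these. So the set stays the same and the measure drops through
  \<open>n - h\<close>, where \<open>h < t\<close> and \<open>t \<le> n\<close>.\<close>

lemma worklist_pop:
  assumes "worklist vis Q h t r i e" "\<not> i < e" "h < t"
  shows "worklist vis Q (Suc h) t r (A1 (Q h)) (A1 (Suc (Q h)))" "Q h < n"
    "handled Q (Suc h) (A1 (Q h)) (A1 (Suc (Q h))) = handled Q h i e"
    "worklist_measure Q (Suc h) r (A1 (Q h)) (A1 (Suc (Q h))) < worklist_measure Q h r i e"
proof -
  have w: "inj_on Q {..<t}" "Q ` {..<t} \<subseteq> {..<n}"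
    using assms unfolding worklist_def by blast+
  show v: "Q h < n" using w(2) assms(3) by auto
  show "worklist vis Q (Suc h) t r (A1 (Q h)) (A1 (Suc (Q h)))"
    using assms A1_le_M[of "Suc (Q h)"] A1_le_M[of "Q h"] v unfolding worklist_def by auto
  have new: "Q h \<notin> Q ` {..<h}" using w(1) assms(3) by (fastforce simp: inj_on_def)
  have "src j = Q h \<longleftrightarrow> A1 (Q h) \<le> j \<and> j < A1 (Suc (Q h))" if "j < M" for j
    using src_range[OF that] src_eq[OF v] by auto
  then show h: "handled Q (Suc h) (A1 (Q h)) (A1 (Suc (Q h))) = handled Q h i e"
    using assms(2) new by (auto simp: handled_def lessThan_Suc) (metis imageI lessThan_iff)
  show "worklist_measure Q (Suc h) r (A1 (Q h)) (A1 (Suc (Q h))) < worklist_measure Q h r i e"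
    using assms(3) worklist_le_n[OF assms(1)] by (simp add: worklist_measure_def h)
qed

lemma worklist_root:
  assumes "worklist vis Q h t r i e" "r < n"
  shows "worklist vis Q h t (Suc r) i e"
    "worklist_measure Q h (Suc r) i e < worklist_measure Q h r i e"
  using assms by (auto simp: worklist_def worklist_measure_def)

lemma worklist_measure_le: "worklist_measure Q h r i e \<le> 2 * n + M"
proof -
  have "card ({..<M} - handled Q h i e) \<le> card {..<M}"
    by (rule card_mono) auto
  then show ?thesis by (simp add: worklist_measure_def)
qed

section \<open>Peeling down to the largest tight set\<close>

text \<open>Tight sets in terms of arcs; the direction of the arcs is immaterial because they come in
  opposite pairs.\<close>

definition tight_arcs :: "nat set \<Rightarrow> bool" where
  "tight_arcs X \<longleftrightarrow> X \<subseteq> {..<n} \<and> (\<forall>u\<in>X. \<forall>d\<in>{1, 2}. \<exists>j<M. src j \<in> X \<and> key j = 3 * u + d)"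

definition pending :: "nat set \<Rightarrow> nat \<Rightarrow> nat" where
  "pending H x = card {j. j < M \<and> key j = x \<and> j \<notin> H}"

lemma pending_insert:
  assumes "i < M" "i \<notin> H"
  shows "pending (insert i H) = (pending H)(key i := pending H (key i) - 1)" "pending H (key i) > 0"
proof -
  have fin: "finite {j. j < M \<and> key j = x \<and> j \<notin> H}" for x by simp
  have "{j. j < M \<and> key j = x \<and> j \<notin> insert i H} =
      (if x = key i then {j. j < M \<and> key j = x \<and> j \<notin> H} - {i} else {j. j < M \<and> key j = x \<and> j \<notin> H})" for x
    by auto
  then show "pending (insert i H) = (pending H)(key i := pending H (key i) - 1)"
    using assms fin by (auto simp: pending_def fun_eq_iff)
  show "pending H (key i) > 0"
    using assms fin by (auto simp: pending_def card_gt_0_iff)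
qed

lemma pending_le: "pending H x \<le> M"
  unfolding pending_def by (rule card_arcs_le)

definition peeled ::
    "(nat \<Rightarrow> nat) \<Rightarrow> (nat \<Rightarrow> nat) \<Rightarrow> (nat \<Rightarrow> nat) \<Rightarrow> nat \<Rightarrow> nat \<Rightarrow> nat \<Rightarrow> nat \<Rightarrow> nat \<Rightarrow> bool" where
  "peeled cnt vis Q h t r i e \<longleftrightarrow>
     worklist vis Q h t r i e \<and> cnt = pending (handled Q h i e) \<and>
     (\<forall>X. tight_arcs X \<longrightarrow> X \<inter> Q ` {..<t} = {})"

text \<open>The completeness half of the invariant: among the roots already tried, nothing removable
  has been overlooked. Soundness is the last conjunct of \<open>peeled\<close>.\<close>

definition scanned :: "(nat \<Rightarrow> nat) \<Rightarrow> (nat \<Rightarrow> nat) \<Rightarrow> nat \<Rightarrow> bool" where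
  "scanned cnt vis r \<longleftrightarrow> (\<forall>u<r. vis u = 0 \<longrightarrow> cnt (3 * u + 1) \<noteq> 0 \<and> cnt (3 * u + 2) \<noteq> 0)"

text \<open>If \<open>u\<close> were in \<open>X\<close>, tightness would give an arc from
  \<open>X\<close> counted in this cell. The count is zero, so the arc has been handled and its
  source was in the queue, which \<open>X\<close> does not meet.\<close>

lemma tight_arcs_not_peeled:
  assumes "peeled cnt vis Q h t r i e" "d \<in> {1, 2}" "cnt (3 * u + d) = 0" "tight_arcs X"
  shows "u \<notin> X"
proof
  assume "u \<in> X"
  then obtain j where j: "j < M" "src j \<in> X" "key j = 3 * u + d"
    using assms(2,4) unfolding tight_arcs_def by blast
  have "card {j. j < M \<and> key j = 3 * u + d \<and> j \<notin> handled Q h i e} = 0"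
    using assms(1,3) by (simp add: peeled_def pending_def)
  then have "j \<in> handled Q h i e" using j by simp
  then have "src j \<in> Q ` {..<h}" by (simp add: handled_def)
  moreover have "h \<le> t" "X \<inter> Q ` {..<t} = {}"
    using assms(1,4) by (auto simp: peeled_def worklist_def)
  ultimately show False using j(2) by fastforce
qed

lemma peeled_push:
  assumes "peeled cnt vis Q h t r i e" "u < n" "vis u = 0" "d \<in> {1, 2}" "cnt (3 * u + d) = 0"
  shows "peeled cnt (vis(u := Suc 0)) (Q(t := u)) h (Suc t) r i e"
proof -
  have w: "worklist vis Q h t r i e" using assms(1) by (simp add: peeled_def)
  note p = worklist_push[OF w assms(2,3)]
  have "X \<inter> (Q(t := u)) ` {..<Suc t} = {}" if "tight_arcs X" for X
  proof -
    have "u \<notin> X" by (rule tight_arcs_not_peeled[OF assms(1,4,5) that])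
    moreover have "X \<inter> Q ` {..<t} = {}" using assms(1) that by (simp add: peeled_def)
    moreover have "(Q(t := u)) ` {..<Suc t} = insert u (Q ` {..<t})"
      by (auto simp: lessThan_Suc fun_upd_def)
    ultimately show ?thesis by simp
  qed
  then show ?thesis
    using assms(1) p(1,2) by (simp add: peeled_def)
qed

lemma key_cases:
  assumes "j < M"
  shows "\<exists>d\<in>{1, 2}. key j = 3 * dst j + d"
proof -
  have "(a (src j) + 3 - a (dst j)) mod 3 \<noteq> 0"
    using a_range[of "src j"] a_range[OF dst_less[OF assms]] src_range[OF assms] a_proper[OF assms]
    by presburger
  moreover have "(a (src j) + 3 - a (dst j)) mod 3 < 3" by simp
  ultimately have "(a (src j) + 3 - a (dst j)) mod 3 \<in> {1, 2}" by auto
  then show ?thesis unfolding key_def by blast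
qed

lemma key_eqD: "j < M \<Longrightarrow> 3 * u + d = key j \<Longrightarrow> d \<le> 2 \<Longrightarrow> u = dst j"
  using key_cases[of j] by auto

lemma peeled_next:
  assumes "peeled cnt vis Q h t r i e" "i < e"
  shows "peeled (cnt(key i := cnt (key i) - 1)) vis Q h t r (Suc i) e" "cnt (key i) > 0"
  using assms worklist_next[of vis Q h t r i e] pending_insert[of i "handled Q h i e"]
  unfolding peeled_def by auto

text \<open>Only a counter of \<open>dst i\<close> falls, so \<open>scanned\<close> could break only
  there; the mark or the positive remainder prevents it.\<close>

lemma peel_arc_keep:
  assumes "peeled cnt vis Q h t r i e" "scanned cnt vis r" "i < e"
    and "vis (dst i) \<noteq> 0 \<or> cnt (key i) - 1 \<noteq> 0"
  shows "peeled (cnt(key i := cnt (key i) - 1)) vis Q h t r (Suc i) e"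
    "scanned (cnt(key i := cnt (key i) - 1)) vis r"
proof -
  show "peeled (cnt(key i := cnt (key i) - 1)) vis Q h t r (Suc i) e"
    using peeled_next[OF assms(1,3)] by simp
  have "i < M" using worklist_next(2) assms(1,3) by (auto simp: peeled_def)
  have "3 * u + 1 = key i \<Longrightarrow> u = dst i" "3 * u + 2 = key i \<Longrightarrow> u = dst i" for u
    using key_eqD[OF \<open>i < M\<close>, of u 1] key_eqD[OF \<open>i < M\<close>, of u 2] by auto
  then show "scanned (cnt(key i := cnt (key i) - 1)) vis r"
    using assms(2,4) unfolding scanned_def by (metis fun_upd_apply)
qed

lemma peel_arc_push:
  assumes "peeled cnt vis Q h t r i e" "scanned cnt vis r" "i < e"
    and "vis (dst i) = 0" "cnt (key i) - 1 = 0"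
  shows "peeled (cnt(key i := cnt (key i) - 1)) (vis(dst i := Suc 0)) (Q(t := dst i)) h (Suc t) r (Suc i) e"
    "scanned (cnt(key i := cnt (key i) - 1)) (vis(dst i := Suc 0)) r"
proof -
  have i: "i < M" using worklist_next(2) assms(1,3) by (auto simp: peeled_def)
  obtain d where d: "d \<in> {1, 2}" "key i = 3 * dst i + d" using key_cases[OF i] by blast
  show "peeled (cnt(key i := cnt (key i) - 1)) (vis(dst i := Suc 0)) (Q(t := dst i)) h (Suc t) r (Suc i) e"
    using peeled_push[OF peeled_next(1)[OF assms(1,3)] dst_less[OF i] assms(4) d(1)] d(2) assms(5)
    by simp
  have "3 * u + 1 = key i \<Longrightarrow> u = dst i" "3 * u + 2 = key i \<Longrightarrow> u = dst i" for u
    using key_eqD[OF \<open>i < M\<close>, of u 1] key_eqD[OF \<open>i < M\<close>, of u 2] by auto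
  then show "scanned (cnt(key i := cnt (key i) - 1)) (vis(dst i := Suc 0)) r"
    using assms(2) unfolding scanned_def by (metis One_nat_def fun_upd_apply zero_neq_one)
qed

lemma peel_pop:
  assumes "peeled cnt vis Q h t r i e" "\<not> i < e" "h < t"
  shows "peeled cnt vis Q (Suc h) t r (A1 (Q h)) (A1 (Suc (Q h)))"
  using assms worklist_pop[of vis Q h t r i e] by (simp add: peeled_def)

lemma peel_root_keep:
  assumes "peeled cnt vis Q h t r i e" "scanned cnt vis r" "r < n"
    "vis r \<noteq> 0 \<or> cnt (3 * r + 1) \<noteq> 0 \<and> cnt (3 * r + 2) \<noteq> 0"
  shows "peeled cnt vis Q h t (Suc r) i e" "scanned cnt vis (Suc r)"
  using assms worklist_root[of vis Q h t r i e] by (auto simp: peeled_def scanned_def less_Suc_eq)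

lemma peel_root_push:
  assumes "peeled cnt vis Q h t r i e" "scanned cnt vis r" "r < n"
    "vis r = 0" "cnt (3 * r + 1) = 0 \<or> cnt (3 * r + 2) = 0"
  shows "peeled cnt (vis(r := Suc 0)) (Q(t := r)) h (Suc t) (Suc r) i e"
    "scanned cnt (vis(r := Suc 0)) (Suc r)"
proof -
  obtain d where "d \<in> {1, 2}" "cnt (3 * r + d) = 0" using assms(5) by blast
  from peeled_push[OF assms(1,3,4) this]
  show "peeled cnt (vis(r := Suc 0)) (Q(t := r)) h (Suc t) (Suc r) i e"
    using worklist_root(1) assms(3) by (auto simp: peeled_def)
  show "scanned cnt (vis(r := Suc 0)) (Suc r)"
    using assms(2) by (auto simp: scanned_def less_Suc_eq)
qed

text \<open>With queue and window exhausted, the handled arcs are those with a marked source. The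
  remaining counts therefore count arcs from unmarked vertices, so the unmarked vertices form a
  tight set; by soundness it contains every other one.\<close>

lemma peel_end:
  assumes "peeled cnt vis Q h t n i e" "scanned cnt vis n" "\<not> i < e" "\<not> h < t" "u < n"
  shows "vis u = 0 \<longleftrightarrow> (\<exists>X. tight_arcs X \<and> u \<in> X)"
proof
  assume u: "vis u = 0"
  have w: "worklist vis Q h t n i e" using assms(1) by (simp add: peeled_def)
  then have ht: "h = t" using assms(4) by (simp add: worklist_def)
  have vis: "\<And>u. u < n \<Longrightarrow> vis u \<noteq> 0 \<longleftrightarrow> u \<in> Q ` {..<t}"
    using w unfolding worklist_def by blast
  have "tight_arcs {u. u < n \<and> vis u = 0}"
    unfolding tight_arcs_def
  proof (intro conjI ballI)
    fix u d :: nat assume u: "u \<in> {u. u < n \<and> vis u = 0}" and d: "d \<in> {1, 2}"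
    then have "pending (handled Q h i e) (3 * u + d) \<noteq> 0"
      using assms(1,2) unfolding peeled_def scanned_def by auto
    then have "{j. j < M \<and> key j = 3 * u + d \<and> j \<notin> handled Q h i e} \<noteq> {}"
      unfolding pending_def by (metis card.empty)
    then obtain j where j: "j < M" "key j = 3 * u + d" "j \<notin> handled Q h i e" by blast
    then have "src j \<notin> Q ` {..<t}" using assms(3) ht by (simp add: handled_def)
    then have "src j \<in> {u. u < n \<and> vis u = 0}" using vis src_range[OF j(1)] by blast
    then show "\<exists>j<M. src j \<in> {u. u < n \<and> vis u = 0} \<and> key j = 3 * u + d" using j by blast
  qed auto
  then show "\<exists>X. tight_arcs X \<and> u \<in> X" using u assms(5) by blast
next
  assume "\<exists>X. tight_arcs X \<and> u \<in> X"
  then have "u \<notin> Q ` {..<t}" using assms(1) unfolding peeled_def by blast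
  then show "vis u = 0"
    using assms(1,5) unfolding peeled_def worklist_def by blast
qed

lemma times3: "x + x + x = 3 * (x :: nat)"
  by simp

text \<open>Registers 23 to 27 hold \<open>h\<close>, \<open>t\<close>, \<open>r\<close>,
  \<open>i\<close> and \<open>e\<close> of the worklist over arrays 8 and 9. The guard is zero only
  if window, queue and roots are all exhausted, as \<open>peel_end\<close> requires.\<close>

lemma wp_peel:
  assumes "static s" "\<forall>x. s 7 x = card {j. j < M \<and> key j = x}" "s 8 = (\<lambda>_. 0)"
    "s 23 0 = 0" "s 24 0 = 0" "s 25 0 = 0" "s 26 0 = 0" "s 27 0 = 0"
  shows "wp W peel s (2 * n + M) (\<lambda>s. static s \<and> (\<forall>u<n. s 8 u \<le> 1) \<and>
    (\<forall>u<n. s 8 u = 0 \<longleftrightarrow> (\<exists>X. tight_arcs X \<and> u \<in> X)))"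
  unfolding peel_def
proof (rule wp_While_vc[where f = "\<lambda>s. worklist_measure (s 9) (s 23 0) (s 25 0) (s 26 0) (s 27 0)" and
      I = "\<lambda>s. static s \<and> peeled (s 7) (s 8) (s 9) (s 23 0) (s 24 0) (s 25 0) (s 26 0) (s 27 0) \<and>
        scanned (s 7) (s 8) (s 25 0)"])
  have "s 7 = pending (handled (s 9) 0 0 0)"
    using assms(2) by (auto simp: pending_def handled_def fun_eq_iff)
  then show "static s \<and> peeled (s 7) (s 8) (s 9) (s 23 0) (s 24 0) (s 25 0) (s 26 0) (s 27 0) \<and>
        scanned (s 7) (s 8) (s 25 0)"
    using assms worklist_init by (simp add: peeled_def scanned_def)
next
  fix s :: memory
  assume I: "static s \<and> peeled (s 7) (s 8) (s 9) (s 23 0) (s 24 0) (s 25 0) (s 26 0) (s 27 0) \<and>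
        scanned (s 7) (s 8) (s 25 0)"
  then have w: "worklist (s 8) (s 9) (s 23 0) (s 24 0) (s 25 0) (s 26 0) (s 27 0)"
    and cnt: "\<And>x. s 7 x \<le> M" and st: "static s"
    and pe: "peeled (s 7) (s 8) (s 9) (s 23 0) (s 24 0) (s 25 0) (s 26 0) (s 27 0)"
    and sc: "scanned (s 7) (s 8) (s 25 0)"
    by (auto simp: peeled_def pending_le)
  have n: "s 0 0 = n" "s (Suc 0) = A1" "s 2 = dst" using st by (auto simp: static_def input_ok_def)
  have bnd: "s 23 0 \<le> n" "s 24 0 \<le> n" "s 25 0 \<le> n" "s 26 0 \<le> M" "s 27 0 \<le> M"
    using w worklist_le_n[OF w] by (auto simp: worklist_def)
  show "fits W s (Plus (Plus (Minus (reg 0) (reg 25)) (Minus (reg 24) (reg 23))) (Minus (reg 27) (reg 26)))"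
    using W_lin n bnd by auto
  assume run: "eval_expr s (Plus (Plus (Minus (reg 0) (reg 25)) (Minus (reg 24) (reg 23))) (Minus (reg 27) (reg 26))) \<noteq> 0"
  note k = arc_key(1,2)[of _ 26]
  have "s 25 0 < n" if "\<not> s 26 0 < s 27 0" "\<not> s 23 0 < s 24 0"
    using run n(1) that by simp
  then consider (arc) "s 26 0 < s 27 0" | (pop) "\<not> s 26 0 < s 27 0" "s 23 0 < s 24 0"
    | (root) "\<not> s 26 0 < s 27 0" "\<not> s 23 0 < s 24 0" "s 25 0 < n"
    by blast
  then show "vc W (If (Minus (reg 27) (reg 26))
        (Seq (Assign 7 (arc_key 26) (Minus (Cell 7 (arc_key 26)) (Const 1)))
        (Seq (If (Plus (Cell 8 (Cell 2 (reg 26))) (Cell 7 (arc_key 26))) Skip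
                (push 8 9 24 (Cell 2 (reg 26))))
             (incr 26)))
        (If (Minus (reg 24) (reg 23))
           (Seq (set_reg 26 (Cell 1 (Cell 9 (reg 23))))
           (Seq (set_reg 27 (Cell 1 (Plus (Cell 9 (reg 23)) (Const 1))))
                (incr 23)))
           (Seq (If (Cell 8 (reg 25)) Skip
                  (If (Plus (Minus (Const 1) (Cell 7 (Plus (triple (reg 25)) (Const 1))))
                            (Minus (Const 1) (Cell 7 (Plus (triple (reg 25)) (Const 2)))))
                     (push 8 9 24 (reg 25)) Skip))
                (incr 25))))
     (\<lambda>s'. (static s' \<and> peeled (s' 7) (s' 8) (s' 9) (s' 23 0) (s' 24 0) (s' 25 0) (s' 26 0) (s' 27 0) \<and>
        scanned (s' 7) (s' 8) (s' 25 0)) \<and>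
        worklist_measure (s' 9) (s' 23 0) (s' 25 0) (s' 26 0) (s' 27 0) <
        worklist_measure (s 9) (s 23 0) (s 25 0) (s 26 0) (s 27 0)) s"
  proof cases
    case arc
    note w' = worklist_next[OF w arc]
    have i: "s 26 0 < M" "dst (s 26 0) < n" "src (s 26 0) < n"
      using w'(2) dst_less src_range by auto
    have vis: "s 8 (dst (s 26 0)) \<le> 1" using w i(2) by (auto simp: worklist_def)
    show ?thesis
    proof (cases "s 8 (dst (s 26 0)) \<noteq> 0 \<or> s 7 (key (s 26 0)) - 1 \<noteq> 0")
      case True
      then show ?thesis
        using st i bnd arc W_lin w'(8) vis peel_arc_keep[OF pe sc arc]
          cnt[of "key (s 26 0)"]
        by (auto simp: n k)
    next
      case False
      then show ?thesis
        using st i bnd arc W_lin w'(8) vis peel_arc_push[OF pe sc arc]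
          worklist_push(3)[OF w i(2)]
          cnt[of "key (s 26 0)"]
        by (auto simp: n k push_def)
    qed
  next
    case pop
    note w' = worklist_pop[OF w pop]
    have "A1 (s 9 (s 23 0)) \<le> M" "A1 (Suc (s 9 (s 23 0))) \<le> M"
      using A1_le_M w'(2) by auto
    then show ?thesis
      using st bnd pop W_lin w' peel_pop[OF pe pop] sc
      by (auto simp: n)
  next
    case root
    note w' = worklist_root[OF w root(3)]
    have vis: "s 8 (s 25 0) \<le> 1" using w root(3) by (auto simp: worklist_def)
    show ?thesis
      using st bnd root W_lin w' peel_root_keep[OF pe sc root(3)] peel_root_push[OF pe sc root(3)]
        worklist_push(3)[OF w root(3)]
        cnt[of "3 * s 25 0 + 1"] cnt[of "3 * s 25 0 + 2"] vis
      by (auto simp: n push_def triple_def times3)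
  qed
next
  fix s :: memory
  assume I: "static s \<and> peeled (s 7) (s 8) (s 9) (s 23 0) (s 24 0) (s 25 0) (s 26 0) (s 27 0) \<and>
        scanned (s 7) (s 8) (s 25 0)"
    and stop: "eval_expr s (Plus (Plus (Minus (reg 0) (reg 25)) (Minus (reg 24) (reg 23))) (Minus (reg 27) (reg 26))) = 0"
  have "s 0 0 = n" using I by (simp add: static_def input_ok_def)
  moreover have "s 25 0 \<le> n" using I by (auto simp: peeled_def worklist_def)
  ultimately have "s 25 0 = n" "\<not> s 26 0 < s 27 0" "\<not> s 23 0 < s 24 0" using stop by auto
  moreover have "\<forall>u<n. s 8 u \<le> 1"
    using I unfolding peeled_def worklist_def by blast
  ultimately show "static s \<and> (\<forall>u<n. s 8 u \<le> 1) \<and> (\<forall>u<n. s 8 u = 0 \<longleftrightarrow> (\<exists>X. tight_arcs X \<and> u \<in> X))"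
    using I peel_end[of "s 7" "s 8" "s 9" "s 23 0" "s 24 0" "s 26 0" "s 27 0"] by auto
qed (rule worklist_measure_le)

end

section \<open>A candidate shift by breadth-first search\<close>

text \<open>The table value is one more than the change of the shift along the arc; the summand 7 is
  congruent to 1 and keeps the index within the table.\<close>

definition arc_step :: "nat \<Rightarrow> expr" where
  "arc_step j = Cell 5 (Minus
     (Plus (Plus (Cell 3 (Cell 2 (reg j))) (Cell 4 (Cell 6 (reg j)))) (Const 7))
     (Plus (Cell 4 (Cell 2 (reg j))) (Cell 3 (Cell 6 (reg j)))))"

definition base_expr :: expr where
  "base_expr = Plus (triple (reg 0)) (Const 6)"

definition bfs_guard :: expr where
  "bfs_guard = Plus (Plus (Minus (reg 0) (reg 35)) (Minus (reg 34) (reg 33))) (Minus (reg 37) (reg 36))"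

text \<open>The same merged loop as in \<open>peel\<close>, with registers 33 to 37 and the number
  of components in 38. A root is tried only when window and queue are empty, so each component fills
  a contiguous segment of the queue.\<close>

definition bfs_body :: com where
  "bfs_body =
     (If (Minus (reg 37) (reg 36))
        (Seq (If (Cell 10 (Cell 2 (reg 36))) Skip
                (Seq (Assign 12 (Cell 2 (reg 36))
                        (Minus (Plus (Cell 12 (Cell 6 (reg 36))) (arc_step 36)) (Const 1)))
                (Seq (Assign 13 (Cell 2 (reg 36)) (Cell 13 (Cell 6 (reg 36))))
                     (push 10 11 34 (Cell 2 (reg 36))))))
             (incr 36))
        (If (Minus (reg 34) (reg 33))
           (Seq (set_reg 36 (Cell 1 (Cell 11 (reg 33))))
           (Seq (set_reg 37 (Cell 1 (Plus (Cell 11 (reg 33)) (Const 1))))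
                (incr 33)))
           (Seq (If (Cell 10 (reg 35)) Skip
                  (Seq (Assign 12 (reg 35)
                         (Plus base_expr (Cell 5 (Minus (Plus (Cell 3 (reg 35)) (Const 3)) (Cell 4 (reg 35))))))
                  (Seq (Assign 13 (reg 35) (reg 38))
                  (Seq (Assign 14 (reg 38) (reg 34))
                  (Seq (incr 38)
                       (push 10 11 34 (reg 35)))))))
                (incr 35))))"

definition bfs_loop :: com where
  "bfs_loop = While bfs_guard bfs_body"

text \<open>The last assignment writes a sentinel, so that the end of every component is the start
  of the next one.\<close>

definition bfs :: com where
  "bfs = Seq bfs_loop (Assign 14 (reg 38) (reg 34))"

context ram_instance
begin

definition arc_diff :: "nat \<Rightarrow> nat" where
  "arc_diff j = (a (dst j) + b (src j) + 7 - (b (dst j) + a (src j))) mod 3"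

lemma arc_step:
  assumes "static s" "s x 0 < M"
  shows "eval_expr s (arc_step x) = arc_diff (s x 0)" "fits W s (arc_step x)"
proof -
  let ?j = "s x 0"
  have 1: "dst ?j < n" "src ?j < n"
    using src_range[OF assms(2)] dst_less[OF assms(2)] by auto
  moreover have "a (src ?j) \<le> 3" "a (dst ?j) \<le> 3" "b (src ?j) \<le> 3" "b (dst ?j) \<le> 3"
    "a (dst ?j) + b (src ?j) + 7 - (b (dst ?j) + a (src ?j)) < 12"
    using a_range[OF 1(1)] a_range[OF 1(2)] b_range[OF 1(1)] b_range[OF 1(2)] by linarith+
  moreover have "(a (dst ?j) + b (src ?j) + 7 - (b (dst ?j) + a (src ?j))) mod 3 \<le> 2" by simp
  moreover have "s 3 = a" "s 4 = b" "s 2 = dst" "s 6 ?j = src ?j"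
    "\<And>i. i < 12 \<Longrightarrow> s 5 i = i mod 3"
    using assms by (auto simp: static_def input_ok_def)
  ultimately show "eval_expr s (arc_step x) = arc_diff ?j" "fits W s (arc_step x)"
    using assms(2) W_lin by (auto simp: arc_step_def arc_diff_def)
qed

text \<open>A multiple of 3 large enough that no truncation occurs when subtracting from values of the
  candidate shift.\<close>

abbreviation base :: nat where "base \<equiv> 3 * n + 6"

lemma base_expr:
  assumes "static s"
  shows "eval_expr s base_expr = base" "fits W s base_expr"
  using assms W_lin by (auto simp: base_expr_def triple_def static_def input_ok_def)

section \<open>The invariant of the search\<close>

definition potential :: "(nat \<Rightarrow> int) \<Rightarrow> bool" where
  "potential F \<longleftrightarrow> (\<forall>v<n. 3 dvd int (a v) - F v - int (b v)) \<and> (\<forall>j<M. \<bar>F (src j) - F (dst j)\<bar> \<le> 1)"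

text \<open>Segments are described by their starts alone, a form that survives the opening of
  further components. A value strays from the root value, which lies in
  \<open>{base..base + 2}\<close>, by at most 1 per queue position since the start
  \<open>st\<close>. The last conjunct says that \<open>E\<close> is, up to a constant on each
  component, the only possible shift; it does not claim that \<open>E\<close> is one.\<close>

definition placed ::
    "(nat \<Rightarrow> nat) \<Rightarrow> (nat \<Rightarrow> nat) \<Rightarrow> (nat \<Rightarrow> nat) \<Rightarrow> (nat \<Rightarrow> nat) \<Rightarrow> nat \<Rightarrow> nat \<Rightarrow> bool" where
  "placed Q E cmp st k t \<longleftrightarrow>
     (\<forall>p<t. cmp (Q p) < k \<and> (\<forall>c<k. c \<le> cmp (Q p) \<longleftrightarrow> st c \<le> p) \<and>
        E (Q p) \<le> base + 2 + (p - st (cmp (Q p))) \<and> base \<le> E (Q p) + (p - st (cmp (Q p))) \<and>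
        3 dvd int (a (Q p)) - int (E (Q p)) - int (b (Q p))) \<and>
     (\<forall>F. potential F \<longrightarrow> (\<forall>p<t. \<forall>q<t. cmp (Q p) = cmp (Q q) \<longrightarrow>
        F (Q p) - int (E (Q p)) = F (Q q) - int (E (Q q))))"

text \<open>Covers both ways of placing a vertex: extending the current component
  (\<open>k' = k\<close>) and opening a new one (\<open>k' = Suc k\<close>, with \<open>st'\<close>
  recording \<open>t\<close>).\<close>

lemma placed_add:
  assumes pl: "placed Q E cmp st k t" and u: "u \<notin> Q ` {..<t}"
    and k': "k \<le> k'" "\<And>c. c < k \<Longrightarrow> st' c = st c" "\<And>c. k \<le> c \<Longrightarrow> c < k' \<Longrightarrow> t \<le> st' c"
    and c: "c < k'" "\<And>d. d < k' \<Longrightarrow> d \<le> c \<longleftrightarrow> st' d \<le> t"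
    and x: "x \<le> base + 2 + (t - st' c)" "base \<le> x + (t - st' c)" "3 dvd int (a u) - int x - int (b u)"
    and F: "\<And>F p. potential F \<Longrightarrow> p < t \<Longrightarrow> cmp (Q p) = c \<Longrightarrow> F (Q p) - int (E (Q p)) = F u - int x"
  shows "placed (Q(t := u)) (E(u := x)) (cmp(u := c)) st' k' (Suc t)"
proof -
  have old: "(Q(t := u)) p = Q p" "(E(u := x)) (Q p) = E (Q p)" "(cmp(u := c)) (Q p) = cmp (Q p)"
    if "p < t" for p using that u by auto
  have P: "cmp (Q p) < k" "\<And>d. d < k \<Longrightarrow> d \<le> cmp (Q p) \<longleftrightarrow> st d \<le> p"
    "E (Q p) \<le> base + 2 + (p - st (cmp (Q p)))" "base \<le> E (Q p) + (p - st (cmp (Q p)))"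
    "3 dvd int (a (Q p)) - int (E (Q p)) - int (b (Q p))" if "p < t" for p
    using pl that unfolding placed_def by blast+
  show ?thesis
    unfolding placed_def
  proof (rule conjI)
    show "\<forall>p<Suc t. (cmp(u := c)) ((Q(t := u)) p) < k' \<and>
        (\<forall>d<k'. d \<le> (cmp(u := c)) ((Q(t := u)) p) \<longleftrightarrow> st' d \<le> p) \<and>
        (E(u := x)) ((Q(t := u)) p) \<le> base + 2 + (p - st' ((cmp(u := c)) ((Q(t := u)) p))) \<and>
        base \<le> (E(u := x)) ((Q(t := u)) p) + (p - st' ((cmp(u := c)) ((Q(t := u)) p))) \<and>
        3 dvd int (a ((Q(t := u)) p)) - int ((E(u := x)) ((Q(t := u)) p)) - int (b ((Q(t := u)) p))"
    proof (intro allI impI)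
      fix p assume p: "p < Suc t"
      show "(cmp(u := c)) ((Q(t := u)) p) < k' \<and>
        (\<forall>d<k'. d \<le> (cmp(u := c)) ((Q(t := u)) p) \<longleftrightarrow> st' d \<le> p) \<and>
        (E(u := x)) ((Q(t := u)) p) \<le> base + 2 + (p - st' ((cmp(u := c)) ((Q(t := u)) p))) \<and>
        base \<le> (E(u := x)) ((Q(t := u)) p) + (p - st' ((cmp(u := c)) ((Q(t := u)) p))) \<and>
        3 dvd int (a ((Q(t := u)) p)) - int ((E(u := x)) ((Q(t := u)) p)) - int (b ((Q(t := u)) p))"
      proof (cases "p = t")
        case True
        then show ?thesis using c x by simp
      next
        case False
        then have pt: "p < t" using p by simp
        have "d \<le> cmp (Q p) \<longleftrightarrow> st' d \<le> p" if d: "d < k'" for d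
        proof (cases "d < k")
          case True
          then show ?thesis using P(2)[OF pt] k'(2) by simp
        next
          case False
          then show ?thesis using P(1)[OF pt] k'(3)[of d] d pt by simp
        qed
        then show ?thesis using P[OF pt] k' old[OF pt] by simp
      qed
    qed
    show "\<forall>F. potential F \<longrightarrow> (\<forall>p<Suc t. \<forall>q<Suc t.
        (cmp(u := c)) ((Q(t := u)) p) = (cmp(u := c)) ((Q(t := u)) q) \<longrightarrow>
        F ((Q(t := u)) p) - int ((E(u := x)) ((Q(t := u)) p)) =
        F ((Q(t := u)) q) - int ((E(u := x)) ((Q(t := u)) q)))"
    proof (intro allI impI)
      fix G p q assume pot: "potential G" and pq: "p < Suc t" "q < Suc t"
        "(cmp(u := c)) ((Q(t := u)) p) = (cmp(u := c)) ((Q(t := u)) q)"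
      have both: "cmp (Q p) = cmp (Q q) \<Longrightarrow> G (Q p) - int (E (Q p)) = G (Q q) - int (E (Q q))"
        if "p < t" "q < t"
        using pl pot that unfolding placed_def by blast
      have t: "(Q(t := u)) t = u" "(E(u := x)) u = x" "(cmp(u := c)) u = c" by simp_all
      consider "p = t" "q = t" | "p = t" "q < t" | "p < t" "q = t" | "p < t" "q < t"
        using pq(1,2) by linarith
      then show "G ((Q(t := u)) p) - int ((E(u := x)) ((Q(t := u)) p)) =
        G ((Q(t := u)) q) - int ((E(u := x)) ((Q(t := u)) q))"
      proof cases
        case 2
        then show ?thesis using pq(3) F[OF pot 2(2)] by (simp only: old[OF 2(2)] t)
      next
        case 3
        then show ?thesis using pq(3) F[OF pot 3(1)] by (simp only: old[OF 3(1)] t)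
      next
        case 4
        then show ?thesis using pq(3) both[OF 4] by (simp only: old[OF 4(1)] old[OF 4(2)])
      qed simp
    qed
  qed
qed

text \<open>The strict bound \<open>st c < h\<close> during an open window says that even the
  youngest component has had its root read; hence the arcs in the window leave a vertex of that
  component.\<close>

definition searching ::
    "(nat \<Rightarrow> nat) \<Rightarrow> (nat \<Rightarrow> nat) \<Rightarrow> (nat \<Rightarrow> nat) \<Rightarrow> (nat \<Rightarrow> nat) \<Rightarrow> (nat \<Rightarrow> nat) \<Rightarrow>
     nat \<Rightarrow> nat \<Rightarrow> nat \<Rightarrow> nat \<Rightarrow> nat \<Rightarrow> nat \<Rightarrow> bool" where
  "searching vis Q E cmp st h t r i e k \<longleftrightarrow>
     worklist vis Q h t r i e \<and> placed Q E cmp st k t \<and> k \<le> t \<and>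
     (\<forall>c<k. st c \<le> h \<and> (i < e \<longrightarrow> st c < h)) \<and> (\<forall>c d. c \<le> d \<longrightarrow> d < k \<longrightarrow> st c \<le> st d) \<and>
     (\<forall>j\<in>handled Q h i e. vis (dst j) \<noteq> 0 \<and> cmp (src j) = cmp (dst j)) \<and>
     (\<forall>u<r. vis u \<noteq> 0)"

lemma searching_init: "searching (\<lambda>_. 0) Q E cmp st 0 0 0 0 0 0"
  by (simp add: searching_def worklist_init placed_def handled_def)

lemma handled_src: "j \<in> handled Q h i e \<Longrightarrow> j < M \<and> src j \<in> Q ` {..<h}"
  by (simp add: handled_def)

lemma searching_current:
  assumes "searching vis Q E cmp st h t r i e k" "i < e"
  shows "cmp (src i) < k" "\<And>c. c < k \<Longrightarrow> c \<le> cmp (src i)" "st (cmp (src i)) < h"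
    "base \<le> E (src i) + n"
    "E (src i) \<le> base + 2 + (h - 1 - st (cmp (src i)))"
    "base \<le> E (src i) + (h - 1 - st (cmp (src i)))"
    "3 dvd int (a (src i)) - int (E (src i)) - int (b (src i))"
proof -
  have w: "worklist vis Q h t r i e" and pl: "placed Q E cmp st k t"
    and st: "\<forall>c<k. st c < h"
    using assms by (auto simp: searching_def)
  note w' = worklist_next[OF w assms(2)]
  have h: "h - 1 < t" "h \<le> t" using w w'(4) by (auto simp: worklist_def)
  have P: "cmp (Q (h - 1)) < k" "\<And>c. c < k \<Longrightarrow> c \<le> cmp (Q (h - 1)) \<longleftrightarrow> st c \<le> h - 1"
    "E (Q (h - 1)) \<le> base + 2 + (h - 1 - st (cmp (Q (h - 1))))"
    "base \<le> E (Q (h - 1)) + (h - 1 - st (cmp (Q (h - 1))))"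
    "3 dvd int (a (Q (h - 1))) - int (E (Q (h - 1))) - int (b (Q (h - 1)))"
    using pl h(1) unfolding placed_def by blast+
  show "cmp (src i) < k" "st (cmp (src i)) < h"
    "E (src i) \<le> base + 2 + (h - 1 - st (cmp (src i)))"
    "base \<le> E (src i) + (h - 1 - st (cmp (src i)))"
    "3 dvd int (a (src i)) - int (E (src i)) - int (b (src i))"
    using P st by (simp_all add: w'(3))
  show "base \<le> E (src i) + n"
    using P(4) worklist_le_n[OF w] h by (simp add: w'(3))
  show "c \<le> cmp (src i)" if "c < k" for c
  proof -
    have "st c \<le> h - 1" using st that w'(4) by (auto simp: Suc_le_eq)
    then show ?thesis using P(2)[OF that] by (simp add: w'(3))
  qed
qed

text \<open>A visited target in another component would be in an older one, hence read before the
  current source. Its arc back to the source would then be handled already, and handled arcs join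
  vertices of the same component.\<close>

lemma search_arc_keep:
  assumes "searching vis Q E cmp st h t r i e k" "i < e" "vis (dst i) \<noteq> 0"
  shows "searching vis Q E cmp st h t r (Suc i) e k"
proof -
  have w: "worklist vis Q h t r i e" and pl: "placed Q E cmp st k t"
    and st: "\<forall>c<k. st c < h"
    and ha: "\<And>j. j \<in> handled Q h i e \<Longrightarrow> cmp (src j) = cmp (dst j)"
    using assms by (auto simp: searching_def)
  note w' = worklist_next[OF w assms(2)]
  have inj: "inj_on Q {..<t}" and "h \<le> t" using w by (auto simp: worklist_def)
  have "dst i \<in> Q ` {..<t}" using w w'(5) assms(3) unfolding worklist_def by blast
  then obtain p where p: "p < t" "dst i = Q p" by auto
  note cur = searching_current[OF assms(1,2)]
  have P: "cmp (Q p) < k" "\<And>c. c < k \<Longrightarrow> c \<le> cmp (Q p) \<longleftrightarrow> st c \<le> p"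
    using pl p(1) unfolding placed_def by blast+
  have "cmp (src i) = cmp (dst i)"
  proof (rule ccontr)
    assume neq: "cmp (src i) \<noteq> cmp (dst i)"
    then have "\<not> cmp (src i) \<le> cmp (Q p)"
      using cur(2)[OF P(1)] p(2) by simp
    then have "p < st (cmp (src i))"
      using P(2)[OF cur(1)] by simp
    then have ph: "p < h - 1" using cur(3) by simp
    obtain j where j: "j < M" "src j = dst i" "dst j = src i" using arc_sym[OF w'(2)] by blast
    have "Q p \<noteq> Q (h - 1)"
      using inj_on_eq_iff[OF inj, of p "h - 1"] ph \<open>h \<le> t\<close> p(1) by simp
    moreover have "src j' = Q (h - 1)" if "i \<le> j'" "j' < e" for j'
    proof -
      have "A1 (Q (h - 1)) \<le> i" "e = A1 (Suc (Q (h - 1)))" using w assms(2) by (auto simp: worklist_def)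
      then show ?thesis
        using src_eq[of "Q (h - 1)" j'] src_range[OF w'(2)] w'(3) that by simp
    qed
    ultimately have "j \<in> handled Q h i e"
      using j p(2) ph by (auto simp: handled_def)
    from ha[OF this] show False using neq j by simp
  qed
  then show ?thesis using assms w' by (auto simp: searching_def)
qed

lemma search_arc_push:
  assumes "searching vis Q E cmp st h t r i e k" "i < e" "vis (dst i) = 0"
  shows "searching (vis(dst i := Suc 0)) (Q(t := dst i)) (E(dst i := E (src i) + arc_diff i - 1))
    (cmp(dst i := cmp (src i))) st h (Suc t) r (Suc i) e k"
proof -
  let ?u = "dst i" and ?v = "src i" and ?x = "E (src i) + arc_diff i - 1"
  have w: "worklist vis Q h t r i e" and pl: "placed Q E cmp st k t"
    and st: "\<forall>c<k. st c < h"
    and ha: "\<And>j. j \<in> handled Q h i e \<Longrightarrow> vis (dst j) \<noteq> 0 \<and> cmp (src j) = cmp (dst j)"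
    using assms by (auto simp: searching_def)
  note w' = worklist_next[OF w assms(2)]
  note p' = worklist_push[OF w'(1) w'(5) assms(3)]
  note cur = searching_current[OF assms(1,2)]
  have u: "?u \<notin> Q ` {..<t}" using w w'(5) assms(3) unfolding worklist_def by blast
  have t: "h \<le> t" using w by (simp add: worklist_def)
  have v: "?v < n" "?v = Q (h - 1)" "h - 1 < t" using src_range[OF w'(2)] w'(3,4) t by auto
  have d: "arc_diff i \<le> 2" by (simp add: arc_diff_def)
  \<comment> \<open>The final \<open>- 1\<close> in \<open>?x\<close> does not truncate, because
    \<open>base\<close> exceeds \<open>n\<close>.\<close>
  have E1: "E ?v \<ge> 1" using cur(4) by simp
  then have int_x: "int ?x = int (E ?v) + int (arc_diff i) - 1" by simp
  have x3: "3 dvd int (a ?u) - int ?x - int (b ?u)"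
  proof -
    have "b ?u + a ?v \<le> a ?u + b ?v + 7"
      using a_range[OF v(1)] b_range[OF v(1)] a_range[OF w'(5)] b_range[OF w'(5)] by simp
    then have "int (arc_diff i) = (int (a ?u) + int (b ?v) + 7 - (int (b ?u) + int (a ?v))) mod 3"
      by (simp add: arc_diff_def of_nat_diff zmod_int)
    then show ?thesis
      using cur(7) unfolding int_x by presburger
  qed
  have x: "?x \<le> base + 2 + (t - st (cmp ?v))" "base \<le> ?x + (t - st (cmp ?v))"
    using cur(3,5,6) E1 d t by auto
  have F: "F (Q p) - int (E (Q p)) = F ?u - int ?x"
    if F: "potential F" and p: "p < t" "cmp (Q p) = cmp ?v" for F p
  proof -
    have "F (Q p) - int (E (Q p)) = F ?v - int (E ?v)"
      using pl F p v(2,3) unfolding placed_def by metis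
    moreover have "3 dvd int (a ?u) - F ?u - int (b ?u)" "3 dvd int (a ?v) - F ?v - int (b ?v)"
      "\<bar>F ?v - F ?u\<bar> \<le> 1"
      using F v(1) w'(2,5) by (auto simp: potential_def)
    \<comment> \<open>Both sides are congruent modulo 3, and each of \<open>F\<close> and the stored
      values changes by at most 1 along the arc, so they differ by at most 2.\<close>
    moreover have "F ?u - int ?x = F ?v - int (E ?v)"
    proof -
      have "3 dvd (F ?u - int ?x) - (F ?v - int (E ?v))"
        using calculation(2,3) x3 cur(7) by presburger
      moreover have "\<bar>(F ?u - int ?x) - (F ?v - int (E ?v))\<bar> \<le> 2"
        using \<open>\<bar>F ?v - F ?u\<bar> \<le> 1\<close> d unfolding int_x by linarith
      ultimately show ?thesis by presburger
    qed
    ultimately show ?thesis by simp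
  qed
  have "placed (Q(t := ?u)) (E(?u := ?x)) (cmp(?u := cmp ?v)) st k (Suc t)"
  proof (rule placed_add[OF pl u])
    show "d \<le> cmp ?v \<longleftrightarrow> st d \<le> t" if "d < k" for d
    proof -
      have "st d < h" using st that by blast
      then show ?thesis using cur(2)[OF that] t by simp
    qed
  qed (use cur(1) x x3 F in auto)
  moreover have "(vis(?u := Suc 0)) (dst j) \<noteq> 0 \<and> (cmp(?u := cmp ?v)) (src j) = (cmp(?u := cmp ?v)) (dst j)"
    if "j \<in> handled (Q(t := ?u)) h (Suc i) e" for j
  proof (cases "j = i")
    case True
    then show ?thesis by simp
  next
    case False
    then have j: "j \<in> handled Q h i e" using that p'(2) w'(7) by simp
    have "src j \<in> Q ` {..<t}" using handled_src[OF j] t by auto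
    then have "src j \<noteq> ?u" using u by auto
    moreover have "dst j \<noteq> ?u" using ha[OF j] assms(3) by metis
    ultimately show ?thesis using ha[OF j] by simp
  qed
  moreover have "k \<le> Suc t" "\<forall>c<k. st c \<le> h" "\<forall>c d. c \<le> d \<longrightarrow> d < k \<longrightarrow> st c \<le> st d"
    "\<forall>u<r. (vis(?u := Suc 0)) u \<noteq> 0"
    using assms(1) by (auto simp: searching_def)
  ultimately show ?thesis
    using p'(1) st unfolding searching_def by blast
qed

lemma search_pop:
  assumes "searching vis Q E cmp st h t r i e k" "\<not> i < e" "h < t"
  shows "searching vis Q E cmp st (Suc h) t r (A1 (Q h)) (A1 (Suc (Q h))) k"
proof -
  have w: "worklist vis Q h t r i e" using assms by (auto simp: searching_def)
  note w' = worklist_pop[OF w assms(2,3)]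
  show ?thesis
    using assms w' unfolding searching_def by (auto simp: le_Suc_eq less_Suc_eq_le)
qed

lemma search_root_keep:
  assumes "searching vis Q E cmp st h t r i e k" "r < n" "vis r \<noteq> 0"
  shows "searching vis Q E cmp st h t (Suc r) i e k"
  using assms worklist_root(1)[of vis Q h t r i e] unfolding searching_def
  by (auto simp: less_Suc_eq)

lemma search_root_push:
  assumes "searching vis Q E cmp st h t r i e k" "r < n" "vis r = 0" "\<not> i < e" "\<not> h < t"
  shows "searching (vis(r := Suc 0)) (Q(t := r)) (E(r := base + (a r + 3 - b r) mod 3))
    (cmp(r := k)) (st(k := t)) h (Suc t) (Suc r) i e (Suc k)"
proof -
  let ?x = "base + (a r + 3 - b r) mod 3"
  have w: "worklist vis Q h t r i e" and pl: "placed Q E cmp st k t"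
    and st: "\<And>c. c < k \<Longrightarrow> st c \<le> h" "\<forall>c d. c \<le> d \<longrightarrow> d < k \<longrightarrow> st c \<le> st d"
    and ha: "\<And>j. j \<in> handled Q h i e \<Longrightarrow> vis (dst j) \<noteq> 0 \<and> cmp (src j) = cmp (dst j)"
    using assms by (auto simp: searching_def)
  note w' = worklist_root[OF w assms(2)]
  note p' = worklist_push[OF w'(1) assms(2,3)]
  have u: "r \<notin> Q ` {..<t}" using w assms(2,3) unfolding worklist_def by blast
  have t: "h = t" using w assms(5) by (simp add: worklist_def)
  have ab: "b r \<le> a r + 3" using a_range[OF assms(2)] b_range[OF assms(2)] by simp
  have x3: "3 dvd int (a r) - int ?x - int (b r)"
  proof -
    have "int ((a r + 3 - b r) mod 3) = (int (a r) + 3 - int (b r)) mod 3"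
      using ab by (simp add: of_nat_diff zmod_int)
    then have "int (a r) - int ?x - int (b r) =
        ((int (a r) + 3 - int (b r)) - (int (a r) + 3 - int (b r)) mod 3) - 3 * (int n + 3)"
      by simp
    then show ?thesis
      using dvd_minus_mod[of 3 "int (a r) + 3 - int (b r)"] by (simp only: dvd_diff dvd_triv_left)
  qed
  have m2: "(a r + 3 - b r) mod 3 \<le> 2" by simp
  have comp_less: "cmp (Q p) < k" if "p < t" for p
    using pl that unfolding placed_def by blast
  have "placed (Q(t := r)) (E(r := ?x)) (cmp(r := k)) (st(k := t)) (Suc k) (Suc t)"
  proof (rule placed_add[OF pl u])
    show "d \<le> k \<longleftrightarrow> (st(k := t)) d \<le> t" if "d < Suc k" for d
      using st(1)[of d] that t by auto
    \<comment> \<open>Vacuous: no vertex placed so far has the new component number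
      \<open>k\<close>.\<close>
    show "F (Q p) - int (E (Q p)) = F r - int ?x" if "p < t" "cmp (Q p) = k" for F p
      using comp_less[OF that(1)] that(2) by simp
  qed (use x3 m2 in auto)
  moreover have "(vis(r := Suc 0)) (dst j) \<noteq> 0 \<and> (cmp(r := k)) (src j) = (cmp(r := k)) (dst j)"
    if "j \<in> handled (Q(t := r)) h i e" for j
  proof -
    have j: "j \<in> handled Q h i e" using that p'(2) by simp
    have "src j \<in> Q ` {..<t}" using handled_src[OF j] t by auto
    then have "src j \<noteq> r" using u by auto
    moreover have "dst j \<noteq> r" using ha[OF j] assms(3) by metis
    ultimately show ?thesis using ha[OF j] by simp
  qed
  moreover have "\<forall>c<Suc k. (st(k := t)) c \<le> h" "\<forall>c d. c \<le> d \<longrightarrow> d < Suc k \<longrightarrow> (st(k := t)) c \<le> (st(k := t)) d"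
    using st t by (auto simp: less_Suc_eq)
  moreover have "Suc k \<le> Suc t" "\<forall>u<Suc r. (vis(r := Suc 0)) u \<noteq> 0"
    using assms(1) by (auto simp: searching_def less_Suc_eq)
  ultimately show ?thesis
    using p'(1) assms(4) unfolding searching_def by blast
qed

text \<open>What the later phases need from the search. The window for \<open>E\<close> is symmetric
  about \<open>base + 1\<close>, the middle of the three possible root values. The edge condition
  for \<open>E\<close> is deliberately absent: it holds only if a shift exists.\<close>

definition layout ::
    "(nat \<Rightarrow> nat) \<Rightarrow> (nat \<Rightarrow> nat) \<Rightarrow> (nat \<Rightarrow> nat) \<Rightarrow> (nat \<Rightarrow> nat) \<Rightarrow> nat \<Rightarrow> bool" where
  "layout Q E cmp st k \<longleftrightarrow>
     bij_betw Q {..<n} {..<n} \<and> k \<le> n \<and> st 0 = 0 \<and> st k = n \<and> (\<forall>c<k. st c \<le> st (Suc c)) \<and>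
     (\<forall>p<n. cmp (Q p) < k \<and> (\<forall>c<k. cmp (Q p) = c \<longleftrightarrow> st c \<le> p \<and> p < st (Suc c)) \<and>
        E (Q p) \<le> base + 1 + (st (Suc (cmp (Q p))) - st (cmp (Q p))) \<and>
        base + 1 \<le> E (Q p) + (st (Suc (cmp (Q p))) - st (cmp (Q p))) \<and>
        3 dvd int (a (Q p)) - int (E (Q p)) - int (b (Q p))) \<and>
     (\<forall>j<M. cmp (src j) = cmp (dst j)) \<and>
     (\<forall>F. potential F \<longrightarrow> (\<forall>u<n. \<forall>v<n. cmp u = cmp v \<longrightarrow> F u - int (E u) = F v - int (E v)))"

lemma search_end:
  assumes "searching vis Q E cmp st h t n i e k" "\<not> i < e" "\<not> h < t"
  shows "layout Q E cmp (st(k := t)) k" "t = n"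
proof -
  have w: "worklist vis Q h t n i e" and pl: "placed Q E cmp st k t" and kt: "k \<le> t"
    and st: "\<And>c. c < k \<Longrightarrow> st c \<le> h" "\<And>c d. c \<le> d \<Longrightarrow> d < k \<Longrightarrow> st c \<le> st d"
    and ha: "\<And>j. j \<in> handled Q h i e \<Longrightarrow> vis (dst j) \<noteq> 0 \<and> cmp (src j) = cmp (dst j)"
    and vis: "\<And>u. u < n \<Longrightarrow> vis u \<noteq> 0"
    using assms by (auto simp: searching_def)
  have ht: "h = t" using w assms(3) by (simp add: worklist_def)
  have Q: "inj_on Q {..<t}" "Q ` {..<t} \<subseteq> {..<n}" using w unfolding worklist_def by blast+
  have "u \<in> Q ` {..<t}" if "u < n" for u
    using w vis[OF that] that unfolding worklist_def by blast
  then have img: "Q ` {..<t} = {..<n}" using Q(2) by blast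
  have "card (Q ` {..<t}) = t" using Q(1) by (simp add: card_image)
  then show tn: "t = n" using img by simp
  let ?st = "st(k := t)"
  have P: "cmp (Q p) < k" "\<And>d. d < k \<Longrightarrow> d \<le> cmp (Q p) \<longleftrightarrow> st d \<le> p"
    "E (Q p) \<le> base + 2 + (p - st (cmp (Q p)))" "base \<le> E (Q p) + (p - st (cmp (Q p)))"
    "3 dvd int (a (Q p)) - int (E (Q p)) - int (b (Q p))" if "p < n" for p
    using pl that tn unfolding placed_def by blast+
  have seg: "cmp (Q p) = c \<longleftrightarrow> ?st c \<le> p \<and> p < ?st (Suc c)" if "p < n" "c < k" for p c
  proof (cases "Suc c < k")
    case True
    then show ?thesis using P(2)[OF that] P(2)[OF that(1) True] that by auto
  next
    case False
    then have "Suc c = k" using that by simp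
    then show ?thesis using P(1)[OF that(1)] P(2)[OF that] that tn by auto
  qed
  show "layout Q E cmp ?st k"
    unfolding layout_def
  proof (intro conjI)
    show "bij_betw Q {..<n} {..<n}" using Q(1) img tn by (simp add: bij_betw_def)
    show "k \<le> n" "?st k = n" using kt tn by auto
    show "?st 0 = 0"
    proof (cases "k = 0")
      case True
      then have "n = 0" using P(1) by (metis less_nat_zero_code neq0_conv)
      then show ?thesis using True tn by simp
    next
      case False
      then have "0 < n" using kt tn by simp
      then show ?thesis using P(2)[of 0 0] False by simp
    qed
    show "\<forall>c<k. ?st c \<le> ?st (Suc c)" using st ht by auto
    show "\<forall>p<n. cmp (Q p) < k \<and> (\<forall>c<k. cmp (Q p) = c \<longleftrightarrow> ?st c \<le> p \<and> p < ?st (Suc c)) \<and>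
        E (Q p) \<le> base + 1 + (?st (Suc (cmp (Q p))) - ?st (cmp (Q p))) \<and>
        base + 1 \<le> E (Q p) + (?st (Suc (cmp (Q p))) - ?st (cmp (Q p))) \<and>
        3 dvd int (a (Q p)) - int (E (Q p)) - int (b (Q p))"
    proof (intro allI impI)
      fix p assume p: "p < n"
      have "?st (cmp (Q p)) \<le> p" "p < ?st (Suc (cmp (Q p)))" "?st (cmp (Q p)) = st (cmp (Q p))"
        using seg[OF p P(1)[OF p]] P(1)[OF p] by auto
      then show "cmp (Q p) < k \<and> (\<forall>c<k. cmp (Q p) = c \<longleftrightarrow> ?st c \<le> p \<and> p < ?st (Suc c)) \<and>
        E (Q p) \<le> base + 1 + (?st (Suc (cmp (Q p))) - ?st (cmp (Q p))) \<and>
        base + 1 \<le> E (Q p) + (?st (Suc (cmp (Q p))) - ?st (cmp (Q p))) \<and>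
        3 dvd int (a (Q p)) - int (E (Q p)) - int (b (Q p))"
        using P[OF p] seg[OF p] by auto
    qed
    show "\<forall>j<M. cmp (src j) = cmp (dst j)"
    proof (intro allI impI)
      fix j assume j: "j < M"
      then have "j \<in> handled Q h i e"
        using src_range[OF j] img ht assms(2) by (auto simp: handled_def)
      then show "cmp (src j) = cmp (dst j)" using ha by blast
    qed
    show "\<forall>F. potential F \<longrightarrow> (\<forall>u<n. \<forall>v<n. cmp u = cmp v \<longrightarrow> F u - int (E u) = F v - int (E v))"
    proof (intro allI impI)
      fix F u v assume F: "potential F" and uv: "u < n" "v < n" "cmp u = cmp v"
      obtain p q where "u = Q p" "v = Q q" "p < t" "q < t" using img uv by (metis imageE lessThan_iff)
      then show "F u - int (E u) = F v - int (E v)"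
        using pl F uv(3) unfolding placed_def by blast
    qed
  qed
qed

lemma searching_bounds:
  assumes "searching vis Q E cmp st h t r i e k" "v \<in> Q ` {..<t}"
  shows "cmp v < n" "E v \<le> 4 * n + 10"
proof -
  have w: "worklist vis Q h t r i e" and pl: "placed Q E cmp st k t" and "k \<le> t"
    using assms by (auto simp: searching_def)
  obtain p where p: "v = Q p" "p < t" using assms(2) by auto
  have "cmp (Q p) < k" "E (Q p) \<le> base + 2 + (p - st (cmp (Q p)))"
    using pl p unfolding placed_def by blast+
  then show "cmp v < n" "E v \<le> 4 * n + 10"
    using p worklist_le_n[OF w] \<open>k \<le> t\<close> by auto
qed

definition bfs_inv :: "memory \<Rightarrow> bool" where
  "bfs_inv s \<longleftrightarrow> static s \<and>
     searching (s 10) (s 11) (s 12) (s 13) (s 14) (s 33 0) (s 34 0) (s 35 0) (s 36 0) (s 37 0) (s 38 0)"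

lemma vc_bfs_body:
  assumes "bfs_inv s" "eval_expr s bfs_guard \<noteq> 0"
  shows "vc W bfs_body (\<lambda>s'. bfs_inv s' \<and>
    worklist_measure (s' 11) (s' 33 0) (s' 35 0) (s' 36 0) (s' 37 0) <
    worklist_measure (s 11) (s 33 0) (s 35 0) (s 36 0) (s 37 0)) s"
proof -
  have st: "static s" and se: "searching (s 10) (s 11) (s 12) (s 13) (s 14) (s 33 0) (s 34 0) (s 35 0) (s 36 0) (s 37 0) (s 38 0)"
    using assms(1) by (auto simp: bfs_inv_def)
  then have w: "worklist (s 10) (s 11) (s 33 0) (s 34 0) (s 35 0) (s 36 0) (s 37 0)" and k: "s 38 0 \<le> s 34 0"
    by (auto simp: searching_def)
  have n: "s 0 0 = n" "s (Suc 0) = A1" "s 2 = dst" "s 3 = a" "s 4 = b"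
    using st by (auto simp: static_def input_ok_def)
  have bnd: "s 33 0 \<le> n" "s 34 0 \<le> n" "s 35 0 \<le> n" "s 36 0 \<le> M" "s 37 0 \<le> M" "s 38 0 \<le> n"
    using w worklist_le_n[OF w] k by (auto simp: worklist_def)
  note as = arc_step[of _ 36]
  have "s 35 0 < n" if "\<not> s 36 0 < s 37 0" "\<not> s 33 0 < s 34 0"
    using assms(2) n(1) that by (simp add: bfs_guard_def)
  then consider (arc) "s 36 0 < s 37 0" | (pop) "\<not> s 36 0 < s 37 0" "s 33 0 < s 34 0"
    | (root) "\<not> s 36 0 < s 37 0" "\<not> s 33 0 < s 34 0" "s 35 0 < n"
    by blast
  then show ?thesis
  proof cases
    case arc
    note w' = worklist_next[OF w arc]
    have i: "s 36 0 < M" "dst (s 36 0) < n" "src (s 36 0) < n"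
      using w'(2) dst_less src_range by auto
    have src: "s 6 (s 36 0) = src (s 36 0)" using st i(1) by (simp add: static_def)
    have vis: "s 10 (dst (s 36 0)) \<le> 1" using w i(2) by (auto simp: worklist_def)
    have v: "src (s 36 0) \<in> s 11 ` {..<s 34 0}"
      using w w'(3,4) by (auto simp: worklist_def)
    note sb = searching_bounds[OF se v]
    have d: "arc_diff (s 36 0) \<le> 2" by (simp add: arc_diff_def)
    show ?thesis
    proof (cases "s 10 (dst (s 36 0)) = 0")
      case True
      show ?thesis
        using st i bnd arc W_lin w'(8) sb d True search_arc_push[OF se arc True]
          worklist_push(3)[OF w i(2) True]
        by (simp add: n src as bfs_body_def push_def bfs_inv_def)
    next
      case False
      then show ?thesis
        using st i bnd arc W_lin w'(8) vis search_arc_keep[OF se arc]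
        by (simp add: n src bfs_body_def bfs_inv_def)
    qed
  next
    case pop
    note w' = worklist_pop[OF w pop]
    have "A1 (s 11 (s 33 0)) \<le> M" "A1 (Suc (s 11 (s 33 0))) \<le> M"
      using A1_le_M w'(2) by auto
    then show ?thesis
      using st bnd pop W_lin w' search_pop[OF se pop]
      by (simp add: n bfs_body_def bfs_inv_def)
  next
    case root
    note w' = worklist_root[OF w root(3)]
    have vis: "s 10 (s 35 0) \<le> 1" using w root(3) by (auto simp: worklist_def)
    have ab: "a (s 35 0) \<le> 3" "b (s 35 0) \<le> 3" "a (s 35 0) + 3 - b (s 35 0) < 12"
      using a_range[OF root(3)] b_range[OF root(3)] by auto
    have T: "s 5 (a (s 35 0) + 3 - b (s 35 0)) = (a (s 35 0) + 3 - b (s 35 0)) mod 3"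
      using st ab(3) by (simp add: static_def)
    have T2: "(a (s 35 0) + 3 - b (s 35 0)) mod 3 \<le> 2" by simp
    show ?thesis
    proof (cases "s 10 (s 35 0) = 0")
      case True
      show ?thesis
        using st bnd root W_lin w' ab T2 True search_root_push[OF se root(3) True root(1,2)]
          worklist_push(3)[OF w root(3) True]
        by (simp add: n T base_expr bfs_body_def push_def bfs_inv_def)
    next
      case False
      then show ?thesis
        using st bnd root W_lin w' vis search_root_keep[OF se root(3) False]
        by (simp add: n bfs_body_def bfs_inv_def)
    qed
  qed
qed

lemma wp_bfs:
  assumes "static s" "s 10 = (\<lambda>_. 0)" "\<forall>x\<in>{33..38}. s x 0 = 0"
  shows "wp W bfs s (2 * n + M) (\<lambda>s. static s \<and> layout (s 11) (s 12) (s 13) (s 14) (s 38 0))"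
proof -
  have "wp W bfs_loop s (2 * n + M) (\<lambda>s. static s \<and> layout (s 11) (s 12) (s 13) ((s 14)(s 38 0 := s 34 0)) (s 38 0) \<and>
      s 34 0 \<le> n \<and> s 38 0 \<le> n)"
    unfolding bfs_loop_def
  proof (rule wp_While_vc[where I = bfs_inv and
        f = "\<lambda>s. worklist_measure (s 11) (s 33 0) (s 35 0) (s 36 0) (s 37 0)"])
    show "bfs_inv s" using assms searching_init by (simp add: bfs_inv_def)
    show "fits W s bfs_guard" if "bfs_inv s" for s
    proof -
      have w: "worklist (s 10) (s 11) (s 33 0) (s 34 0) (s 35 0) (s 36 0) (s 37 0)"
        using that by (simp add: bfs_inv_def searching_def)
      have "s 33 0 \<le> n" "s 34 0 \<le> n" "s 35 0 \<le> n" "s 36 0 \<le> M" "s 37 0 \<le> M" "s 0 0 = n"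
        using w worklist_le_n[OF w] that by (auto simp: worklist_def bfs_inv_def static_def input_ok_def)
      then show ?thesis using W_lin by (auto simp: bfs_guard_def)
    qed
    show "static s \<and> layout (s 11) (s 12) (s 13) ((s 14)(s 38 0 := s 34 0)) (s 38 0) \<and> s 34 0 \<le> n \<and> s 38 0 \<le> n"
      if I: "bfs_inv s" and stop: "eval_expr s bfs_guard = 0" for s
    proof -
      have se: "searching (s 10) (s 11) (s 12) (s 13) (s 14) (s 33 0) (s 34 0) (s 35 0) (s 36 0) (s 37 0) (s 38 0)" and st: "static s"
        using I by (auto simp: bfs_inv_def)
      have w: "worklist (s 10) (s 11) (s 33 0) (s 34 0) (s 35 0) (s 36 0) (s 37 0)"
        using se by (simp add: searching_def)
      have "s 0 0 = n" "s 35 0 \<le> n" using st w by (auto simp: static_def input_ok_def worklist_def)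
      then have r: "s 35 0 = n" "\<not> s 36 0 < s 37 0" "\<not> s 33 0 < s 34 0"
        using stop by (auto simp: bfs_guard_def)
      have L: "layout (s 11) (s 12) (s 13) ((s 14)(s 38 0 := s 34 0)) (s 38 0)"
        by (rule search_end(1)[OF se[unfolded r(1)] r(2,3)])
      then have "s 38 0 \<le> n" unfolding layout_def by blast
      then show ?thesis
        using L st worklist_le_n[OF w] by blast
    qed
  qed (rule vc_bfs_body worklist_measure_le; assumption?)+
  moreover have "wp W (Assign 14 (reg 38) (reg 34)) s 0
      (\<lambda>s. static s \<and> layout (s 11) (s 12) (s 13) (s 14) (s 38 0))"
    if "static s \<and> layout (s 11) (s 12) (s 13) ((s 14)(s 38 0 := s 34 0)) (s 38 0) \<and> s 34 0 \<le> n \<and> s 38 0 \<le> n" for s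
    using that W_lin by (intro wp_vc) simp
  ultimately have "wp W bfs s (2 * n + M + 0) (\<lambda>s. static s \<and> layout (s 11) (s 12) (s 13) (s 14) (s 38 0))"
    unfolding bfs_def by (rule wp_Seq)
  then show ?thesis by simp
qed

end

section \<open>The best shift of each component\<close>

text \<open>For increasing \<open>x\<close> the sweep maintains the sum of the distances of all values to \<open>x\<close>, which
  increases by the number of values up to \<open>x\<close> minus the number of values above \<open>x\<close>.
  Only multiples of 3 are candidates, and only if all frozen vertices have the value \<open>x\<close>.
  The histograms are cleared on the fly.\<close>

definition fill_body :: com where
  "fill_body =
     Seq (Assign 15 (Cell 12 (Cell 11 (reg 41)))
            (Plus (Cell 15 (Cell 12 (Cell 11 (reg 41)))) (Const 1)))
     (Seq (Assign 16 (Cell 12 (Cell 11 (reg 41)))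
            (Plus (Cell 16 (Cell 12 (Cell 11 (reg 41)))) (Minus (Const 1) (Cell 8 (Cell 11 (reg 41))))))
     (Seq (set_reg 46 (Plus (reg 46) (Minus (Const 1) (Cell 8 (Cell 11 (reg 41))))))
     (Seq (set_reg 45 (Plus (reg 45) (Minus (Cell 12 (Cell 11 (reg 41))) (reg 42))))
          (incr 41))))"

definition fill :: com where
  "fill = While (Minus (Cell 14 (Plus (reg 40) (Const 1))) (reg 41)) fill_body"

text \<open>Truncated subtraction serves as comparison: the first test is zero iff every frozen
  vertex of the component has the current value.\<close>

definition improve :: com where
  "improve = If (Minus (reg 46) (Cell 16 (reg 42))) Skip
     (If (Minus (reg 47) (reg 45)) (set_reg 47 (reg 45)) Skip)"

text \<open>With \<open>r\<close> values up to the current one in a component of size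
  \<open>s\<close>, the increase of the cost is \<open>r - (s - r)\<close>; it is computed as
  \<open>+ r + r - s\<close>, additions first, to avoid truncation.\<close>

definition advance :: com where
  "advance =
     Seq (set_reg 44 (Plus (reg 44) (Cell 15 (reg 42))))
     (Seq (Assign 15 (reg 42) (Const 0))
     (Seq (Assign 16 (reg 42) (Const 0))
     (Seq (set_reg 45 (Minus (Plus (Plus (reg 45) (reg 44)) (reg 44)) (reg 49)))
          (incr 42))))"

definition sweep :: com where
  "sweep = While (Minus (reg 43) (reg 42)) (Seq improve (Seq advance (Seq advance advance)))"

text \<open>Registers: 40 component, 41 queue position, 42 and 43 current value and end of the
  sweep, 44 number of values below, 45 cost, 46 number of frozen vertices, 47 best cost, 48 total,
  49 size of the component. The best cost starts at \<open>l + 1\<close>, which acts as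
  infinity.\<close>

definition start_component :: com where
  "start_component =
     Seq (set_reg 41 (Cell 14 (reg 40)))
     (Seq (set_reg 49 (Minus (Cell 14 (Plus (reg 40) (Const 1))) (Cell 14 (reg 40))))
     (Seq (set_reg 42 (Minus base_expr (triple (reg 49))))
     (Seq (set_reg 43 (Plus (Plus base_expr (triple (reg 49))) (Const 3)))
     (Seq (set_reg 44 (Const 0))
     (Seq (set_reg 45 (Const 0))
     (Seq (set_reg 46 (Const 0))
          (set_reg 47 (Plus (Cell 0 (Const 2)) (Const 1)))))))))"

definition end_component :: com where
  "end_component = Seq (set_reg 48 (Plus (reg 48) (reg 47))) (incr 40)"

definition components :: com where
  "components = While (Minus (reg 38) (reg 40))
     (Seq start_component (Seq fill (Seq sweep end_component)))"

text \<open>Sums the excess over 1 in both directions. It tests the candidate rather than the final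
  shift, which suffices because the two differ by a constant on each component.\<close>

definition check_arcs :: com where
  "check_arcs = While (Minus (Cell 1 (reg 0)) (reg 50))
     (Seq (set_reg 51 (Plus (reg 51)
        (Plus (Minus (Cell 12 (Cell 2 (reg 50))) (Plus (Cell 12 (Cell 6 (reg 50))) (Const 1)))
              (Minus (Cell 12 (Cell 6 (reg 50))) (Plus (Cell 12 (Cell 2 (reg 50))) (Const 1))))))
     (incr 50))"

definition decide :: com where
  "decide = Assign 0 (Const 0) (Minus (Const 1) (Plus (Minus (reg 48) (Cell 0 (Const 2))) (reg 51)))"

lemma vc_Seq_set_reg:
  assumes "fits W s e" "eval_expr s e = v" "vc W d Q (s(x := (s x)(0 := v)))"
  shows "vc W (Seq (set_reg x e) d) Q s"
  using assms by simp

text \<open>Moving the reference point up by one adds 1 for each value up to \<open>x\<close> and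
  removes 1 for each value above. Adding \<open>card P\<close> on the left keeps the equation within
  the naturals.\<close>

lemma sum_abs_diff_Suc:
  assumes "finite P"
  shows "(\<Sum>p\<in>P. nat \<bar>int (e p) - int (Suc x)\<bar>) + card P =
    (\<Sum>p\<in>P. nat \<bar>int (e p) - int x\<bar>) + 2 * card {p \<in> P. e p \<le> x}"
proof -
  have "(\<Sum>p\<in>P. nat \<bar>int (e p) - int (Suc x)\<bar>) + card P =
      (\<Sum>p\<in>P. nat \<bar>int (e p) - int (Suc x)\<bar> + 1)"
    by (subst sum.distrib) simp
  also have "\<dots> = (\<Sum>p\<in>P. nat \<bar>int (e p) - int x\<bar> + (if e p \<le> x then 2 else 0))"
    by (intro sum.cong) auto
  also have "\<dots> = (\<Sum>p\<in>P. nat \<bar>int (e p) - int x\<bar>) + 2 * card {p \<in> P. e p \<le> x}"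
    using assms by (simp add: sum.distrib sum.If_cases Int_def mult.commute)
  finally show ?thesis .
qed

text \<open>The source of the factor 4 in \<open>W_quad\<close>: one product of linear quantities
  plus three linear terms as headroom.\<close>

lemma (in ram_instance) W_prod:
  assumes "x \<le> 10 * n + 10 * M + 10 * l + 100" "y \<le> 10 * n + 10 * M + 10 * l + 100"
  shows "x * y + 3 * (10 * n + 10 * M + 10 * l + 100) \<le> W"
proof -
  let ?X = "10 * n + 10 * M + 10 * l + 100"
  have "x * y \<le> ?X * ?X" by (rule mult_mono) (use assms in auto)
  moreover have "?X * 1 \<le> ?X * ?X" by (rule mult_left_mono) auto
  ultimately show ?thesis using W_quad by linarith
qed

text \<open>Fixes the results of peeling and search as plain functions. \<open>frz\<close> is array
  8, which marks the peeled vertices, so the value 0 means frozen.\<close>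

locale laid_out = ram_instance +
  fixes frz Q E cmp st :: "nat \<Rightarrow> nat" and k :: nat
  assumes lay: "layout Q E cmp st k" and frz_le: "v < n \<Longrightarrow> frz v \<le> 1"
begin

section \<open>Reduction to the choice of one integer per component\<close>

lemma layout_facts:
  shows Q_bij: "bij_betw Q {..<n} {..<n}" and k_le: "k \<le> n" and st_0: "st 0 = 0" and st_k: "st k = n"
    and st_Suc: "c < k \<Longrightarrow> st c \<le> st (Suc c)"
    and cmp_less: "p < n \<Longrightarrow> cmp (Q p) < k"
    and cmp_iff: "p < n \<Longrightarrow> c < k \<Longrightarrow> cmp (Q p) = c \<longleftrightarrow> st c \<le> p \<and> p < st (Suc c)"
    and E_upper: "p < n \<Longrightarrow> E (Q p) \<le> base + 1 + (st (Suc (cmp (Q p))) - st (cmp (Q p)))"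
    and E_lower: "p < n \<Longrightarrow> base + 1 \<le> E (Q p) + (st (Suc (cmp (Q p))) - st (cmp (Q p)))"
    and E_mod3: "p < n \<Longrightarrow> 3 dvd int (a (Q p)) - int (E (Q p)) - int (b (Q p))"
    and cmp_arc: "j < M \<Longrightarrow> cmp (src j) = cmp (dst j)"
    and E_pot: "potential F \<Longrightarrow> u < n \<Longrightarrow> v < n \<Longrightarrow> cmp u = cmp v \<Longrightarrow> F u - int (E u) = F v - int (E v)"
  using lay unfolding layout_def by blast+

lemma st_mono: "c \<le> d \<Longrightarrow> d \<le> k \<Longrightarrow> st c \<le> st d"
proof (induction rule: dec_induct)
  case (step d)
  then show ?case using st_Suc[of d] by simp
qed simp

lemma st_le_n: "c \<le> k \<Longrightarrow> st c \<le> n"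
  using st_mono[of c k] st_k by simp

lemma Q_less: "p < n \<Longrightarrow> Q p < n"
  using Q_bij by (auto simp: bij_betw_def)

abbreviation seg :: "nat \<Rightarrow> nat set" where "seg c \<equiv> {st c..<st (Suc c)}"
abbreviation len :: "nat \<Rightarrow> nat" where "len c \<equiv> st (Suc c) - st c"

lemma seg_less: "c < k \<Longrightarrow> p \<in> seg c \<Longrightarrow> p < n"
  using st_le_n[of "Suc c"] by simp

lemma seg_E:
  assumes "c < k" "p \<in> seg c"
  shows "E (Q p) \<le> base + 1 + len c" "base + 1 \<le> E (Q p) + len c" "0 < len c"
  using seg_less[OF assms] E_upper[of p] E_lower[of p] cmp_iff[of p c] assms by auto

lemma len_le: "c < k \<Longrightarrow> len c \<le> n"
  using st_le_n[of "Suc c"] by simp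

definition cost :: "nat \<Rightarrow> int \<Rightarrow> nat" where
  "cost c x = (\<Sum>p\<in>seg c. nat \<bar>int (E (Q p)) - x\<bar>)"

definition admissible :: "nat \<Rightarrow> int \<Rightarrow> bool" where
  "admissible c x \<longleftrightarrow> 3 dvd x \<and> (\<forall>p\<in>seg c. frz (Q p) = 0 \<longrightarrow> int (E (Q p)) = x)"

text \<open>The minimum of \<open>cost\<close> over the admissible values, cut off at
  \<open>l + 1\<close>.\<close>

definition optimum :: "nat \<Rightarrow> nat \<Rightarrow> bool" where
  "optimum c m \<longleftrightarrow> m \<le> l + 1 \<and> (m \<le> l \<longrightarrow> (\<exists>x. admissible c x \<and> cost c x = m)) \<and>
     (\<forall>x. admissible c x \<longrightarrow> m \<le> cost c x)"

lemma cost_bound: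
  assumes "c < k" "x \<le> base + 3 * len c + 3" "base \<le> x + 3 * len c"
  shows "cost c (int x) \<le> n * (7 * n + 3)"
proof -
  have "cost c (int x) \<le> (\<Sum>p\<in>seg c. 7 * n + 3)"
    unfolding cost_def
  proof (rule sum_mono)
    fix p assume p: "p \<in> seg c"
    have "len c \<le> n" using len_le assms by simp
    then show "nat \<bar>int (E (Q p)) - int x\<bar> \<le> 7 * n + 3"
      using seg_E[OF assms(1) p] assms by simp
  qed
  also have "\<dots> \<le> n * (7 * n + 3)"
    using len_le[OF assms(1)] by simp
  finally show ?thesis .
qed

text \<open>All values of the component lie between \<open>?lo\<close> and \<open>?hi\<close>. An
  admissible \<open>x\<close> outside this range shows that nothing is frozen, and moving it to the
  nearer end does not increase the cost. The half-width is \<open>3 * len c\<close> so that both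
  ends are multiples of 3.\<close>

lemma optimum_from_range:
  assumes c: "c < k" and "m \<le> l + 1" "m \<le> l \<longrightarrow> (\<exists>x. admissible c x \<and> cost c x = m)"
    and range: "\<And>x. base \<le> x + 3 * len c \<Longrightarrow> x \<le> base + 3 * len c \<Longrightarrow> admissible c (int x) \<Longrightarrow> m \<le> cost c (int x)"
  shows "optimum c m"
  unfolding optimum_def
proof (intro conjI allI impI)
  fix x assume adm: "admissible c x"
  let ?lo = "base - 3 * len c" and ?hi = "base + 3 * len c"
  have lo: "3 * len c \<le> base" using len_le[OF c] by simp
  have lo_hi: "?lo \<le> E (Q p) \<and> E (Q p) \<le> ?hi" if "p \<in> seg c" for p
    using seg_E[OF c that] by arith
  have dvd: "3 dvd int ?lo" "3 dvd int ?hi"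
    using lo by (auto simp: of_nat_diff)
  consider "x < int ?lo" | "int ?hi < x" | "int ?lo \<le> x" "x \<le> int ?hi" by linarith
  then show "m \<le> cost c x"
  proof cases
    case 1
    have "admissible c (int ?lo)"
      using adm 1 lo_hi dvd(1) unfolding admissible_def by fastforce
    then have "m \<le> cost c (int ?lo)" using range[of ?lo] lo by simp
    also have "\<dots> \<le> cost c x"
      unfolding cost_def using 1 lo_hi by (intro sum_mono) fastforce
    finally show ?thesis .
  next
    case 2
    have "admissible c (int ?hi)"
      using adm 2 lo_hi dvd(2) unfolding admissible_def by fastforce
    then have "m \<le> cost c (int ?hi)" using range[of ?hi] by simp
    also have "\<dots> \<le> cost c x"
      unfolding cost_def using 2 lo_hi by (intro sum_mono) fastforce
    finally show ?thesis .
  next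
    case 3
    then have "x = int (nat x)" by simp
    then show ?thesis using range[of "nat x"] 3 adm lo by (metis (no_types, lifting) of_nat_le_iff of_nat_add of_nat_diff le_diff_conv)
  qed
qed (use assms in auto)

section \<open>Histograms and sweep of one component\<close>

definition frame :: "memory \<Rightarrow> bool" where
  "frame s \<longleftrightarrow> static s \<and> s 8 = frz \<and> s 11 = Q \<and> s 12 = E \<and> s 14 = st \<and> s 38 0 = k"

lemma frame_upd [simp]: "x \<ge> 15 \<Longrightarrow> x \<noteq> 38 \<Longrightarrow> frame (s(x := f)) = frame s"
  by (simp add: frame_def)

lemma frameD:
  assumes "frame s"
  shows "s 0 0 = n" "s 0 2 = l" "s (Suc 0) = A1" "s 2 = dst" "s 8 = frz" "s 11 = Q" "s 12 = E" "s 14 = st"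
    "s 38 0 = k" "static s"
  using assms by (auto simp: frame_def static_def input_ok_def)

definition tally :: "nat \<Rightarrow> nat \<Rightarrow> (nat \<Rightarrow> bool) \<Rightarrow> nat" where
  "tally lo p P = card {q \<in> {lo..<p}. P q}"

lemma tally_Suc:
  assumes "lo \<le> p"
  shows "tally lo (Suc p) P = tally lo p P + (if P p then 1 else 0)"
proof -
  have "{q \<in> {lo..<Suc p}. P q} = (if P p then insert p else id) {q \<in> {lo..<p}. P q}"
    using assms by (auto simp: less_Suc_eq)
  then show ?thesis by (simp add: tally_def)
qed

lemma tally_empty: "tally lo lo P = 0"
  by (simp add: tally_def)

lemma tally_le: "tally lo p P \<le> p - lo"
proof -
  have "card {q \<in> {lo..<p}. P q} \<le> card {lo..<p}"
    by (rule card_mono) auto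
  then show ?thesis by (simp add: tally_def)
qed

abbreviation segtally :: "nat \<Rightarrow> (nat \<Rightarrow> bool) \<Rightarrow> nat" where
  "segtally c \<equiv> tally (st c) (st (Suc c))"

definition filling :: "nat \<Rightarrow> nat \<Rightarrow> memory \<Rightarrow> bool" where
  "filling c p s \<longleftrightarrow> frame s \<and> s 40 0 = c \<and> s 41 0 = p \<and> s 49 0 = len c \<and>
     s 42 0 = base - 3 * len c \<and> s 43 0 = base + 3 * len c + 3 \<and> s 44 0 = 0 \<and> s 47 0 = l + 1 \<and>
     (\<forall>y. s 15 y = tally (st c) p (\<lambda>q. E (Q q) = y)) \<and>
     (\<forall>y. s 16 y = tally (st c) p (\<lambda>q. E (Q q) = y \<and> frz (Q q) = 0)) \<and>
     s 46 0 = tally (st c) p (\<lambda>q. frz (Q q) = 0) \<and>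
     s 45 0 = (\<Sum>q\<in>{st c..<p}. E (Q q) - (base - 3 * len c))"

lemma vc_fill_body:
  assumes "filling c p s" "c < k" "st c \<le> p" "p < st (Suc c)"
  shows "vc W fill_body (filling c (Suc p)) s"
proof -
  have p: "p \<in> seg c" using assms by simp
  have pn: "p < n" using seg_less[OF assms(2) p] .
  note fr = frameD[of s]
  have frm: "frame s" and I: "s 40 0 = c" "s 41 0 = p" "s 49 0 = len c"
     "s 42 0 = base - 3 * len c" "s 43 0 = base + 3 * len c + 3" "s 44 0 = 0" "s 47 0 = l + 1"
     "\<And>y. s 15 y = tally (st c) p (\<lambda>q. E (Q q) = y)"
     "\<And>y. s 16 y = tally (st c) p (\<lambda>q. E (Q q) = y \<and> frz (Q q) = 0)"
     "s 46 0 = tally (st c) p (\<lambda>q. frz (Q q) = 0)"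
     "s 45 0 = (\<Sum>q\<in>{st c..<p}. E (Q q) - (base - 3 * len c))"
    using assms(1) by (auto simp: filling_def)
  have cards: "s 15 (E (Q p)) \<le> n" "s 16 (E (Q p)) \<le> n" "s 46 0 \<le> n"
  proof -
    have le: "tally (st c) p P \<le> n" for P
      using tally_le[of "st c" p P] pn by simp
    show "s 15 (E (Q p)) \<le> n" unfolding I(8) by (rule le)
    show "s 16 (E (Q p)) \<le> n" unfolding I(9) by (rule le)
    show "s 46 0 \<le> n" unfolding I(10) by (rule le)
  qed
  have "len c \<le> n" using len_le assms(2) by simp
  then have Ep: "E (Q p) \<le> 4 * n + 10" "Q p < n" "frz (Q p) \<le> 1"
    using seg_E[OF assms(2) p] frz_le[OF Q_less[OF pn]] Q_less[OF pn] by auto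
  have cur: "s 45 0 \<le> n * (7 * n + 3)"
  proof -
    have "s 45 0 \<le> (\<Sum>q\<in>{st c..<p}. 7 * n + 3)"
      unfolding I(11)
    proof (rule sum_mono)
      fix q assume "q \<in> {st c..<p}"
      then have "q \<in> seg c" using assms(4) by simp
      then show "E (Q q) - (base - 3 * len c) \<le> 7 * n + 3"
        using seg_E[OF assms(2)] \<open>len c \<le> n\<close> by fastforce
    qed
    also have "\<dots> \<le> n * (7 * n + 3)" using pn by simp
    finally show ?thesis .
  qed
  have quad: "n * (7 * n + 3) + 3 * (10 * n + 10 * M + 10 * l + 100) \<le> W"
    by (rule W_prod) auto
  note simps = fr[OF frm] I(1-7)
  have x0: "base - 3 * len c \<le> 3 * n + 6" "E (Q p) - (base - 3 * len c) \<le> 4 * n + 10"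
    using Ep(1) by linarith+
  have "frz (Q p) = 0 \<or> frz (Q p) = 1" using Ep(3) by linarith
  then show ?thesis
    using frm cards Ep(1,2) cur quad pn W_lin assms(3) x0
    by (elim disjE) (simp_all add: fill_body_def filling_def simps I(8-11) tally_Suc)
qed

lemma wp_fill:
  assumes "filling c (st c) s" "c < k"
  shows "wp W fill s (len c) (filling c (st (Suc c)))"
  unfolding fill_def
proof (rule wp_While_vc[where I = "\<lambda>s. filling c (s 41 0) s \<and> st c \<le> s 41 0 \<and> s 41 0 \<le> st (Suc c)" and
      f = "\<lambda>s. st (Suc c) - s 41 0"])
  have start: "s 41 0 = st c" using assms(1) by (simp add: filling_def)
  then show "filling c (s 41 0) s \<and> st c \<le> s 41 0 \<and> s 41 0 \<le> st (Suc c)" "st (Suc c) - s 41 0 \<le> len c"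
    using assms st_Suc by auto
next
  fix s :: memory
  assume I: "filling c (s 41 0) s \<and> st c \<le> s 41 0 \<and> s 41 0 \<le> st (Suc c)"
  then have fr: "frame s" "s 40 0 = c" by (auto simp: filling_def)
  then show "fits W s (Minus (Cell 14 (Plus (reg 40) (Const 1))) (reg 41))"
    using I assms(2) st_le_n[of "Suc c"] k_le W_lin by (simp add: frameD)
  assume run: "eval_expr s (Minus (Cell 14 (Plus (reg 40) (Const 1))) (reg 41)) \<noteq> 0"
  then have "s 41 0 < st (Suc c)" using fr by (simp add: frameD)
  then have "vc W fill_body (filling c (Suc (s 41 0))) s"
    using vc_fill_body I assms(2) by blast
  then show "vc W fill_body (\<lambda>s'. (filling c (s' 41 0) s' \<and> st c \<le> s' 41 0 \<and> s' 41 0 \<le> st (Suc c)) \<and>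
      st (Suc c) - s' 41 0 < st (Suc c) - s 41 0) s"
  proof (rule vc_mono)
    fix s' assume f: "filling c (Suc (s 41 0)) s'"
    then have "s' 41 0 = Suc (s 41 0)" by (simp add: filling_def)
    then show "(filling c (s' 41 0) s' \<and> st c \<le> s' 41 0 \<and> s' 41 0 \<le> st (Suc c)) \<and>
      st (Suc c) - s' 41 0 < st (Suc c) - s 41 0"
      using f I \<open>s 41 0 < st (Suc c)\<close> by simp
  qed
next
  fix s :: memory
  assume I: "filling c (s 41 0) s \<and> st c \<le> s 41 0 \<and> s 41 0 \<le> st (Suc c)"
    and stop: "eval_expr s (Minus (Cell 14 (Plus (reg 40) (Const 1))) (reg 41)) = 0"
  then have fr: "frame s" "s 40 0 = c" by (auto simp: filling_def)
  then have "s 41 0 = st (Suc c)" using I stop by (simp add: frameD)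
  then show "filling c (st (Suc c)) s" using I by simp
qed

text \<open>Cells below \<open>x\<close> are already cleared, so the histograms are zero again for
  the next component at no extra cost.\<close>

definition sweeping :: "nat \<Rightarrow> nat \<Rightarrow> memory \<Rightarrow> bool" where
  "sweeping c x s \<longleftrightarrow> frame s \<and> s 40 0 = c \<and> s 49 0 = len c \<and>
     s 42 0 = x \<and> base \<le> x + 3 * len c \<and> s 43 0 = base + 3 * len c + 3 \<and>
     s 44 0 = segtally c (\<lambda>q. E (Q q) < x) \<and>
     (\<forall>y. s 15 y = (if y < x then 0 else segtally c (\<lambda>q. E (Q q) = y))) \<and>
     (\<forall>y. s 16 y = (if y < x then 0 else segtally c (\<lambda>q. E (Q q) = y \<and> frz (Q q) = 0))) \<and>
     s 46 0 = segtally c (\<lambda>q. frz (Q q) = 0) \<and> s 45 0 = cost c (int x)"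

definition best_below :: "nat \<Rightarrow> nat \<Rightarrow> nat \<Rightarrow> bool" where
  "best_below c x m \<longleftrightarrow> m \<le> l + 1 \<and> (m \<le> l \<longrightarrow> (\<exists>y. admissible c y \<and> cost c y = m)) \<and>
     (\<forall>y<x. base \<le> y + 3 * len c \<longrightarrow> admissible c (int y) \<longrightarrow> m \<le> cost c (int y))"

lemma sweeping_start:
  assumes "filling c (st (Suc c)) s" "c < k"
  shows "sweeping c (base - 3 * len c) s" "best_below c (base - 3 * len c) (s 47 0)"
proof -
  let ?x = "base - 3 * len c"
  have I: "frame s" "s 40 0 = c" "s 49 0 = len c"
     "s 42 0 = ?x" "s 43 0 = base + 3 * len c + 3" "s 44 0 = 0" "s 47 0 = l + 1"
     "\<And>y. s 15 y = segtally c (\<lambda>q. E (Q q) = y)"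
     "\<And>y. s 16 y = segtally c (\<lambda>q. E (Q q) = y \<and> frz (Q q) = 0)"
     "s 46 0 = segtally c (\<lambda>q. frz (Q q) = 0)"
     "s 45 0 = (\<Sum>q\<in>seg c. E (Q q) - ?x)"
    using assms(1) by (auto simp: filling_def)
  have lo: "?x \<le> E (Q q)" if "q \<in> seg c" for q
    using seg_E[OF assms(2) that] by arith
  then have e: "segtally c (\<lambda>q. E (Q q) < ?x) = 0" "y < ?x \<Longrightarrow> segtally c (\<lambda>q. E (Q q) = y) = 0"
    "y < ?x \<Longrightarrow> segtally c (\<lambda>q. E (Q q) = y \<and> frz (Q q) = 0) = 0" for y
    unfolding tally_def by (fastforce intro!: card_eq_0_iff[THEN iffD2])+
  \<comment> \<open>The sweep starts at or below all values, so the truncated differences added up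
    while filling are the absolute ones.\<close>
  have "cost c (int ?x) = (\<Sum>q\<in>seg c. E (Q q) - ?x)"
    unfolding cost_def using lo by (intro sum.cong refl) (fastforce simp: nat_diff_distrib)
  then show "sweeping c ?x s"
    unfolding sweeping_def
  proof (intro conjI allI)
    show "s 44 0 = segtally c (\<lambda>q. E (Q q) < ?x)" unfolding e I by simp
    show "s 15 y = (if y < ?x then 0 else segtally c (\<lambda>q. E (Q q) = y))" for y
      using e(2)[of y] unfolding I by auto
    show "s 16 y = (if y < ?x then 0 else segtally c (\<lambda>q. E (Q q) = y \<and> frz (Q q) = 0))" for y
      using e(3)[of y] unfolding I by auto
    have "u \<le> u - v + v" for u v :: nat by simp
    then show "base \<le> ?x + 3 * len c" .
  qed (use I in auto)
  show "best_below c ?x (s 47 0)"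
    unfolding best_below_def I(7)
  proof (intro conjI allI impI)
    fix y assume "y < ?x" "base \<le> y + 3 * len c"
    then show "l + 1 \<le> cost c (int y)" by (metis leD less_diff_conv)
  qed simp_all
qed

lemma vc_advance:
  assumes "sweeping c x s" "c < k" "x < base + 3 * len c + 3"
  shows "vc W advance (\<lambda>s'. sweeping c (Suc x) s' \<and> s' 47 0 = s 47 0) s"
proof -
  have frm: "frame s" and I: "s 40 0 = c" "s 49 0 = len c" "s 42 0 = x" "s 43 0 = base + 3 * len c + 3"
     "s 44 0 = segtally c (\<lambda>q. E (Q q) < x)"
     "s 46 0 = segtally c (\<lambda>q. frz (Q q) = 0)" "s 45 0 = cost c (int x)" and x0: "base \<le> x + 3 * len c"
    and H: "\<And>y. s 15 y = (if y < x then 0 else segtally c (\<lambda>q. E (Q q) = y))"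
     "\<And>y. s 16 y = (if y < x then 0 else segtally c (\<lambda>q. E (Q q) = y \<and> frz (Q q) = 0))"
    using assms(1) by (auto simp: sweeping_def)
  have "{q \<in> seg c. E (Q q) < Suc x} = {q \<in> seg c. E (Q q) < x} \<union> {q \<in> seg c. E (Q q) = x}"
    by auto
  then have le: "segtally c (\<lambda>q. E (Q q) < x) + segtally c (\<lambda>q. E (Q q) = x) = segtally c (\<lambda>q. E (Q q) < Suc x)"
    unfolding tally_def by (subst card_Un_disjoint[symmetric]) auto
  have "cost c (int (Suc x)) + len c = cost c (int x) + 2 * segtally c (\<lambda>q. E (Q q) \<le> x)"
    unfolding cost_def tally_def using sum_abs_diff_Suc[of "seg c" "\<lambda>q. E (Q q)" x] by simp
  then have S: "cost c (int x) + segtally c (\<lambda>q. E (Q q) < Suc x) + segtally c (\<lambda>q. E (Q q) < Suc x) - len c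
      = cost c (int (Suc x))"
    by (simp add: less_Suc_eq_le)
  have cn: "segtally c P \<le> n" for P
    using tally_le[of "st c" "st (Suc c)" P] len_le[OF assms(2)] by simp
  have cb: "cost c (int x) \<le> n * (7 * n + 3)"
    using cost_bound[OF assms(2) _ x0] assms(3) by simp
  have quad: "n * (7 * n + 3) + 3 * (10 * n + 10 * M + 10 * l + 100) \<le> W"
    by (rule W_prod) auto
  have ln: "len c \<le> n" by (rule len_le[OF assms(2)])
  show ?thesis
    using frm cn[of "\<lambda>q. E (Q q) < x"] cn[of "\<lambda>q. E (Q q) = x"] cn[of "\<lambda>q. E (Q q) < Suc x"]
      cn[of "\<lambda>q. E (Q q) = x \<and> frz (Q q) = 0"] cb quad x0 W_lin ln assms(3)
    by (auto simp: advance_def sweeping_def I H le S)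
qed

lemma admissible_iff:
  assumes "3 dvd x"
  shows "admissible c (int x) \<longleftrightarrow>
    segtally c (\<lambda>q. frz (Q q) = 0) \<le> segtally c (\<lambda>q. E (Q q) = x \<and> frz (Q q) = 0)"
proof
  assume "admissible c (int x)"
  then have "{q \<in> seg c. frz (Q q) = 0} = {q \<in> seg c. E (Q q) = x \<and> frz (Q q) = 0}"
    unfolding admissible_def by fastforce
  then show "segtally c (\<lambda>q. frz (Q q) = 0) \<le> segtally c (\<lambda>q. E (Q q) = x \<and> frz (Q q) = 0)"
    by (simp add: tally_def)
next
  assume le: "segtally c (\<lambda>q. frz (Q q) = 0) \<le> segtally c (\<lambda>q. E (Q q) = x \<and> frz (Q q) = 0)"
  have "{q \<in> seg c. E (Q q) = x \<and> frz (Q q) = 0} = {q \<in> seg c. frz (Q q) = 0}"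
    by (rule card_seteq[OF _ _ le[unfolded tally_def]]) auto
  then have "E (Q q) = x" if "q \<in> seg c" "frz (Q q) = 0" for q
    using that by blast
  moreover have "int 3 dvd int x" using assms by (simp only: int_dvd_int_iff)
  ultimately show "admissible c (int x)"
    by (simp add: admissible_def)
qed

lemma vc_improve:
  assumes "sweeping c x s" "best_below c x (s 47 0)" "3 dvd x" "c < k" "x < base + 3 * len c + 3"
  shows "vc W improve (\<lambda>s'. sweeping c x s' \<and> best_below c (Suc x) (s' 47 0)) s"
proof -
  have frm: "frame s" and I: "s 40 0 = c" "s 42 0 = x" 
     "s 16 x = segtally c (\<lambda>q. E (Q q) = x \<and> frz (Q q) = 0)"
     "s 46 0 = segtally c (\<lambda>q. frz (Q q) = 0)" "s 45 0 = cost c (int x)" and x0: "base \<le> x + 3 * len c"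
    using assms(1) by (auto simp: sweeping_def)
  have cn: "segtally c P \<le> n" for P
    using tally_le[of "st c" "st (Suc c)" P] len_le[OF assms(4)] by simp
  have cb: "cost c (int x) \<le> n * (7 * n + 3)"
    using cost_bound[OF assms(4) _ x0] assms(5) by simp
  have quad: "n * (7 * n + 3) + 3 * (10 * n + 10 * M + 10 * l + 100) \<le> W"
    by (rule W_prod) auto
  have ln: "len c \<le> n" by (rule len_le[OF assms(4)])
  have b: "s 47 0 \<le> l + 1" using assms(2) by (simp add: best_below_def)
  have skip: "best_below c (Suc x) (s 47 0)" if "\<not> admissible c (int x) \<or> s 47 0 \<le> cost c (int x)"
    using assms(2) that by (auto simp: best_below_def less_Suc_eq)
  have upd: "best_below c (Suc x) (cost c (int x))" if "admissible c (int x)" "cost c (int x) < s 47 0"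
    unfolding best_below_def
  proof (intro conjI allI impI)
    show "cost c (int x) \<le> l + 1" using b that(2) by simp
    show "\<exists>y. admissible c y \<and> cost c y = cost c (int x)" using that(1) by blast
    fix y assume "y < Suc x" "base \<le> y + 3 * len c" "admissible c (int y)"
    then show "cost c (int x) \<le> cost c (int y)"
    proof (cases "y = x")
      case False
      then have "s 47 0 \<le> cost c (int y)"
        using assms(2) \<open>y < Suc x\<close> \<open>base \<le> y + 3 * len c\<close> \<open>admissible c (int y)\<close>
        unfolding best_below_def by (metis less_antisym)
      then show ?thesis using that(2) by simp
    qed simp
  qed
  have sw: "sweeping c x (s(47 := f))" for f
    using assms(1) by (simp add: sweeping_def)
  note ad = admissible_iff[OF assms(3), of c]
  show ?thesis
  proof (cases "admissible c (int x)")
    case False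
    then show ?thesis
      using assms(1) skip ad cn[of "\<lambda>q. frz (Q q) = 0"] cn[of "\<lambda>q. E (Q q) = x \<and> frz (Q q) = 0"]
        W_lin x0 assms(5) ln
      by (simp add: improve_def I)
  next
    case True
    show ?thesis
    proof (cases "cost c (int x) < s 47 0")
      case le: True
      show ?thesis
        using True assms(1) upd[OF True le] ad cn[of "\<lambda>q. frz (Q q) = 0"]
          cn[of "\<lambda>q. E (Q q) = x \<and> frz (Q q) = 0"] W_lin x0 assms(5) ln b cb quad le sw
        by (simp add: improve_def I)
    next
      case ge: False
      then show ?thesis
        using True assms(1) skip ad cn[of "\<lambda>q. frz (Q q) = 0"]
          cn[of "\<lambda>q. E (Q q) = x \<and> frz (Q q) = 0"] W_lin x0 assms(5) ln b cb quad
        by (simp add: improve_def I)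
    qed
  qed
qed

lemma best_below_skip:
  assumes "best_below c (Suc x) m" "3 dvd x"
  shows "best_below c (Suc (Suc (Suc x))) m"
proof -
  have "\<not> 3 dvd Suc x" "\<not> 3 dvd Suc (Suc x)" using assms(2) by presburger+
  then have "\<not> admissible c (int (Suc x))" "\<not> admissible c (int (Suc (Suc x)))"
    unfolding admissible_def by (metis int_dvd_int_iff of_nat_numeral)+
  moreover have "y < Suc (Suc (Suc x)) \<Longrightarrow> y < Suc x \<or> y = Suc x \<or> y = Suc (Suc x)" for y
    by linarith
  ultimately show ?thesis
    using assms(1) unfolding best_below_def by blast
qed

lemma dvd3_less: "3 dvd x \<Longrightarrow> 3 dvd y \<Longrightarrow> x < y \<Longrightarrow> x + 3 \<le> (y :: nat)"
proof -
  assume "3 dvd x" "3 dvd y" "x < y"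
  then have "3 dvd y - x" by (intro dvd_diff_nat)
  then have "3 \<le> y - x" by (rule dvd_imp_le) (use \<open>x < y\<close> in simp)
  then show ?thesis by simp
qed

lemma dvd3_Suc: "3 dvd x \<Longrightarrow> 3 dvd Suc (Suc (Suc x))"
proof -
  assume "3 dvd x"
  then have "3 dvd x + 3" by simp
  moreover have "x + 3 = Suc (Suc (Suc x))" by simp
  ultimately show ?thesis by metis
qed

lemma vc_sweep_body:
  assumes "sweeping c x s" "best_below c x (s 47 0)" "3 dvd x" "c < k" "x < base + 3 * len c + 3"
  shows "vc W (Seq improve (Seq advance (Seq advance advance)))
    (\<lambda>s'. sweeping c (Suc (Suc (Suc x))) s' \<and> best_below c (Suc (Suc (Suc x))) (s' 47 0)) s"
proof -
  have "base \<le> x + 3 * len c" using assms(1) by (simp add: sweeping_def)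
  \<comment> \<open>The current value and the end of the sweep are multiples of 3, so all three
    advances stay inside the range where \<open>vc_advance\<close> applies.\<close>
  have "3 dvd base + 3 * len c + 3" by simp
  then have x: "x + 3 \<le> base + 3 * len c + 3"
    using dvd3_less assms(3,5) by blast
  show ?thesis
    unfolding vc.simps
  proof (rule vc_mono[OF vc_improve[OF assms]])
    fix s1 assume 1: "sweeping c x s1 \<and> best_below c (Suc x) (s1 47 0)"
    show "vc W advance (vc W advance (vc W advance
        (\<lambda>s'. sweeping c (Suc (Suc (Suc x))) s' \<and> best_below c (Suc (Suc (Suc x))) (s' 47 0)))) s1"
    proof (rule vc_mono[OF vc_advance[of c x]])
      fix s2 assume 2: "sweeping c (Suc x) s2 \<and> s2 47 0 = s1 47 0"
      show "vc W advance (vc W advance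
        (\<lambda>s'. sweeping c (Suc (Suc (Suc x))) s' \<and> best_below c (Suc (Suc (Suc x))) (s' 47 0))) s2"
      proof (rule vc_mono[OF vc_advance[of c "Suc x"]])
        fix s3 assume 3: "sweeping c (Suc (Suc x)) s3 \<and> s3 47 0 = s2 47 0"
        show "vc W advance
          (\<lambda>s'. sweeping c (Suc (Suc (Suc x))) s' \<and> best_below c (Suc (Suc (Suc x))) (s' 47 0)) s3"
        proof (rule vc_mono[OF vc_advance[of c "Suc (Suc x)"]])
          fix s4 assume "sweeping c (Suc (Suc (Suc x))) s4 \<and> s4 47 0 = s3 47 0"
          then show "sweeping c (Suc (Suc (Suc x))) s4 \<and> best_below c (Suc (Suc (Suc x))) (s4 47 0)"
            using 1 2 3 best_below_skip[OF _ assms(3)] by simp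
        qed (use 3 x assms(4) in auto)
      qed (use 2 x assms(4) in auto)
    qed (use 1 x assms(4) in auto)
  qed
qed

lemma sweep_end:
  assumes "sweeping c (base + 3 * len c + 3) s" "best_below c (base + 3 * len c + 3) (s 47 0)" "c < k"
  shows "optimum c (s 47 0)" "s 15 = (\<lambda>_. 0)" "s 16 = (\<lambda>_. 0)"
proof -
  let ?x = "base + 3 * len c + 3"
  have hi: "E (Q q) < ?x" if "q \<in> seg c" for q
    using seg_E[OF assms(3) that] by arith
  then have e: "\<not> y < ?x \<Longrightarrow> segtally c (\<lambda>q. E (Q q) = y) = 0"
    "\<not> y < ?x \<Longrightarrow> segtally c (\<lambda>q. E (Q q) = y \<and> frz (Q q) = 0) = 0" for y
    unfolding tally_def by (fastforce intro!: card_eq_0_iff[THEN iffD2])+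
  have "s 15 y = (if y < ?x then 0 else segtally c (\<lambda>q. E (Q q) = y))"
    "s 16 y = (if y < ?x then 0 else segtally c (\<lambda>q. E (Q q) = y \<and> frz (Q q) = 0))" for y
    using assms(1) unfolding sweeping_def by blast+
  then show "s 15 = (\<lambda>_. 0)" "s 16 = (\<lambda>_. 0)"
    using e by (auto simp: fun_eq_iff)
  show "optimum c (s 47 0)"
  proof (rule optimum_from_range[OF assms(3)])
    show "s 47 0 \<le> cost c (int x)"
      if "base \<le> x + 3 * len c" "x \<le> base + 3 * len c" "admissible c (int x)" for x
      using assms(2) that unfolding best_below_def by auto
  qed (use assms(2) in \<open>auto simp: best_below_def\<close>)
qed

lemma wp_sweep:
  assumes "sweeping c x s" "best_below c x (s 47 0)" "3 dvd x" "c < k" "x \<le> base + 3 * len c + 3"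
  shows "wp W sweep s (base + 3 * len c + 3 - x)
    (\<lambda>s. frame s \<and> s 40 0 = c \<and> optimum c (s 47 0) \<and> s 15 = (\<lambda>_. 0) \<and> s 16 = (\<lambda>_. 0))"
  unfolding sweep_def
proof (rule wp_While_vc[where f = "\<lambda>s. base + 3 * len c + 3 - s 42 0" and
      I = "\<lambda>s. sweeping c (s 42 0) s \<and> best_below c (s 42 0) (s 47 0) \<and> 3 dvd s 42 0 \<and> s 42 0 \<le> base + 3 * len c + 3"])
  have "s 42 0 = x" using assms(1) by (simp add: sweeping_def)
  then show "sweeping c (s 42 0) s \<and> best_below c (s 42 0) (s 47 0) \<and> 3 dvd s 42 0 \<and> s 42 0 \<le> base + 3 * len c + 3"
    "base + 3 * len c + 3 - s 42 0 \<le> base + 3 * len c + 3 - x"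
    using assms by auto
next
  fix s :: memory
  assume I: "sweeping c (s 42 0) s \<and> best_below c (s 42 0) (s 47 0) \<and> 3 dvd s 42 0 \<and> s 42 0 \<le> base + 3 * len c + 3"
  then have x1: "s 43 0 = base + 3 * len c + 3" by (simp add: sweeping_def)
  then show "fits W s (Minus (reg 43) (reg 42))"
    using I len_le[OF assms(4)] W_lin by simp
  assume "eval_expr s (Minus (reg 43) (reg 42)) \<noteq> 0"
  then have lt: "s 42 0 < base + 3 * len c + 3" using x1 by simp
  have "3 dvd base + 3 * len c + 3" by simp
  then have x3: "s 42 0 + 3 \<le> base + 3 * len c + 3"
    using dvd3_less I lt by blast
  have "vc W (Seq improve (Seq advance (Seq advance advance)))
    (\<lambda>s'. sweeping c (Suc (Suc (Suc (s 42 0)))) s' \<and> best_below c (Suc (Suc (Suc (s 42 0)))) (s' 47 0)) s"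
    using vc_sweep_body[of c "s 42 0" s] I lt assms(4) by blast
  then show "vc W (Seq improve (Seq advance (Seq advance advance)))
      (\<lambda>s'. (sweeping c (s' 42 0) s' \<and> best_below c (s' 42 0) (s' 47 0) \<and> 3 dvd s' 42 0 \<and>
        s' 42 0 \<le> base + 3 * len c + 3) \<and>
        base + 3 * len c + 3 - s' 42 0 < base + 3 * len c + 3 - s 42 0) s"
  proof (rule vc_mono)
    fix s' assume s': "sweeping c (Suc (Suc (Suc (s 42 0)))) s' \<and> best_below c (Suc (Suc (Suc (s 42 0)))) (s' 47 0)"
    then have "s' 42 0 = Suc (Suc (Suc (s 42 0)))" by (simp add: sweeping_def)
    moreover have "3 dvd Suc (Suc (Suc (s 42 0)))" using I dvd3_Suc by blast
    ultimately show "(sweeping c (s' 42 0) s' \<and> best_below c (s' 42 0) (s' 47 0) \<and> 3 dvd s' 42 0 \<and>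
        s' 42 0 \<le> base + 3 * len c + 3) \<and>
        base + 3 * len c + 3 - s' 42 0 < base + 3 * len c + 3 - s 42 0"
      using s' x3 by auto
  qed
next
  fix s :: memory
  assume I: "sweeping c (s 42 0) s \<and> best_below c (s 42 0) (s 47 0) \<and> 3 dvd s 42 0 \<and> s 42 0 \<le> base + 3 * len c + 3"
    and stop: "eval_expr s (Minus (reg 43) (reg 42)) = 0"
  have "s 43 0 = base + 3 * len c + 3" using I by (simp add: sweeping_def)
  then have "s 42 0 = base + 3 * len c + 3" using I stop by simp
  then have s: "sweeping c (base + 3 * len c + 3) s" "best_below c (base + 3 * len c + 3) (s 47 0)"
    using I by auto
  then have "frame s" "s 40 0 = c" by (auto simp: sweeping_def)
  then show "frame s \<and> s 40 0 = c \<and> optimum c (s 47 0) \<and> s 15 = (\<lambda>_. 0) \<and> s 16 = (\<lambda>_. 0)"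
    using sweep_end[OF s assms(4)] by blast
qed

section \<open>The loop over the components and the test of the arcs\<close>

lemma vc_start_component:
  assumes "frame s" "s 40 0 = c" "c < k" "s 15 = (\<lambda>_. 0)" "s 16 = (\<lambda>_. 0)"
  shows "vc W start_component (filling c (st c)) s"
proof -
  have b: "st c \<le> W" "st (Suc c) \<le> W" "len c \<le> W" "3 * len c \<le> W" "2 * len c \<le> W" "st c \<le> st (Suc c)" "c + 1 \<le> W"
    "base \<le> W" "base + 3 * len c \<le> W" "base + 3 * len c + 3 \<le> W" "base - 3 * len c \<le> W" "l + 1 \<le> W" "3 \<le> W" "1 \<le> W"
    "k \<le> W" "c \<le> W" "l \<le> W" "2 \<le> W"
    using assms(3) st_le_n[of c] st_le_n[of "Suc c"] len_le[of c] st_Suc[of c] k_le W_lin by linarith+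
  have bx: "eval_expr s' base_expr = base" "fits W s' base_expr" if "frame s'" for s'
    using base_expr frameD(10) that by auto
  have tr: "eval_expr s' (triple (reg 49)) = 3 * s' 49 0"
    "fits W s' (triple (reg 49)) \<longleftrightarrow> 0 \<le> W \<and> s' 49 0 \<le> W \<and> 2 * s' 49 0 \<le> W \<and> 3 * s' 49 0 \<le> W" for s'
    by (auto simp: triple_def)
  note fr = frameD[OF assms(1)]
  show ?thesis
    unfolding start_component_def
    apply (rule vc_Seq_set_reg[where v = "st c"])
      apply (simp add: fr assms b)
     apply (simp add: fr assms b)
    apply (rule vc_Seq_set_reg[where v = "len c"])
      apply (use b in \<open>simp add: fr assms b\<close>)
     apply (simp add: fr assms b)
    apply (rule vc_Seq_set_reg[where v = "base - 3 * len c"])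
      apply (simp only: fits.simps bx(2) tr frame_upd rel_simps fun_upd_apply assms(1) b simp_thms if_True if_False)
     apply (simp only: eval_expr.simps bx(1) tr frame_upd rel_simps fun_upd_apply assms(1) simp_thms if_True if_False)
    apply (rule vc_Seq_set_reg[where v = "base + 3 * len c + 3"])
      apply (simp only: eval_expr.simps fits.simps bx tr frame_upd rel_simps fun_upd_apply assms(1) b simp_thms if_True if_False)
     apply (simp only: eval_expr.simps bx(1) tr frame_upd rel_simps fun_upd_apply assms(1) simp_thms if_True if_False)
    apply (rule vc_Seq_set_reg[where v = 0], simp, simp)+
    apply (use b in \<open>simp add: fr assms b filling_def tally_empty\<close>)
    done
qed

text \<open>Filling takes \<open>len c\<close> iterations, and the range of the sweep has width
  \<open>6 * len c + 3\<close>.\<close>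

lemma wp_component:
  assumes "frame s" "s 40 0 = c" "c < k" "s 15 = (\<lambda>_. 0)" "s 16 = (\<lambda>_. 0)" "s 48 0 \<le> n * (l + 1)"
  shows "wp W (Seq start_component (Seq fill (Seq sweep end_component))) s (7 * len c + 3)
    (\<lambda>s'. frame s' \<and> s' 40 0 = Suc c \<and> s' 15 = (\<lambda>_. 0) \<and> s' 16 = (\<lambda>_. 0) \<and>
      (\<exists>m. optimum c m \<and> s' 48 0 = s 48 0 + m))"
proof -
  let ?x = "base - 3 * len c" and ?y = "base + 3 * len c + 3"
  have len: "len c \<le> n" by (rule len_le[OF assms(3)])
  have "wp W start_component s 0 (\<lambda>s'. filling c (st c) s' \<and> s' 48 0 = s 48 0)"
    by (rule wp_mono[OF wp_frame[OF wp_vc[OF vc_start_component[OF assms(1-5)]]]])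
      (auto simp: start_component_def)
  moreover have "wp W fill s1 (len c) (\<lambda>s'. filling c (st (Suc c)) s' \<and> s' 48 0 = s 48 0)"
    if "filling c (st c) s1 \<and> s1 48 0 = s 48 0" for s1
    by (rule wp_mono[OF wp_frame[OF wp_fill[of c s1]]]) (use that assms(3) in \<open>auto simp: fill_def fill_body_def\<close>)
  moreover have "wp W sweep s2 (?y - ?x) (\<lambda>s'. frame s' \<and> s' 40 0 = c \<and> optimum c (s' 47 0) \<and>
      s' 15 = (\<lambda>_. 0) \<and> s' 16 = (\<lambda>_. 0) \<and> s' 48 0 = s 48 0)"
    if "filling c (st (Suc c)) s2 \<and> s2 48 0 = s 48 0" for s2
  proof -
    have "3 dvd ?x"
    proof (rule dvd_diff_nat)
      have "base = 3 * (n + 2)" by simp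
      then show "3 dvd base" by (metis dvd_triv_left)
    qed simp
    then have "wp W sweep s2 (?y - ?x) (\<lambda>s. frame s \<and> s 40 0 = c \<and> optimum c (s 47 0) \<and> s 15 = (\<lambda>_. 0) \<and> s 16 = (\<lambda>_. 0))"
      using that assms(3) by (intro wp_sweep sweeping_start) auto
    from wp_frame[OF this] show ?thesis
      by (rule wp_mono) (use that in \<open>auto simp: sweep_def improve_def advance_def\<close>)
  qed
  moreover have "wp W end_component s3 0 (\<lambda>s'. frame s' \<and> s' 40 0 = Suc c \<and> s' 15 = (\<lambda>_. 0) \<and> s' 16 = (\<lambda>_. 0) \<and>
      (\<exists>m. optimum c m \<and> s' 48 0 = s 48 0 + m))"
    if s3: "frame s3 \<and> s3 40 0 = c \<and> optimum c (s3 47 0) \<and>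
      s3 15 = (\<lambda>_. 0) \<and> s3 16 = (\<lambda>_. 0) \<and> s3 48 0 = s 48 0" for s3
  proof (rule wp_vc)
    have "n * (l + 1) + 3 * (10 * n + 10 * M + 10 * l + 100) \<le> W"
      by (rule W_prod) auto
    moreover have "s3 47 0 \<le> l + 1" using s3 by (simp add: optimum_def)
    moreover have "c < n" using assms(3) k_le by simp
    moreover have "s3 48 0 + s3 47 0 \<le> n * (l + 1) + (l + 1)" using calculation(2) s3 assms(6) by linarith
    ultimately show "vc W end_component (\<lambda>s'. frame s' \<and> s' 40 0 = Suc c \<and> s' 15 = (\<lambda>_. 0) \<and> s' 16 = (\<lambda>_. 0) \<and>
      (\<exists>m. optimum c m \<and> s' 48 0 = s 48 0 + m)) s3"
      using s3 W_lin assms(6) by (auto simp: end_component_def)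
  qed
  ultimately have "wp W (Seq start_component (Seq fill (Seq sweep end_component))) s
      (0 + (len c + ((?y - ?x) + 0))) (\<lambda>s'. frame s' \<and> s' 40 0 = Suc c \<and> s' 15 = (\<lambda>_. 0) \<and> s' 16 = (\<lambda>_. 0) \<and>
      (\<exists>m. optimum c m \<and> s' 48 0 = s 48 0 + m))"
    by (intro wp_Seq)
  moreover have "0 + (len c + ((?y - ?x) + 0)) \<le> 7 * len c + 3"
    using len by linarith
  ultimately show ?thesis by (rule wp_mono)
qed

text \<open>In the potential, 7 per queue position and 3 per component pay for
  \<open>wp_component\<close>, and one more per component pays for the outer iteration. As
  \<open>k \<le> n\<close>, it starts at no more than \<open>11 * n\<close>.\<close>

lemma wp_components:
  assumes "frame s" "s 40 0 = 0" "s 15 = (\<lambda>_. 0)" "s 16 = (\<lambda>_. 0)" "s 48 0 = 0"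
  shows "wp W components s (11 * n) (\<lambda>s. frame s \<and>
    (\<exists>m. (\<forall>c<k. optimum c (m c)) \<and> s 48 0 = (\<Sum>c<k. m c)))"
  unfolding components_def
proof (rule wp_While[where f = "\<lambda>s. 7 * (n - st (s 40 0)) + 4 * (k - s 40 0)" and
    I = "\<lambda>s. frame s \<and> s 40 0 \<le> k \<and> s 15 = (\<lambda>_. 0) \<and> s 16 = (\<lambda>_. 0) \<and>
      (\<exists>m. (\<forall>c<s 40 0. optimum c (m c)) \<and> s 48 0 = (\<Sum>c<s 40 0. m c))"])
  fix s :: memory
  assume I: "frame s \<and> s 40 0 \<le> k \<and> s 15 = (\<lambda>_. 0) \<and> s 16 = (\<lambda>_. 0) \<and>
      (\<exists>m. (\<forall>c<s 40 0. optimum c (m c)) \<and> s 48 0 = (\<Sum>c<s 40 0. m c))"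
  then have fr: "frame s" and k: "s 38 0 = k" by (auto simp: frame_def)
  then show "fits W s (Minus (reg 38) (reg 40))"
    using I k_le W_lin by auto
  assume "eval_expr s (Minus (reg 38) (reg 40)) \<noteq> 0"
  then have c: "s 40 0 < k" using k by simp
  obtain m where m: "\<forall>c<s 40 0. optimum c (m c)" "s 48 0 = (\<Sum>c<s 40 0. m c)"
    using I by blast
  have "(\<Sum>c<s 40 0. m c) \<le> (\<Sum>c<s 40 0. l + 1)"
    using m(1) by (intro sum_mono) (auto simp: optimum_def)
  also have "\<dots> \<le> n * (l + 1)"
    using c k_le by (simp only: sum_constant card_lessThan of_nat_id) (intro mult_right_mono; simp)
  finally have tot: "s 48 0 \<le> n * (l + 1)" using m(2) by simp
  have st: "st (s 40 0) \<le> st (Suc (s 40 0))" "st (Suc (s 40 0)) \<le> n"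
    using c st_Suc st_le_n[of "Suc (s 40 0)"] by auto
  have "wp W (Seq start_component (Seq fill (Seq sweep end_component))) s (7 * len (s 40 0) + 3)
    (\<lambda>s'. frame s' \<and> s' 40 0 = Suc (s 40 0) \<and> s' 15 = (\<lambda>_. 0) \<and> s' 16 = (\<lambda>_. 0) \<and>
      (\<exists>m. optimum (s 40 0) m \<and> s' 48 0 = s 48 0 + m))"
    by (rule wp_component) (use I c tot in auto)
  then have "wp W (Seq start_component (Seq fill (Seq sweep end_component))) s (7 * len (s 40 0) + 3)
    (\<lambda>s'. (frame s' \<and> s' 40 0 \<le> k \<and> s' 15 = (\<lambda>_. 0) \<and> s' 16 = (\<lambda>_. 0) \<and>
      (\<exists>m. (\<forall>c<s' 40 0. optimum c (m c)) \<and> s' 48 0 = (\<Sum>c<s' 40 0. m c))) \<and>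
      7 * (n - st (s' 40 0)) + 4 * (k - s' 40 0) + (7 * len (s 40 0) + 3) + 1 \<le>
      7 * (n - st (s 40 0)) + 4 * (k - s 40 0))"
  proof (rule wp_mono)
    fix s' assume s': "frame s' \<and> s' 40 0 = Suc (s 40 0) \<and> s' 15 = (\<lambda>_. 0) \<and> s' 16 = (\<lambda>_. 0) \<and>
      (\<exists>m. optimum (s 40 0) m \<and> s' 48 0 = s 48 0 + m)"
    then obtain x where x: "optimum (s 40 0) x" "s' 48 0 = s 48 0 + x" by blast
    have "(\<forall>c<Suc (s 40 0). optimum c ((m(s 40 0 := x)) c)) \<and> s' 48 0 = (\<Sum>c<Suc (s 40 0). (m(s 40 0 := x)) c)"
      using m x by (auto simp: less_Suc_eq)
    then have "\<exists>m. (\<forall>c<s' 40 0. optimum c (m c)) \<and> s' 48 0 = (\<Sum>c<s' 40 0. m c)"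
      using s' by metis
    moreover have "7 * (n - st (Suc (s 40 0))) + 4 * (k - Suc (s 40 0)) + (7 * len (s 40 0) + 3) + 1 \<le>
      7 * (n - st (s 40 0)) + 4 * (k - s 40 0)"
      using st c by linarith
    ultimately show "(frame s' \<and> s' 40 0 \<le> k \<and> s' 15 = (\<lambda>_. 0) \<and> s' 16 = (\<lambda>_. 0) \<and>
      (\<exists>m. (\<forall>c<s' 40 0. optimum c (m c)) \<and> s' 48 0 = (\<Sum>c<s' 40 0. m c))) \<and>
      7 * (n - st (s' 40 0)) + 4 * (k - s' 40 0) + (7 * len (s 40 0) + 3) + 1 \<le>
      7 * (n - st (s 40 0)) + 4 * (k - s 40 0)"
      using s' c by simp
  qed simp
  then show "\<exists>ticks. wp W (Seq start_component (Seq fill (Seq sweep end_component))) s ticks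
    (\<lambda>s'. (frame s' \<and> s' 40 0 \<le> k \<and> s' 15 = (\<lambda>_. 0) \<and> s' 16 = (\<lambda>_. 0) \<and>
      (\<exists>m. (\<forall>c<s' 40 0. optimum c (m c)) \<and> s' 48 0 = (\<Sum>c<s' 40 0. m c))) \<and>
      7 * (n - st (s' 40 0)) + 4 * (k - s' 40 0) + ticks + 1 \<le>
      7 * (n - st (s 40 0)) + 4 * (k - s 40 0))"
    by (intro exI[of _ "7 * len (s 40 0) + 3"])
next
  fix s :: memory
  assume I: "frame s \<and> s 40 0 \<le> k \<and> s 15 = (\<lambda>_. 0) \<and> s 16 = (\<lambda>_. 0) \<and>
      (\<exists>m. (\<forall>c<s 40 0. optimum c (m c)) \<and> s 48 0 = (\<Sum>c<s 40 0. m c))"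
    and stop: "eval_expr s (Minus (reg 38) (reg 40)) = 0"
  have "frame s" "s 40 0 \<le> k" using I by blast+
  then have eq: "s 40 0 = k" using stop frameD(9)[of s] by simp
  show "frame s \<and> (\<exists>m. (\<forall>c<k. optimum c (m c)) \<and> s 48 0 = (\<Sum>c<k. m c))"
    using I unfolding eq by blast
qed (use assms k_le in auto)

lemma E_le: "v < n \<Longrightarrow> E v \<le> 4 * n + 10"
proof -
  assume "v < n"
  then obtain p where p: "p < n" "v = Q p" using Q_bij by (auto simp: bij_betw_def)
  then have "cmp (Q p) < k" using cmp_less by simp
  then show ?thesis
    using E_upper[OF p(1)] len_le[of "cmp (Q p)"] p(2) by simp
qed

lemma wp_check_arcs:
  assumes "frame s" "s 50 0 = 0" "s 51 0 = 0"
  shows "wp W check_arcs s M (\<lambda>s. frame s \<and> s 51 0 \<le> M * (8 * n + 20) \<and>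
    (s 51 0 = 0 \<longleftrightarrow> (\<forall>i<M. \<bar>int (E (src i)) - int (E (dst i))\<bar> \<le> 1)))"
  unfolding check_arcs_def
proof (rule wp_While_vc[where f = "\<lambda>s. M - s 50 0" and
    I = "\<lambda>s. frame s \<and> s 50 0 \<le> M \<and> s 51 0 \<le> s 50 0 * (8 * n + 20) \<and>
      (s 51 0 = 0 \<longleftrightarrow> (\<forall>i<s 50 0. \<bar>int (E (src i)) - int (E (dst i))\<bar> \<le> 1))"])
  fix s :: memory
  assume I: "frame s \<and> s 50 0 \<le> M \<and> s 51 0 \<le> s 50 0 * (8 * n + 20) \<and>
      (s 51 0 = 0 \<longleftrightarrow> (\<forall>i<s 50 0. \<bar>int (E (src i)) - int (E (dst i))\<bar> \<le> 1))"
  then have fr: "frame s" by simp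
  then show "fits W s (Minus (Cell 1 (reg 0)) (reg 50))"
    using I A1_n W_lin by (simp add: frameD)
  assume "eval_expr s (Minus (Cell 1 (reg 0)) (reg 50)) \<noteq> 0"
  then have j: "s 50 0 < M" using fr A1_n by (simp add: frameD)
  have sd: "src (s 50 0) < n" "dst (s 50 0) < n" using src_range[OF j] dst_less[OF j] by auto
  have s6: "s 6 (s 50 0) = src (s 50 0)" using fr j by (simp add: frame_def static_def)
  have Es: "E (src (s 50 0)) \<le> 4 * n + 10" "E (dst (s 50 0)) \<le> 4 * n + 10"
    using E_le sd by auto
  have "s 50 0 * (8 * n + 20) + (8 * n + 20) \<le> M * (8 * n + 20)"
    using mult_right_mono[of "Suc (s 50 0)" M "8 * n + 20"] j by simp
  moreover have "M * (8 * n + 20) + 3 * (10 * n + 10 * M + 10 * l + 100) \<le> W"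
    by (rule W_prod) auto
  ultimately have q: "s 51 0 + (8 * n + 20) \<le> W" using I by linarith
  let ?d = "(E (dst (s 50 0)) - Suc (E (src (s 50 0)))) + (E (src (s 50 0)) - Suc (E (dst (s 50 0))))"
  have d: "?d = 0 \<longleftrightarrow> \<bar>int (E (src (s 50 0))) - int (E (dst (s 50 0)))\<bar> \<le> 1" "?d \<le> 8 * n + 20"
    using Es by auto
  have all: "(\<forall>i<Suc (s 50 0). P i) \<longleftrightarrow> (\<forall>i<s 50 0. P i) \<and> P (s 50 0)" for P
    by (auto simp: less_Suc_eq)
  show "vc W (Seq (set_reg 51 (Plus (reg 51)
        (Plus (Minus (Cell 12 (Cell 2 (reg 50))) (Plus (Cell 12 (Cell 6 (reg 50))) (Const 1)))
              (Minus (Cell 12 (Cell 6 (reg 50))) (Plus (Cell 12 (Cell 2 (reg 50))) (Const 1))))))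
     (incr 50)) (\<lambda>s'. (frame s' \<and> s' 50 0 \<le> M \<and> s' 51 0 \<le> s' 50 0 * (8 * n + 20) \<and>
      (s' 51 0 = 0 \<longleftrightarrow> (\<forall>i<s' 50 0. \<bar>int (E (src i)) - int (E (dst i))\<bar> \<le> 1))) \<and> M - s' 50 0 < M - s 50 0) s"
    using I j Es q d W_lin sd
    by (simp add: frameD[OF fr] s6 all)
qed (use assms A1_n in \<open>auto simp: frameD\<close>)

end

definition program :: com where
  "program = Seq fill_mod3 (Seq fill_src (Seq count_keys (Seq peel (Seq bfs
     (Seq components (Seq check_arcs decide))))))"

context laid_out
begin

section \<open>The sum of the component optima decides the instance\<close>

lemma sum_seg: "(\<Sum>v<n. g v) = (\<Sum>c<k. \<Sum>p\<in>seg c. g (Q p))" for g :: "nat \<Rightarrow> nat"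
proof -
  have "(\<Sum>c<d. \<Sum>p\<in>seg c. g (Q p)) = (\<Sum>p\<in>{0..<st d}. g (Q p))" if "d \<le> k" for d
    using that
  proof (induction d)
    case 0
    then show ?case using st_0 by simp
  next
    case (Suc d)
    then show ?case
      using sum.atLeastLessThan_concat[of 0 "st d" "st (Suc d)" "\<lambda>p. g (Q p)"] st_Suc[of d] by simp
  qed
  from this[of k] have "(\<Sum>c<k. \<Sum>p\<in>seg c. g (Q p)) = (\<Sum>p<n. g (Q p))"
    using st_k by (simp add: atLeast0LessThan)
  also have "\<dots> = (\<Sum>v<n. g v)"
    using sum.reindex_bij_betw[OF Q_bij] .
  finally show ?thesis ..
qed

lemma cmp_seg: "c < k \<Longrightarrow> p \<in> seg c \<Longrightarrow> cmp (Q p) = c"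
  using cmp_iff[of p c] seg_less[of c p] by simp

text \<open>A potential is \<open>E\<close> minus one constant per component, and arcs stay inside
  components. So the edge condition does not depend on the constants, while admissibility and cost
  split over the components, which can be optimised separately.\<close>

lemma optimum_correct:
  assumes m: "\<forall>c<k. optimum c (m c)"
  shows "(\<Sum>c<k. m c) \<le> l \<and> (\<forall>i<M. \<bar>int (E (src i)) - int (E (dst i))\<bar> \<le> 1) \<longleftrightarrow>
    (\<exists>F. potential F \<and> (\<forall>v<n. frz v = 0 \<longrightarrow> F v = 0) \<and> (\<Sum>v<n. nat \<bar>F v\<bar>) \<le> l)"
    (is "?L \<longleftrightarrow> ?R")
proof
  assume L: ?L
  have "\<exists>x. admissible c x \<and> cost c x = m c" if c: "c < k" for c
  proof -
    \<comment> \<open>No summand exceeds \<open>l\<close>, so none is the cut-off value and every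
      optimum is attained.\<close>
    have "m c \<le> (\<Sum>c<k. m c)" using c by (intro member_le_sum) auto
    then show ?thesis using m c L unfolding optimum_def by (meson le_trans)
  qed
  then obtain x where x: "\<And>c. c < k \<Longrightarrow> admissible c (x c)" "\<And>c. c < k \<Longrightarrow> cost c (x c) = m c"
    by metis
  let ?F = "\<lambda>v. int (E v) - x (cmp v)"
  have "potential ?F"
    unfolding potential_def
  proof (intro conjI allI impI)
    fix v assume "v < n"
    then obtain p where p: "p < n" "v = Q p" using Q_bij by (auto simp: bij_betw_def)
    have x3: "3 dvd x (cmp v)" using x(1)[OF cmp_less[OF p(1)]] p(2) by (simp add: admissible_def)
    show "3 dvd int (a v) - ?F v - int (b v)"
      using dvd_add[OF E_mod3[OF p(1)] x3] p(2) by (simp add: algebra_simps)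
  next
    fix j assume j: "j < M"
    then show "\<bar>?F (src j) - ?F (dst j)\<bar> \<le> 1" using L cmp_arc[OF j] by simp
  qed
  moreover have "?F v = 0" if v: "v < n" "frz v = 0" for v
  proof -
    obtain p where p: "p < n" "v = Q p" using v Q_bij by (auto simp: bij_betw_def)
    have "p \<in> seg (cmp v)" using cmp_iff[OF p(1) cmp_less[OF p(1)]] p(2) by simp
    then show ?thesis
      using x(1)[OF cmp_less[OF p(1)]] p(2) v(2) by (simp add: admissible_def)
  qed
  moreover have "(\<Sum>v<n. nat \<bar>?F v\<bar>) \<le> l"
  proof -
    have "(\<Sum>p\<in>seg c. nat \<bar>?F (Q p)\<bar>) = m c" if c: "c < k" for c
      unfolding x(2)[OF c, symmetric] cost_def
      by (rule sum.cong) (use cmp_seg[OF c] in auto)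
    then show ?thesis using L by (simp add: sum_seg)
  qed
  ultimately show ?R by blast
next
  assume ?R
  then obtain F where F: "potential F" "\<And>v. v < n \<Longrightarrow> frz v = 0 \<Longrightarrow> F v = 0" "(\<Sum>v<n. nat \<bar>F v\<bar>) \<le> l"
    by blast
  have "m c \<le> (\<Sum>p\<in>seg c. nat \<bar>F (Q p)\<bar>)" if c: "c < k" for c
  proof (cases "seg c = {}")
    \<comment> \<open>The layout permits empty segments; there the value 0 is admissible at cost
      0.\<close>
    case True
    then have "admissible c 0" "cost c 0 = 0" by (simp_all add: admissible_def cost_def)
    then have "m c \<le> 0" using m c unfolding optimum_def by metis
    then show ?thesis by simp
  next
    case False
    then have p0: "st c \<in> seg c" by simp
    define x where "x = int (E (Q (st c))) - F (Q (st c))"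
    have x: "int (E (Q p)) - F (Q p) = x" if p: "p \<in> seg c" for p
      using E_pot[OF F(1), of "Q p" "Q (st c)"] seg_less[OF c] Q_less p p0 cmp_seg[OF c]
      unfolding x_def by simp
    have "3 dvd x"
    proof -
      let ?v = "Q (st c)"
      have "3 dvd int (a ?v) - F ?v - int (b ?v)"
        using F(1) Q_less seg_less[OF c p0] by (simp add: potential_def)
      from dvd_diff[OF this E_mod3[OF seg_less[OF c p0]]] show ?thesis
        by (simp add: x_def)
    qed
    moreover have "int (E (Q p)) = x" if "p \<in> seg c" "frz (Q p) = 0" for p
      using x[OF that(1)] F(2)[OF Q_less[OF seg_less[OF c that(1)]] that(2)] by simp
    ultimately have "admissible c x" by (simp add: admissible_def)
    then have "m c \<le> cost c x" using m c by (simp add: optimum_def)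
    also have "\<dots> = (\<Sum>p\<in>seg c. nat \<bar>F (Q p)\<bar>)"
      unfolding cost_def
    proof (rule sum.cong)
      fix p assume "p \<in> seg c"
      from x[OF this] show "nat \<bar>int (E (Q p)) - x\<bar> = nat \<bar>F (Q p)\<bar>" by (simp add: algebra_simps)
    qed simp
    finally show ?thesis .
  qed
  then have "(\<Sum>c<k. m c) \<le> (\<Sum>c<k. \<Sum>p\<in>seg c. nat \<bar>F (Q p)\<bar>)"
    by (intro sum_mono) auto
  also have "\<dots> \<le> l" using F(3) by (simp add: sum_seg)
  finally have 1: "(\<Sum>c<k. m c) \<le> l" .
  have "\<bar>int (E (src i)) - int (E (dst i))\<bar> \<le> 1" if i: "i < M" for i
  proof -
    have "\<bar>F (src i) - F (dst i)\<bar> \<le> 1" using F(1) i by (simp add: potential_def)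
    moreover have "F (src i) - int (E (src i)) = F (dst i) - int (E (dst i))"
      by (rule E_pot[OF F(1)]) (use src_range[OF i] dst_less[OF i] cmp_arc[OF i] in auto)
    ultimately show ?thesis by linarith
  qed
  then show ?L using 1 by blast
qed

lemma wp_answer:
  assumes "frame s" "\<forall>x\<ge>39. s x = (\<lambda>_. 0)" "s 15 = (\<lambda>_. 0)" "s 16 = (\<lambda>_. 0)"
  shows "wp W (Seq components (Seq check_arcs decide)) s (11 * n + M) (\<lambda>s. answer s =
    (if \<exists>F. potential F \<and> (\<forall>v<n. frz v = 0 \<longrightarrow> F v = 0) \<and> (\<Sum>v<n. nat \<bar>F v\<bar>) \<le> l then 1 else 0))"
proof -
  let ?m = "\<lambda>s. \<exists>m. (\<forall>c<k. optimum c (m c)) \<and> s 48 0 = (\<Sum>c<k. m c)"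
  have tot: "s 48 0 \<le> n * (l + 1)" if ms: "?m s" for s :: memory
  proof -
    obtain m where m: "\<forall>c<k. optimum c (m c)" "s 48 0 = (\<Sum>c<k. m c)" using ms by blast
    have "(\<Sum>c<k. m c) \<le> (\<Sum>c<k. l + 1)"
      using m(1) by (intro sum_mono) (auto simp: optimum_def)
    also have "\<dots> \<le> n * (l + 1)"
      using k_le by (simp only: sum_constant card_lessThan of_nat_id) (intro mult_right_mono; simp)
    finally show ?thesis using m(2) by simp
  qed
  have "wp W components s (11 * n) (\<lambda>s'. (frame s' \<and> ?m s') \<and> s' 50 0 = 0 \<and> s' 51 0 = 0)"
  proof (rule wp_mono[OF wp_frame[OF wp_components]])
    have "50 \<notin> writes components" "51 \<notin> writes components"
      by (simp_all add: components_def start_component_def fill_def fill_body_def sweep_def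
        improve_def advance_def end_component_def)
    then show "(frame s' \<and> ?m s') \<and> s' 50 0 = 0 \<and> s' 51 0 = 0"
      if "(frame s' \<and> ?m s') \<and> (\<forall>x. x \<notin> writes components \<longrightarrow> s' x = s x)" for s'
    proof -
      have "s 50 0 = 0" "s 51 0 = 0" using assms(2) by simp_all
      then show ?thesis using that \<open>50 \<notin> writes components\<close> \<open>51 \<notin> writes components\<close> by metis
    qed
  qed (use assms in auto)
  moreover have "wp W check_arcs s1 M (\<lambda>s'. frame s' \<and> ?m s' \<and> s' 51 0 \<le> M * (8 * n + 20) \<and>
      (s' 51 0 = 0 \<longleftrightarrow> (\<forall>i<M. \<bar>int (E (src i)) - int (E (dst i))\<bar> \<le> 1)))"
    if "(frame s1 \<and> ?m s1) \<and> s1 50 0 = 0 \<and> s1 51 0 = 0" for s1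
  proof (rule wp_mono[OF wp_frame[OF wp_check_arcs[of s1]]])
    have "48 \<notin> writes check_arcs" by (simp add: check_arcs_def)
    then show "frame s' \<and> ?m s' \<and> s' 51 0 \<le> M * (8 * n + 20) \<and>
      (s' 51 0 = 0 \<longleftrightarrow> (\<forall>i<M. \<bar>int (E (src i)) - int (E (dst i))\<bar> \<le> 1))"
      if "(frame s' \<and> s' 51 0 \<le> M * (8 * n + 20) \<and>
      (s' 51 0 = 0 \<longleftrightarrow> (\<forall>i<M. \<bar>int (E (src i)) - int (E (dst i))\<bar> \<le> 1))) \<and>
      (\<forall>x. x \<notin> writes check_arcs \<longrightarrow> s' x = s1 x)" for s'
      using that \<open>(frame s1 \<and> ?m s1) \<and> s1 50 0 = 0 \<and> s1 51 0 = 0\<close> by metis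
  qed (use that in auto)
  moreover have "wp W decide s2 0 (\<lambda>s. answer s =
    (if \<exists>F. potential F \<and> (\<forall>v<n. frz v = 0 \<longrightarrow> F v = 0) \<and> (\<Sum>v<n. nat \<bar>F v\<bar>) \<le> l then 1 else 0))"
    if s2: "frame s2 \<and> ?m s2 \<and> s2 51 0 \<le> M * (8 * n + 20) \<and>
      (s2 51 0 = 0 \<longleftrightarrow> (\<forall>i<M. \<bar>int (E (src i)) - int (E (dst i))\<bar> \<le> 1))" for s2
  proof (rule wp_vc)
    obtain m where m: "\<forall>c<k. optimum c (m c)" "s2 48 0 = (\<Sum>c<k. m c)" using s2 by blast
    have iff: "(s2 48 0 \<le> l \<and> s2 51 0 = 0) \<longleftrightarrow>
      (\<exists>F. potential F \<and> (\<forall>v<n. frz v = 0 \<longrightarrow> F v = 0) \<and> (\<Sum>v<n. nat \<bar>F v\<bar>) \<le> l)"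
      using optimum_correct[OF m(1)] m(2) s2 by simp
    have X: "(n + M) * (10 * n + 10 * l + 100) + 3 * (10 * n + 10 * M + 10 * l + 100) \<le> W"
      by (rule W_prod) auto
    have "s2 48 0 \<le> n * (l + 1)" using tot s2 by blast
    moreover have "n * (l + 1) \<le> n * (10 * n + 10 * l + 100)" "M * (8 * n + 20) \<le> M * (10 * n + 10 * l + 100)"
      by (rule mult_left_mono; simp)+
    ultimately have "s2 48 0 + s2 51 0 \<le> W" "s2 48 0 \<le> W" "s2 51 0 \<le> W"
      using X s2 unfolding add_mult_distrib by linarith+
    moreover have "s2 48 0 - l + s2 51 0 \<le> s2 48 0 + s2 51 0" by simp
    ultimately have b: "s2 48 0 \<le> W" "s2 51 0 \<le> W" "s2 48 0 - l + s2 51 0 \<le> W" by linarith+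
    have "s2 0 2 = l" using s2 frameD(2) by blast
    then have "vc W decide (\<lambda>s. answer s = (if s2 48 0 \<le> l \<and> s2 51 0 = 0 then 1 else 0)) s2"
      using b W_lin by (auto simp: decide_def answer_def)
    then show "vc W decide (\<lambda>s. answer s =
      (if \<exists>F. potential F \<and> (\<forall>v<n. frz v = 0 \<longrightarrow> F v = 0) \<and> (\<Sum>v<n. nat \<bar>F v\<bar>) \<le> l then 1 else 0)) s2"
      unfolding iff .
  qed
  ultimately have "wp W (Seq components (Seq check_arcs decide)) s (11 * n + (M + 0)) (\<lambda>s. answer s =
    (if \<exists>F. potential F \<and> (\<forall>v<n. frz v = 0 \<longrightarrow> F v = 0) \<and> (\<Sum>v<n. nat \<bar>F v\<bar>) \<le> l then 1 else 0))"
    by (intro wp_Seq)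
  then show ?thesis by simp
qed

end

context ram_instance
begin

definition solvable :: bool where
  "solvable \<longleftrightarrow> (\<exists>F. potential F \<and> (\<forall>X. tight_arcs X \<longrightarrow> (\<forall>v\<in>X. F v = 0)) \<and> (\<Sum>v<n. nat \<bar>F v\<bar>) \<le> l)"

text \<open>The assertions \<open>?R1\<close> to \<open>?R5\<close> pass on which arrays are still
  zero between phases, since every phase relies on zero initialisation. The bound is the sum of the
  five iteration counts \<open>c2\<close> to \<open>c6\<close>.\<close>

lemma wp_program:
  assumes "input_ok s" and z: "\<forall>x\<ge>5. s x = (\<lambda>_. 0)"
  shows "wp W program s (16 * n + 5 * M) (\<lambda>s. answer s = (if solvable then 1 else 0))"
proof -
  let ?R1 = "\<lambda>s. input_ok s \<and> (\<forall>k<12. s 5 k = k mod 3) \<and> (\<forall>x\<ge>6. s x = (\<lambda>_. 0))"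
  let ?R2 = "\<lambda>s. static s \<and> (\<forall>x\<ge>7. x \<noteq> 20 \<longrightarrow> x \<noteq> 21 \<longrightarrow> s x = (\<lambda>_. 0))"
  let ?R3 = "\<lambda>s. (static s \<and> (\<forall>x. s 7 x = card {j. j < M \<and> key j = x})) \<and>
    (\<forall>x\<ge>8. x \<noteq> 20 \<longrightarrow> x \<noteq> 21 \<longrightarrow> x \<noteq> 22 \<longrightarrow> s x = (\<lambda>_. 0))"
  let ?fz = "\<lambda>s. (\<forall>u<n. s 8 u \<le> 1) \<and> (\<forall>u<n. s 8 u = 0 \<longleftrightarrow> (\<exists>X. tight_arcs X \<and> u \<in> X))"
  let ?R4 = "\<lambda>s. (static s \<and> ?fz s) \<and> (\<forall>x\<in>{10..16}. s x = (\<lambda>_. 0)) \<and> (\<forall>x\<ge>33. s x = (\<lambda>_. 0))"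
  let ?R5 = "\<lambda>s. static s \<and> layout (s 11) (s 12) (s 13) (s 14) (s 38 0) \<and> ?fz s \<and>
    s 15 = (\<lambda>_. 0) \<and> s 16 = (\<lambda>_. 0) \<and> (\<forall>x\<ge>39. s x = (\<lambda>_. 0))"
  let ?Q = "\<lambda>s. answer s = (if solvable then 1 else 0)"
  have c1: "wp W fill_mod3 s 0 ?R1"
    by (rule wp_mono[OF wp_frame[OF wp_fill_mod3]]) (use assms in \<open>auto simp: fill_mod3_def\<close>)
  have c2: "wp W fill_src s1 (n + M) ?R2" if "?R1 s1" for s1
    by (rule wp_mono[OF wp_frame[OF wp_fill_src]]) (use that in \<open>auto simp: fill_src_def\<close>)
  have c3: "wp W count_keys s2 M ?R3" if "?R2 s2" for s2
    by (rule wp_mono[OF wp_frame[OF wp_count_keys]]) (use that in \<open>auto simp: count_keys_def\<close>)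
  have c4: "wp W peel s3 (2 * n + M) ?R4" if "?R3 s3" for s3
    by (rule wp_mono[OF wp_frame[OF wp_peel]]) (use that in \<open>auto simp: peel_def push_def\<close>)
  have c5: "wp W bfs s4 (2 * n + M) ?R5" if "?R4 s4" for s4
    by (rule wp_mono[OF wp_frame[OF wp_bfs]])
      (use that in \<open>auto simp: bfs_def bfs_loop_def bfs_body_def push_def\<close>)
  have c6: "wp W (Seq components (Seq check_arcs decide)) s5 (11 * n + M) ?Q" if s5: "?R5 s5" for s5
  proof -
    interpret L: laid_out n M l W A1 dst src a b "s5 8" "s5 11" "s5 12" "s5 13" "s5 14" "s5 38 0"
    proof unfold_locales
      show "layout (s5 11) (s5 12) (s5 13) (s5 14) (s5 38 0)" using s5 by blast
      show "s5 8 v \<le> 1" if "v < n" for v using s5 that by blast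
    qed
    have fz: "\<forall>u<n. s5 8 u = 0 \<longleftrightarrow> (\<exists>X. tight_arcs X \<and> u \<in> X)" using s5 by blast
    have sub: "u < n" if "tight_arcs X" "u \<in> X" for u X
      using that by (auto simp: tight_arcs_def)
    have "(\<forall>v<n. s5 8 v = 0 \<longrightarrow> F v = 0) \<longleftrightarrow> (\<forall>X. tight_arcs X \<longrightarrow> (\<forall>v\<in>X. F v = 0))" for F :: "nat \<Rightarrow> int"
    proof
      assume F: "\<forall>v<n. s5 8 v = 0 \<longrightarrow> F v = 0"
      show "\<forall>X. tight_arcs X \<longrightarrow> (\<forall>v\<in>X. F v = 0)"
      proof (intro allI impI ballI)
        fix X v assume X: "tight_arcs X" "v \<in> X"
        then have "s5 8 v = 0" using fz sub[OF X] by blast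
        then show "F v = 0" using F sub[OF X] by blast
      qed
    next
      assume F: "\<forall>X. tight_arcs X \<longrightarrow> (\<forall>v\<in>X. F v = 0)"
      show "\<forall>v<n. s5 8 v = 0 \<longrightarrow> F v = 0"
      proof (intro allI impI)
        fix v assume "v < n" "s5 8 v = 0"
        then obtain X where "tight_arcs X" "v \<in> X" using fz by blast
        then show "F v = 0" using F by blast
      qed
    qed
    then have "solvable \<longleftrightarrow>
      (\<exists>F. potential F \<and> (\<forall>v<n. s5 8 v = 0 \<longrightarrow> F v = 0) \<and> (\<Sum>v<n. nat \<bar>F v\<bar>) \<le> l)"
      by (simp add: solvable_def)
    moreover have "static s5" using s5 by blast
    then have "L.frame s5" by (simp add: L.frame_def)
    moreover have "\<forall>x\<ge>39. s5 x = (\<lambda>_. 0)" "s5 15 = (\<lambda>_. 0)" "s5 16 = (\<lambda>_. 0)" using s5 by blast+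
    ultimately show ?thesis using L.wp_answer[of s5] by presburger
  qed
  have "wp W program s (0 + ((n + M) + (M + ((2 * n + M) + ((2 * n + M) + (11 * n + M)))))) ?Q"
    unfolding program_def
    by (rule wp_Seq[OF c1], rule wp_Seq[OF c2], assumption, rule wp_Seq[OF c3], assumption,
        rule wp_Seq[OF c4], assumption, rule wp_Seq[OF c5], assumption, erule c6)
  then show ?thesis by (rule wp_mono) auto
qed

end

section \<open>The input encoding\<close>

lemma nth_concat:
  assumes "i < length xs" "k < length (xs ! i)"
  shows "concat xs ! (sum_list (map length (take i xs)) + k) = xs ! i ! k"
  using assms
proof (induction xs arbitrary: i)
  case (Cons x xs)
  then show ?case by (cases i) (auto simp: nth_append add.assoc)
qed simp

lemma triple_add_inj: "r < 3 \<Longrightarrow> e < 3 \<Longrightarrow> 3 * x + r = 3 * u + e \<longleftrightarrow> x = u \<and> r = e"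
  for x r u e :: nat
  by presburger

lemma le_four_square: "x \<le> 4 * (x * x)" for x :: nat
  by (cases x) auto

locale colouring_input =
  fixes G :: "nat graph" and n m :: nat and adj :: "nat \<Rightarrow> nat list" and \<alpha> \<beta> :: "nat \<Rightarrow> nat" and l :: nat
  assumes G: "simple_graph G" and V: "verts G = {..<n}" and m: "card (edges G) = m"
    and adj: "adjacency_lists G adj"
    and \<alpha>: "\<alpha> \<in> proper_colourings 3 G" and \<beta>: "\<beta> \<in> proper_colourings 3 G" and l: "l > 0"
begin

definition offset :: "nat \<Rightarrow> nat" where
  "offset v = (\<Sum>u<v. length (adj u))"

abbreviation M :: nat where "M \<equiv> offset n"
abbreviation input :: memory where "input \<equiv> input_memory G adj \<alpha> \<beta> l"

text \<open>Vertices with empty lists share their offset with the next vertex; taking the first list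
  that ends beyond \<open>j\<close> selects the owner of the arc.\<close>

definition src :: "nat \<Rightarrow> nat" where
  "src j = (LEAST v. j < offset (Suc v))"

abbreviation dst :: "nat \<Rightarrow> nat" where
  "dst \<equiv> input 2"

lemma offset_Suc: "offset (Suc v) = offset v + length (adj v)"
  by (simp add: offset_def)

lemma offset_mono: "v \<le> w \<Longrightarrow> offset v \<le> offset w"
  unfolding offset_def by (intro sum_mono2) auto

lemma adj_set: "v < n \<Longrightarrow> u \<in> set (adj v) \<longleftrightarrow> {v, u} \<in> edges G"
  using adj V by (auto simp: adjacency_lists_def)

lemma input_cells:
  "input 0 0 = n" "input 0 2 = l" "v \<le> n \<Longrightarrow> input 1 v = offset v"
  "v < n \<Longrightarrow> input 3 v = \<alpha> v" "v < n \<Longrightarrow> input 4 v = \<beta> v" "x \<ge> 5 \<Longrightarrow> input x = (\<lambda>_. 0)"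
proof -
  have c: "card (verts G) = n" using V by simp
  show "input 0 0 = n" "input 0 2 = l" "x \<ge> 5 \<Longrightarrow> input x = (\<lambda>_. 0)"
    using c by (auto simp: input_memory_def Let_def cells_of_list_def)
  show "v \<le> n \<Longrightarrow> input 1 v = offset v"
    using c by (auto simp: input_memory_def Let_def cells_of_list_def offset_def nth_append simp del: upt_Suc)
  show "v < n \<Longrightarrow> input 3 v = \<alpha> v" "v < n \<Longrightarrow> input 4 v = \<beta> v"
    using c by (auto simp: input_memory_def Let_def cells_of_list_def)
qed

lemma input_dst:
  assumes "v < n" "i < length (adj v)"
  shows "dst (offset v + i) = adj v ! i"
proof -
  let ?xs = "map adj [0..<n]"
  have sum: "sum_list (map length (take w ?xs)) = offset w" if "w \<le> n" for w
    using that
  proof (induction w)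
    case (Suc w)
    then show ?case by (simp add: take_Suc_conv_app_nth offset_Suc)
  qed (simp add: offset_def)
  have "concat ?xs ! (offset v + i) = ?xs ! v ! i"
    using nth_concat[of v ?xs i] sum[of v] assms by simp
  moreover have "offset v + i < length (concat ?xs)"
  proof -
    have "offset v + i < offset (Suc v)" using assms by (simp add: offset_Suc)
    also have "\<dots> \<le> M" using assms by (intro offset_mono) simp
    also have "M = length (concat ?xs)" using sum[of n] by (simp add: length_concat)
    finally show ?thesis .
  qed
  moreover have "card (verts G) = n" using V by simp
  ultimately show ?thesis
    using assms by (simp add: input_memory_def Let_def cells_of_list_def)
qed

lemma src_eq:
  assumes "offset v \<le> j" "j < offset (Suc v)"
  shows "src j = v"
  unfolding src_def
proof (rule Least_equality)
  show "j < offset (Suc v)" by (rule assms)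
  fix w assume w: "j < offset (Suc w)"
  show "v \<le> w"
  proof (rule ccontr)
    assume "\<not> v \<le> w"
    then have "offset (Suc w) \<le> offset v" by (intro offset_mono) simp
    then show False using w assms(1) by simp
  qed
qed

lemma src_range:
  assumes "j < M"
  shows "src j < n" "offset (src j) \<le> j" "j < offset (Suc (src j))"
proof -
  have "n \<noteq> 0"
  proof
    assume "n = 0"
    then have "M = 0" by (simp add: offset_def)
    then show False using assms by simp
  qed
  then have ex: "j < offset (Suc (n - 1))" using assms by simp
  show 1: "j < offset (Suc (src j))"
    unfolding src_def by (rule LeastI[of "\<lambda>v. j < offset (Suc v)", OF ex])
  have "src j \<le> n - 1" unfolding src_def by (rule Least_le[of "\<lambda>v. j < offset (Suc v)", OF ex])
  then show "src j < n" using \<open>n \<noteq> 0\<close> by simp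
  show "offset (src j) \<le> j"
  proof (cases "src j")
    case 0
    then show ?thesis by (simp add: offset_def)
  next
    case (Suc w)
    then have "\<not> j < offset (Suc w)" using not_less_Least[of w "\<lambda>v. j < offset (Suc v)"] by (simp add: src_def)
    then show ?thesis using Suc by simp
  qed
qed

lemma arc_iff: "(\<exists>j<M. src j = v \<and> dst j = u) \<longleftrightarrow> {v, u} \<in> edges G"
proof
  assume "\<exists>j<M. src j = v \<and> dst j = u"
  then obtain j where j: "j < M" "src j = v" "dst j = u" by blast
  note r = src_range[OF j(1), unfolded j(2)]
  have "j - offset v < length (adj v)" "j = offset v + (j - offset v)"
    using r by (auto simp: offset_Suc)
  then have "u \<in> set (adj v)" using input_dst[OF r(1)] j(3) by (metis nth_mem)
  then show "{v, u} \<in> edges G" using adj_set[OF r(1)] by simp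
next
  assume e: "{v, u} \<in> edges G"
  then have v: "v < n" using simple_graph_edgeD[OF G e] V by auto
  then obtain i where i: "i < length (adj v)" "adj v ! i = u"
    using e adj_set[OF v] by (auto simp: in_set_conv_nth)
  have lt: "offset v + i < offset (Suc v)" using i by (simp add: offset_Suc)
  also have "\<dots> \<le> M" using v by (intro offset_mono) simp
  finally show "\<exists>j<M. src j = v \<and> dst j = u"
    using src_eq[of v "offset v + i"] lt input_dst[OF v i(1)] i(2) by auto
qed

lemma arc_edge: "j < M \<Longrightarrow> {src j, dst j} \<in> edges G"
  using arc_iff[of "src j" "dst j"] by auto

text \<open>Double counting of incidences: each adjacency list injects into the edges at its vertex,
  and an edge has two ends.\<close>

lemma M_le: "M \<le> 2 * m"
proof -
  have fin: "finite (edges G)"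
  proof (rule finite_subset)
    show "edges G \<subseteq> Pow (verts G)" using G by (auto simp: simple_graph_def)
    show "finite (Pow (verts G))" using V by simp
  qed
  have "length (adj v) \<le> card {e \<in> edges G. v \<in> e}" if v: "v < n" for v
  proof -
    have "length (adj v) = card (set (adj v))"
    proof -
      have "distinct (adj v)" using adj V v by (simp add: adjacency_lists_def)
      then show ?thesis by (simp add: distinct_card)
    qed
    also have "\<dots> \<le> card {e \<in> edges G. v \<in> e}"
    proof (rule card_inj_on_le)
      show "inj_on (\<lambda>u. {v, u}) (set (adj v))" by (auto simp: inj_on_def doubleton_eq_iff)
      show "(\<lambda>u. {v, u}) ` set (adj v) \<subseteq> {e \<in> edges G. v \<in> e}" using adj_set[OF v] by auto
      show "finite {e \<in> edges G. v \<in> e}" using fin by simp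
    qed
    finally show ?thesis .
  qed
  then have "M \<le> (\<Sum>v<n. card {e \<in> edges G. v \<in> e})"
    unfolding offset_def by (intro sum_mono) auto
  also have "\<dots> = (\<Sum>v<n. \<Sum>e\<in>edges G. if v \<in> e then 1 else 0)"
    using fin by (simp add: sum.If_cases Int_def)
  also have "\<dots> = (\<Sum>e\<in>edges G. \<Sum>v<n. if v \<in> e then 1 else 0)"
    by (rule sum.swap)
  also have "\<dots> \<le> (\<Sum>e\<in>edges G. 2)"
  proof (rule sum_mono)
    fix e assume e: "e \<in> edges G"
    then have "{..<n} \<inter> e = e" "card e = 2" using G V by (auto simp: simple_graph_def)
    then show "(\<Sum>v<n. if v \<in> e then 1 else 0) \<le> (2::nat)"
      by (simp add: sum.If_cases)
  qed
  also have "\<dots> = 2 * m" using m by simp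
  finally show ?thesis .
qed

section \<open>Constants of the word size and of the running time\<close>

abbreviation W :: "nat \<Rightarrow> nat" where "W K \<equiv> (n + m + l + 2) ^ K"

text \<open>With \<open>N = n + m + l + 2\<close>, the linear bound is at most
  \<open>40 * N\<close>, so four times its square is \<open>6400 * N ^ 2\<close>. From
  \<open>l > 0\<close> follows \<open>N \<ge> 3\<close>, and 6400 is below \<open>3 ^ 8\<close> =
  6561; thus the exponent 8 + 2 = 10.\<close>

lemma W_large:
  assumes "K \<ge> 10"
  shows "4 * ((10 * n + 10 * M + 10 * l + 100) * (10 * n + 10 * M + 10 * l + 100)) \<le> W K"
proof -
  define N where "N = n + m + l + 2"
  let ?X = "10 * n + 10 * M + 10 * l + 100"
  have N: "N \<ge> 3" using l by (simp add: N_def)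
  have "?X \<le> 40 * N" using M_le l by (simp add: N_def)
  then have "?X * ?X \<le> (40 * N) * (40 * N)"
    by (intro mult_mono) auto
  then have "4 * (?X * ?X) \<le> 4 * ((40 * N) * (40 * N))" by (rule mult_left_mono) simp
  also have "\<dots> = 6400 * N ^ 2" by (simp add: power2_eq_square)
  also have "\<dots> \<le> 3 ^ 8 * N ^ 2" by (intro mult_right_mono) auto
  also have "\<dots> \<le> N ^ 8 * N ^ 2" using N by (intro mult_right_mono power_mono) auto
  also have "\<dots> = N ^ 10" by (simp add: power_add[symmetric])
  also have "\<dots> \<le> N ^ K" using assms N by (intro power_increasing) auto
  finally show ?thesis unfolding N_def .
qed

lemma ram:
  assumes "K \<ge> 10"
  shows "ram_instance n M l (W K) (input 1) dst src (input 3) (input 4)"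
proof
  let ?X = "10 * n + 10 * M + 10 * l + 100"
  show "?X \<le> W K" by (rule order_trans[OF le_four_square W_large[OF assms]])
  show "4 * (?X * ?X) \<le> W K" by (rule W_large[OF assms])
  show "input 1 0 = 0" "input 1 n = M"
    using input_cells(3)[of 0] input_cells(3)[of n] by (simp_all add: offset_def)
  show "input 1 v \<le> input 1 (Suc v)" if "v < n" for v
    using that input_cells(3)[of v] input_cells(3)[of "Suc v"] by (simp add: offset_Suc)
  show "src j = v" if "v < n" "input 1 v \<le> j" "j < input 1 (Suc v)" for v j
    using that input_cells(3)[of v] input_cells(3)[of "Suc v"] by (intro src_eq) simp_all
  fix j
  assume j: "j < M"
  note r = src_range[OF j] and e = arc_edge[OF j]
  have d: "dst j < n" using simple_graph_edgeD[OF G e] V by auto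
  show "dst j < n" by fact
  show "src j < n \<and> input 1 (src j) \<le> j \<and> j < input 1 (Suc (src j))"
    using r input_cells(3)[of "src j"] input_cells(3)[of "Suc (src j)"] by simp
  show "input 3 (src j) \<noteq> input 3 (dst j)"
    using r(1) d proper_neq[OF \<alpha> e] by (simp add: input_cells(4))
  show "\<exists>j'<M. src j' = dst j \<and> dst j' = src j"
    using e arc_iff[of "dst j" "src j"] by (simp add: insert_commute)
next
  fix v assume v: "v < n"
  then have "v \<in> verts G" using V by simp
  then have "1 \<le> \<alpha> v \<and> \<alpha> v \<le> 3" "1 \<le> \<beta> v \<and> \<beta> v \<le> 3"
    using colour_range[OF \<alpha>] colour_range[OF \<beta>] by fastforce+
  then show "1 \<le> input 3 v \<and> input 3 v \<le> 3" "1 \<le> input 4 v \<and> input 4 v \<le> 3"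
    unfolding input_cells(4,5)[OF v] by blast+
qed

lemma solvable_iff:
  assumes "(K :: nat) \<ge> 10"
  shows "ram_instance.solvable n M l dst src (input 3) (input 4) \<longleftrightarrow> colouring_reconfiguration 3 G \<alpha> \<beta> l"
proof -
  interpret R: ram_instance n M l "W K" "input 1" dst src "input 3" "input 4"
    by (rule ram[OF assms])
  have pot: "R.potential F \<longleftrightarrow> shift G \<alpha> \<beta> F" for F
  proof -
    have "(\<forall>v<n. 3 dvd int (input 3 v) - F v - int (input 4 v)) \<longleftrightarrow>
        (\<forall>v\<in>verts G. 3 dvd int (\<alpha> v) - F v - int (\<beta> v))"
      using V by (simp add: input_cells(4,5) Ball_def)
    moreover have "(\<forall>j<M. \<bar>F (src j) - F (dst j)\<bar> \<le> 1) \<longleftrightarrow>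
        (\<forall>u v. {u, v} \<in> edges G \<longrightarrow> \<bar>F u - F v\<bar> \<le> 1)"
    proof
      assume F: "\<forall>j<M. \<bar>F (src j) - F (dst j)\<bar> \<le> 1"
      show "\<forall>u v. {u, v} \<in> edges G \<longrightarrow> \<bar>F u - F v\<bar> \<le> 1"
      proof (intro allI impI)
        fix u v assume "{u, v} \<in> edges G"
        then obtain j where "j < M" "src j = u" "dst j = v" using arc_iff[of u v] by auto
        then show "\<bar>F u - F v\<bar> \<le> 1" using F by auto
      qed
    next
      assume "\<forall>u v. {u, v} \<in> edges G \<longrightarrow> \<bar>F u - F v\<bar> \<le> 1"
      then show "\<forall>j<M. \<bar>F (src j) - F (dst j)\<bar> \<le> 1"
        using arc_edge by simp
    qed
    ultimately show ?thesis by (simp add: R.potential_def shift_def)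
  qed
  \<comment> \<open>In \<open>key\<close>, the vertex \<open>u\<close> is the target and the
    difference is source minus target, so sources play the part of the neighbours in
    \<open>tight\<close>.\<close>
  have step: "(\<exists>j<M. src j \<in> X \<and> R.key j = 3 * u + nat d) \<longleftrightarrow>
      (\<exists>v\<in>X. {u, v} \<in> edges G \<and> (int (\<alpha> v) - int (\<alpha> u)) mod 3 = d)"
    if d: "d = 1 \<or> d = 2" for X u d
  proof -
    have key: "R.key j = 3 * u + nat d \<longleftrightarrow> dst j = u \<and> (int (\<alpha> (src j)) - int (\<alpha> u)) mod 3 = d"
      if j: "j < M" for j
    proof -
      have r: "src j < n" "dst j < n" using src_range[OF j] R.dst_less[OF j] by auto
      have "src j \<in> verts G" "dst j \<in> verts G" using r V by simp_all
      then have c: "\<alpha> (src j) \<le> 3" "\<alpha> (dst j) \<le> 3"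
        using colour_range[OF \<alpha>] by fastforce+
      let ?r = "(\<alpha> (src j) + 3 - \<alpha> (dst j)) mod 3"
      have "?r < 3" by simp
      then have "3 * dst j + ?r = 3 * u + nat d \<longleftrightarrow> dst j = u \<and> ?r = nat d"
        using d by (intro triple_add_inj) auto
      moreover have "int ?r = (int (\<alpha> (src j)) - int (\<alpha> (dst j))) mod 3"
      proof -
        have "int ?r = (int (\<alpha> (src j)) - int (\<alpha> (dst j)) + 3) mod 3"
          using c by (simp add: zmod_int of_nat_diff algebra_simps)
        then show ?thesis by simp
      qed
      ultimately show ?thesis
        using d r by (auto simp: R.key_def input_cells(4))
    qed
    have "(\<exists>j<M. src j \<in> X \<and> R.key j = 3 * u + nat d) \<longleftrightarrow>
      (\<exists>v\<in>X. (\<exists>j<M. src j = v \<and> dst j = u) \<and> (int (\<alpha> v) - int (\<alpha> u)) mod 3 = d)"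
    proof
      assume "\<exists>j<M. src j \<in> X \<and> R.key j = 3 * u + nat d"
      then obtain j where j: "j < M" "src j \<in> X" "R.key j = 3 * u + nat d" by blast
      then have "dst j = u \<and> (int (\<alpha> (src j)) - int (\<alpha> u)) mod 3 = d" using key by blast
      then show "\<exists>v\<in>X. (\<exists>j<M. src j = v \<and> dst j = u) \<and> (int (\<alpha> v) - int (\<alpha> u)) mod 3 = d"
        using j by blast
    next
      assume "\<exists>v\<in>X. (\<exists>j<M. src j = v \<and> dst j = u) \<and> (int (\<alpha> v) - int (\<alpha> u)) mod 3 = d"
      then obtain j where j: "j < M" "src j \<in> X" "dst j = u" "(int (\<alpha> (src j)) - int (\<alpha> u)) mod 3 = d"
        by blast
      then have "R.key j = 3 * u + nat d" using key by blast
      then show "\<exists>j<M. src j \<in> X \<and> R.key j = 3 * u + nat d" using j by blast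
    qed
    then show ?thesis by (simp add: arc_iff insert_commute)
  qed
  have tight: "R.tight_arcs X \<longleftrightarrow> tight G \<alpha> X" for X
    unfolding R.tight_arcs_def tight_def
    using step[of 1 X] step[of 2 X] V by simp
  show ?thesis
    unfolding colouring_reconfiguration_iff_shift[OF G \<alpha> \<beta>] R.solvable_def pot tight V ..
qed

lemma exec_program:
  assumes "K \<ge> 10" "K \<ge> 16 * code_size program"
  shows "\<exists>t s. exec (W K) program input t s \<and> t \<le> K * (n + m + 1) \<and>
    answer s = (if colouring_reconfiguration 3 G \<alpha> \<beta> l then 1 else 0)"
proof -
  interpret R: ram_instance n M l "W K" "input 1" dst src "input 3" "input 4"
    by (rule ram[OF assms(1)])
  have "R.input_ok input"
    unfolding R.input_ok_def by (simp add: input_cells(1,2))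
  moreover have "\<forall>x\<ge>5. input x = (\<lambda>_. 0)" using input_cells(6) by blast
  ultimately have "wp (W K) program input (16 * n + 5 * M) (\<lambda>s. answer s = (if R.solvable then 1 else 0))"
    by (rule R.wp_program)
  then obtain t s where ts: "exec (W K) program input t s" "t \<le> code_size program * (16 * n + 5 * M + 1)"
    "answer s = (if R.solvable then 1 else 0)"
    by (auto simp: wp_def)
  \<comment> \<open>By \<open>M_le\<close>, \<open>5 * M\<close> is at most
    \<open>10 * m\<close>.\<close>
  have "16 * n + 5 * M + 1 \<le> 16 * (n + m + 1)" using M_le by simp
  then have "code_size program * (16 * n + 5 * M + 1) \<le> code_size program * (16 * (n + m + 1))"
    by (rule mult_left_mono) simp
  also have "\<dots> = 16 * code_size program * (n + m + 1)" by (simp only: mult.assoc mult.left_commute)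
  also have "\<dots> \<le> K * (n + m + 1)" using assms(2) by (rule mult_right_mono) simp
  finally have "t \<le> K * (n + m + 1)" using ts(2) by linarith
  then show ?thesis
    unfolding solvable_iff[OF assms(1), symmetric] using ts(1,3) by blast
qed

end

theorem theorem1:
  "\<exists>(P :: com) (K :: nat).
     \<forall>(G :: nat graph) (n :: nat) (m :: nat) (adj :: nat \<Rightarrow> nat list)
        (\<alpha> :: nat \<Rightarrow> nat) (\<beta> :: nat \<Rightarrow> nat) (l :: nat).
       simple_graph G \<and> verts G = {..<n} \<and> card (edges G) = m \<and> adjacency_lists G adj \<and>
       \<alpha> \<in> proper_colourings 3 G \<and> \<beta> \<in> proper_colourings 3 G \<and> l > 0 \<longrightarrow>
       (\<exists>t s. exec ((n + m + l + 2) ^ K) P (input_memory G adj \<alpha> \<beta> l) t s \<and>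
              t \<le> K * (n + m + 1) \<and>
              answer s = (if colouring_reconfiguration 3 G \<alpha> \<beta> l then 1 else 0))"
proof (rule exI[of _ program], rule exI[of _ "16 * code_size program + 10"], intro allI impI)
  fix G :: "nat graph" and n m :: nat and adj :: "nat \<Rightarrow> nat list" and \<alpha> \<beta> :: "nat \<Rightarrow> nat" and l :: nat
  assume "simple_graph G \<and> verts G = {..<n} \<and> card (edges G) = m \<and> adjacency_lists G adj \<and>
    \<alpha> \<in> proper_colourings 3 G \<and> \<beta> \<in> proper_colourings 3 G \<and> l > 0"
  then interpret colouring_input G n m adj \<alpha> \<beta> l
    by unfold_locales auto
  \<comment> \<open>A single constant serves twice: as time factor it must reach
    \<open>16 * code_size program\<close>, as word exponent 10.\<close>
  show "\<exists>t s. exec ((n + m + l + 2) ^ (16 * code_size program + 10)) program (input_memory G adj \<alpha> \<beta> l) t s \<and>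
      t \<le> (16 * code_size program + 10) * (n + m + 1) \<and>
      answer s = (if colouring_reconfiguration 3 G \<alpha> \<beta> l then 1 else 0)"
    by (rule exec_program) simp_all
qed

end
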